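(* Consider the coordinator model in which $s$ servers hold blocks $A^{(1)},\dots,A^{(s)}$ (each with $d$ columns) of a matrix $A=[A^{(1)};\dots;A^{(s)}]$. There is a protocol that constructs a $(1\pm\epsilon)$-distortion $\ell_2$ subspace embedding for $A$, which runs in $O(\log d)$ rounds and uses $\widetilde{O}(sd+\epsilon^{-2}d^2)$ communication. Moreover, the servers collectively receive a total of only $\widetilde{O}(s)$ bits from the coordinator.
   Context: Coordinator model: servers communicate only with the coordinator; communication is measured as the amount sent between servers and the coordinator. A $(1\pm\epsilon)$-distortion $\ell_2$ subspace embedding for $A$ is a matrix $S$ (held by the coordinator, here possibly together with the sketched matrix $SA$) such that $\|SAx\|_2=(1\pm\epsilon)\|Ax\|_2$ for all $x\in\mathbb{R}^d$. $\widetilde{O}$ hides polylogarithmic factors. *)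

theory Defs
  imports "HOL-Probability.Product_PMF" "Jordan_Normal_Form.Matrix"
begin

section \<open>Randomised protocols in the coordinator model\<close>

text \<open>
  Servers \<open>0, \<dots>, s - 1\<close> hold private inputs and exchange bit strings with the coordinator
  only. In every round the coordinator sends one (possibly empty) message to each server and then
  every server answers with one (possibly empty) message. Randomness is private and there is no
  shared random string, so a seed that several parties are to use has to be communicated. Coins are
  drawn from arbitrary discrete distributions, independently for all parties. Local computation is
  free, and the parties know the protocol, hence every parameter it was chosen for.

  The coordinator sees its coins and the answers of the previous rounds (one list of answers,
  indexed by server, per round). A server sees its index, its input, its coins and the messages it
  has received so far, including that of the current round.
\<close>

record ('i, 'o) protocol =
  rounds :: nat
  coord_coins :: "nat pmf"
  server_coins :: "nat \<Rightarrow> nat pmf"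
  coord_msg :: "nat \<Rightarrow> bool list list list \<Rightarrow> nat \<Rightarrow> bool list"
  server_msg :: "nat \<Rightarrow> 'i \<Rightarrow> nat \<Rightarrow> bool list list \<Rightarrow> bool list"
  result :: "nat \<Rightarrow> bool list list list \<Rightarrow> 'o"

definition coins :: "('i, 'o) protocol \<Rightarrow> nat \<Rightarrow> (nat \<times> (nat \<Rightarrow> nat)) pmf" where
  "coins P s = pair_pmf (coord_coins P) (Pi_pmf {..<s} 0 (server_coins P))"

text \<open>The messages server \<open>i\<close> receives in the first \<open>r\<close> rounds; \<open>h\<close> contains the answers of at
  least the first \<open>r - 1\<close> rounds.\<close>

definition received ::
  "('i, 'o) protocol \<Rightarrow> nat \<Rightarrow> bool list list list \<Rightarrow> nat \<Rightarrow> nat \<Rightarrow> bool list list" where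
  "received P c h i r = map (\<lambda>u. coord_msg P c (take u h) i) [0..<r]"

text \<open>The answers of the servers in the first \<open>r\<close> rounds, on the inputs \<open>X\<close> (one per server) and
  the outcome \<open>\<omega>\<close> of all coins.\<close>

primrec answers ::
  "('i, 'o) protocol \<Rightarrow> 'i list \<Rightarrow> nat \<times> (nat \<Rightarrow> nat) \<Rightarrow> nat \<Rightarrow> bool list list list" where
  "answers P X \<omega> 0 = []"
| "answers P X \<omega> (Suc r) =
     (let h = answers P X \<omega> r in
      h @ [map (\<lambda>i. server_msg P i (X ! i) (snd \<omega> i) (received P (fst \<omega>) h i (Suc r)))
             [0..<length X]])"

definition transcript ::
  "('i, 'o) protocol \<Rightarrow> 'i list \<Rightarrow> nat \<times> (nat \<Rightarrow> nat) \<Rightarrow> bool list list list" where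
  "transcript P X \<omega> = answers P X \<omega> (rounds P)"

definition protocol_output ::
  "('i, 'o) protocol \<Rightarrow> 'i list \<Rightarrow> nat \<times> (nat \<Rightarrow> nat) \<Rightarrow> 'o" where
  "protocol_output P X \<omega> = result P (fst \<omega>) (transcript P X \<omega>)"

definition bits_to_servers ::
  "('i, 'o) protocol \<Rightarrow> 'i list \<Rightarrow> nat \<times> (nat \<Rightarrow> nat) \<Rightarrow> nat" where
  "bits_to_servers P X \<omega> =
     (\<Sum>i<length X. sum_list (map length
        (received P (fst \<omega>) (transcript P X \<omega>) i (rounds P))))"

definition bits_to_coordinator ::
  "('i, 'o) protocol \<Rightarrow> 'i list \<Rightarrow> nat \<times> (nat \<Rightarrow> nat) \<Rightarrow> nat" where
  "bits_to_coordinator P X \<omega> =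
     sum_list (map (\<lambda>ms. sum_list (map length ms)) (transcript P X \<omega>))"

definition total_bits ::
  "('i, 'o) protocol \<Rightarrow> 'i list \<Rightarrow> nat \<times> (nat \<Rightarrow> nat) \<Rightarrow> nat" where
  "total_bits P X \<omega> = bits_to_servers P X \<omega> + bits_to_coordinator P X \<omega>"


section \<open>Subspace embeddings of a distributed matrix\<close>

definition l2_norm :: "real vec \<Rightarrow> real" where
  "l2_norm v = sqrt (scalar_prod v v)"

text \<open>The number of rows of \<open>S\<close> is arbitrary.\<close>

definition subspace_embedding :: "real \<Rightarrow> real mat \<Rightarrow> real mat \<Rightarrow> bool" where
  "subspace_embedding \<epsilon> A S \<longleftrightarrow>
     dim_col S = dim_row A \<and>
     (\<forall>x \<in> carrier_vec (dim_col A).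
        (1 - \<epsilon>) * l2_norm (A *\<^sub>v x) \<le> l2_norm ((S * A) *\<^sub>v x) \<and>
        l2_norm ((S * A) *\<^sub>v x) \<le> (1 + \<epsilon>) * l2_norm (A *\<^sub>v x))"

text \<open>The blocks \<open>A\<^sup>(\<^sup>1\<^sup>), \<dots>, A\<^sup>(\<^sup>s\<^sup>)\<close> stacked on top of each other. The number of columns is explicit
  because all blocks may be empty.\<close>

definition stack :: "nat \<Rightarrow> int mat list \<Rightarrow> real mat" where
  "stack d As = map_mat real_of_int (mat_of_rows d (concat (map rows As)))"

text \<open>Communication is counted in bits, so the entries need finite precision: they are integers of
  \<open>L\<close> bits and a sign (numbers with a common fixed-point format reduce to this by scaling). The
  rows of \<open>A\<close> may be split arbitrarily, and only their total number \<open>n\<close> is a parameter.\<close>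

definition valid_input :: "nat \<Rightarrow> nat \<Rightarrow> nat \<Rightarrow> nat \<Rightarrow> int mat list \<Rightarrow> bool" where
  "valid_input s n d L As \<longleftrightarrow>
     length As = s \<and>
     (\<forall>B \<in> set As. dim_col B = d \<and> (\<forall>a \<in> elements_mat B. \<bar>a\<bar> \<le> 2 ^ L)) \<and>
     sum_list (map dim_row As) = n"

text \<open>The factor hidden by the soft-O notation, with exponent \<open>k\<close>. For \<open>s, d, L \<ge> 1\<close> and
  \<open>0 < \<epsilon> < 1\<close> the argument of the logarithm exceeds \<open>4\<close>, so that the factor is at least \<open>1\<close>.\<close>

definition polylog :: "nat \<Rightarrow> nat \<Rightarrow> nat \<Rightarrow> nat \<Rightarrow> nat \<Rightarrow> real \<Rightarrow> real" where
  "polylog k s n d L \<epsilon> = ln (real s + real n + real d + real L + 1 / \<epsilon>) ^ k"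

text \<open>The coordinator has to output \<open>S\<close> together with \<open>S * A\<close>. Without the latter, the identity
  matrix would be an embedding that needs no communication.\<close>

definition constructs_subspace_embedding ::
  "real \<Rightarrow> real \<Rightarrow> (int mat, real mat \<times> real mat) protocol \<Rightarrow>
     nat \<Rightarrow> nat \<Rightarrow> nat \<Rightarrow> nat \<Rightarrow> bool" where
  "constructs_subspace_embedding \<delta> \<epsilon> P s n d L \<longleftrightarrow>
     (\<forall>As. valid_input s n d L As \<longrightarrow>
        measure_pmf.prob (coins P s)
          {\<omega>. case protocol_output P As \<omega> of (S, M) \<Rightarrow>
             subspace_embedding \<epsilon> (stack d As) S \<and> M = S * stack d As} \<ge> 1 - \<delta>)"

text \<open>The theorem bounds rounds and bits for all outcomes of the coins; only correctness may fail,
  with probability at most \<open>\<delta>\<close>. There \<open>C\<close> is the constant of all O-terms, the factor \<open>L\<close> in the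
  total communication is the number of bits per entry (the messages to the servers do not pay for
  it), and the number of rounds is bounded by \<open>C * ln (d + 1)\<close> because \<open>C * ln d\<close> would forbid any
  round for \<open>d = 1\<close>.\<close>

end

theory Submission
  imports Defs "HOL-Probability.Hoeffding" "HOL-Real_Asymp.Real_Asymp"
begin

text \<open>
  The coordinator asks server \<open>i\<close> for \<open>t i\<close> random sign combinations of its rows. If every \<open>t i\<close> is at
  least a multiple of \<open>log d / \<epsilon>\<^sup>2\<close> times the total leverage of the server's rows with respect to \<open>A\<close>, the
  reweighted sketches are a subspace embedding by matrix concentration, and about \<open>s + d / \<epsilon>\<^sup>2\<close>
  sketches suffice because the leverages of all servers add up to at most \<open>d\<close>. The leverages are not
  known and are estimated in rounds \<open>j = 0, \<dots>, R\<close> with \<open>2 ^ R \<ge> d\<close>: in round \<open>j\<close> the sketches are scaled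
  so that they represent \<open>2 ^ j / 2 ^ R * A\<^sup>T A\<close> in expectation. In round \<open>0\<close> this scaling makes every
  single sketch negligible. Only an upper bound of the sketched Gram matrix by a multiple of \<open>A\<^sup>T A\<close>
  is needed to conclude that the leverage scores of the sketches with respect to themselves
  overestimate the true ones, and these self scores add up to at most \<open>d\<close> whatever the coins are. So
  they can serve as the numbers of sketches for the next round, where the scale doubles.

  The signs are public: by Newman's argument polynomially many fixed sign tables are enough, so that
  the coordinator only has to send the index of a table and the numbers \<open>t i\<close>.

  Matrix concentration is derived from traces of integer powers. If \<open>B\<close> is at least the identity
  and \<open>v\<close> has squared length at most \<open>\<eta>\<close>, then \<open>tr (B + v v\<^sup>T) ^ q\<close> exceeds \<open>tr B ^ q\<close> by at most
  \<open>q * (1 + \<eta>) ^ q * v\<^sup>T B ^ (q - 1) v\<close>, by log-convexity of the moments \<open>v\<^sup>T B ^ a v\<close>. As the trace of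
  a power is convex, this lets one replace the independent summands by their means one at a time.
\<close>

section \<open>Symmetric operators and traces of powers\<close>

text \<open>No spectral theory enters. Matrices are seen only through quadratic forms; eigenvalue
  facts are replaced by Gram-Schmidt, Cauchy-Schwarz and a case split on the parity of the exponent.
  The exponent \<open>q\<close> balances two effects: the inflation (1 + \<eta>)^q has to stay 1 +
  O(e), while the tail d exp (- q e / 2) has to be small. So q is of order log / e and \<eta> of
  order e^2 / log, which is where 1 / \<epsilon>^2 comes from. Three obstacles shape the rest. A
  sign combination has no useful deterministic length bound, so sketches are truncated at a
  logarithmic multiple of their mean squared length. The moment bounds need a matrix of at least I
  after every step, so for the lower tail the sum is subtracted from 4 I, on an event provided by
  the upper tail. Finally, the number of sketches depends on earlier rounds, so coins are drawn for
  a fixed maximum \<open>K\<close> per server and the surplus is ignored. Integer inputs make every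
  sketch an integer vector, hence it is transmitted exactly and no rounding has to be
  analysed.\<close>

definition ip :: "nat \<Rightarrow> (nat \<Rightarrow> real) \<Rightarrow> (nat \<Rightarrow> real) \<Rightarrow> real" where
  "ip r x y = (\<Sum>i<r. x i * y i)"

definition unitv :: "nat \<Rightarrow> nat \<Rightarrow> real" where
  "unitv i = (\<lambda>j. if j = i then 1 else 0)"

definition mop :: "nat \<Rightarrow> (nat \<Rightarrow> nat \<Rightarrow> real) \<Rightarrow> (nat \<Rightarrow> real) \<Rightarrow> nat \<Rightarrow> real" where
  "mop r S x = (\<lambda>i. \<Sum>j<r. S i j * x j)"

definition mtr :: "nat \<Rightarrow> (nat \<Rightarrow> nat \<Rightarrow> real) \<Rightarrow> nat \<Rightarrow> real" where
  "mtr r S q = (\<Sum>i<r. ip r (unitv i) ((mop r S ^^ q) (unitv i)))"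

definition symm :: "(nat \<Rightarrow> nat \<Rightarrow> real) \<Rightarrow> bool" where
  "symm S \<longleftrightarrow> (\<forall>i j. S i j = S j i)"

text \<open>The Loewner bound S \<ge> c I.\<close>

definition mgeq :: "nat \<Rightarrow> real \<Rightarrow> (nat \<Rightarrow> nat \<Rightarrow> real) \<Rightarrow> bool" where
  "mgeq r c S \<longleftrightarrow> (\<forall>x. c * ip r x x \<le> ip r x (mop r S x))"

lemma ip_commute: "ip r x y = ip r y x"
  by (simp add: ip_def mult.commute)

lemma sum_of_bool_eq: "b < r \<Longrightarrow> (\<Sum>a<r. f a * of_bool (a = b)) = (f b :: real)" for r b :: nat
  by (simp add: of_bool_def if_distrib[where f = "\<lambda>t. _ * t"] cong: if_cong)

lemma ip_self_nonneg: "0 \<le> ip r x x"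
  by (simp add: ip_def sum_nonneg)

lemma ip_unitv: "i < r \<Longrightarrow> ip r x (unitv i) = x i" "i < r \<Longrightarrow> ip r (unitv i) x = x i"
  by (simp_all add: ip_def unitv_def if_distrib [where f = "\<lambda>t. _ * t"]
        if_distrib [where f = "\<lambda>t. t * _"] cong: if_cong)

lemma parseval: "(\<Sum>i<r. ip r x (unitv i) * ip r y (unitv i)) = ip r x y"
  by (simp add: ip_unitv) (simp add: ip_def)

lemma ip_mop_sym: "symm S \<Longrightarrow> ip r (mop r S x) y = ip r x (mop r S y)"
  unfolding ip_def mop_def symm_def sum_distrib_left sum_distrib_right
  by (subst (2) sum.swap) (auto intro!: sum.cong)

lemma ip_mop_pow_sym:
  assumes "symm S" shows "ip r ((mop r S ^^ a) x) y = ip r x ((mop r S ^^ a) y)"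
proof (induction a arbitrary: x y)
  case (Suc a)
  have "ip r ((mop r S ^^ Suc a) x) y = ip r ((mop r S ^^ a) x) (mop r S y)"
    using assms by (simp add: ip_mop_sym)
  also have "\<dots> = ip r x ((mop r S ^^ a) (mop r S y))" by (rule Suc)
  finally show ?case by (simp add: funpow_swap1)
qed simp

text \<open>\<open>expand\<close> packs linearity and dependence on the first \<open>d\<close>
  coordinates into one identity. The form may be degenerate, because the columns of the input may be
  dependent.\<close>

locale psd_form =
  fixes d :: nat and Q :: "(nat \<Rightarrow> real) \<Rightarrow> (nat \<Rightarrow> real) \<Rightarrow> real"
  assumes sym: "Q x y = Q y x"
    and expand: "Q x y = (\<Sum>i<d. x i * Q (unitv i) y)"
    and nonneg: "0 \<le> Q x x"
begin

lemma add_left: "Q (\<lambda>i. x i + y i) z = Q x z + Q y z"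
  by (subst (1 2 3) expand) (simp add: algebra_simps sum.distrib)

lemma scale_left: "Q (\<lambda>i. c * x i) z = c * Q x z"
  by (subst (1 2) expand) (simp add: algebra_simps sum_distrib_left)

lemma diff_left: "Q (\<lambda>i. x i - y i) z = Q x z - Q y z"
  by (subst (1 2 3) expand) (simp add: algebra_simps sum_subtractf)

lemma sum_left: "Q (\<lambda>i. \<Sum>a\<in>A. x a i) z = (\<Sum>a\<in>A. Q (x a) z)"
proof -
  have "Q (\<lambda>i. \<Sum>a\<in>A. x a i) z = (\<Sum>a\<in>A. \<Sum>i<d. x a i * Q (unitv i) z)"
    by (subst expand) (simp add: sum_distrib_right sum.swap[of _ A])
  also have "\<dots> = (\<Sum>a\<in>A. Q (x a) z)" by (subst (2) expand) simp
  finally show ?thesis .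
qed

lemma cauchy_schwarz: "(Q x y)\<^sup>2 \<le> Q x x * Q y y"
proof -
  have eq: "Q (\<lambda>i. a * x i + b * y i) (\<lambda>i. a * x i + b * y i)
      = a\<^sup>2 * Q x x + 2 * a * b * Q x y + b\<^sup>2 * Q y y" for a b
    by (simp add: add_left scale_left sym[of x "\<lambda>i. a * x i + b * y i"]
        sym[of y "\<lambda>i. a * x i + b * y i"] sym[of y x] algebra_simps power2_eq_square)
  have nn: "0 \<le> a\<^sup>2 * Q x x + 2 * a * b * Q x y + b\<^sup>2 * Q y y" for a b
    using nonneg[of "\<lambda>i. a * x i + b * y i"] by (simp only: eq)
  show ?thesis
  proof (cases "Q y y = 0")
    case True
    have "Q x y = 0"
    proof (rule ccontr)
      assume "Q x y \<noteq> 0"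
      \<comment> \<open>With \<open>Q y y = 0\<close> the expansion is affine in \<open>b\<close>,
        and this \<open>b\<close> gives it the value -1.\<close>
      then show False
        using nn[of 1 "- (Q x x + 1) / (2 * Q x y)"] True by (simp add: field_simps)
    qed
    then show ?thesis using True by simp
  next
    case False
    then have "Q y y > 0" using nonneg[of y] by simp
    moreover have "0 \<le> Q y y * (Q x x * Q y y - (Q x y)\<^sup>2)"
      using nn[of "Q y y" "- Q x y"] by (simp add: power2_eq_square algebra_simps)
    ultimately show ?thesis by (simp add: zero_le_mult_iff)
  qed
qed

lemma null_vector: "Q x x = 0 \<Longrightarrow> Q x y = 0"
  using cauchy_schwarz[of x y] by simp

text \<open>Gram-Schmidt for a semidefinite form: a residual \<open>f\<close> of length zero lies in
  the radical and contributes no vector. The expansion is required against every \<open>y\<close>;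
  at \<open>y = f\<close> it shows that the residual is orthogonal to all earlier unit
  vectors.\<close>

lemma orthonormal_aux:
  "m \<le> d \<Longrightarrow> \<exists>r\<le>m. \<exists>w. (\<forall>a<r. \<forall>b<r. Q (w a) (w b) = of_bool (a = b)) \<and>
     (\<forall>i<m. \<forall>y. Q (unitv i) y = (\<Sum>a<r. Q (unitv i) (w a) * Q y (w a)))"
proof (induction m)
  case 0
  show ?case by auto
next
  case (Suc m)
  then obtain r w where r: "r \<le> m" and orth: "\<And>a b. a < r \<Longrightarrow> b < r \<Longrightarrow> Q (w a) (w b) = of_bool (a = b)"
    and ex: "\<And>i y. i < m \<Longrightarrow> Q (unitv i) y = (\<Sum>a<r. Q (unitv i) (w a) * Q y (w a))"
    by (metis Suc_leD)
  define f where "f = (\<lambda>i. unitv m i - (\<Sum>a<r. Q (unitv m) (w a) * w a i))"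
  have Qf: "Q f y = Q (unitv m) y - (\<Sum>a<r. Q (unitv m) (w a) * Q (w a) y)" for y
    unfolding f_def by (simp add: diff_left sum_left scale_left)
  have fw: "Q f (w b) = 0" if "b < r" for b
    using that by (simp add: Qf orth sum_of_bool_eq)
  have fi: "Q (unitv i) f = 0" if "i < m" for i
    using ex[OF that, of f] fw by simp
  have mf: "Q (unitv m) f = Q f f"
  proof -
    have "Q f f = Q (unitv m) f - (\<Sum>a<r. Q (unitv m) (w a) * Q (w a) f)" by (rule Qf)
    moreover have "(\<Sum>a<r. Q (unitv m) (w a) * Q (w a) f) = 0"
      by (rule sum.neutral) (use fw sym in auto)
    ultimately show ?thesis by simp
  qed
  show ?case
  proof (cases "Q f f = 0")
    case True
    have "\<forall>y. Q (unitv m) y = (\<Sum>a<r. Q (unitv m) (w a) * Q y (w a))"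
      using Qf null_vector[OF True] by (simp add: sym)
    then have "\<forall>i<Suc m. \<forall>y. Q (unitv i) y = (\<Sum>a<r. Q (unitv i) (w a) * Q y (w a))"
      unfolding less_Suc_eq using ex by blast
    moreover have "r \<le> Suc m" using r by simp
    moreover have "\<forall>a<r. \<forall>b<r. Q (w a) (w b) = of_bool (a = b)" using orth by blast
    ultimately show ?thesis by blast
  next
    case False
    then have pos: "Q f f > 0" using nonneg[of f] by simp
    define c where "c = sqrt (Q f f)"
    have c: "c \<noteq> 0" "c * c = Q f f" using pos by (auto simp: c_def)
    define g where "g = (\<lambda>i. (1 / c) * f i)"
    have Qg: "Q g y = Q f y / c" for y unfolding g_def scale_left by simp
    have Qg': "Q y g = Q y f / c" for y using Qg[of y] by (simp add: sym)
    define w' where "w' = w(r := g)"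
    have orth': "Q (w' a) (w' b) = of_bool (a = b)" if "a < Suc r" "b < Suc r" for a b
      using that orth[of a b] fw[of a] fw[of b] sym[of "w a" f] c
      by (auto simp: w'_def less_Suc_eq Qg Qg')
    have "Q (unitv i) y = (\<Sum>a<Suc r. Q (unitv i) (w' a) * Q y (w' a))" if "i < Suc m" for i y
    proof (cases "i = m")
      case True
      have "Q f f / c * (Q y f / c) = Q y f" using c pos by (simp add: field_simps)
      then have "Q f y = Q (unitv m) g * Q y g" by (simp add: Qg' mf sym[of f y])
      moreover have "(\<Sum>a<r. Q (unitv m) (w' a) * Q y (w' a)) = (\<Sum>a<r. Q (unitv m) (w a) * Q (w a) y)"
        by (rule sum.cong) (auto simp: w'_def sym)
      ultimately show ?thesis using Qf[of y] True by (simp add: w'_def)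
    next
      case False
      then have i: "i < m" using that by simp
      show ?thesis using ex[OF i, of y] fi[OF i] by (simp add: w'_def Qg')
    qed
    then have "\<forall>i<Suc m. \<forall>y. Q (unitv i) y = (\<Sum>a<Suc r. Q (unitv i) (w' a) * Q y (w' a))" by blast
    moreover have "Suc r \<le> Suc m" using r by simp
    moreover have "\<forall>a<Suc r. \<forall>b<Suc r. Q (w' a) (w' b) = of_bool (a = b)" using orth' by blast
    ultimately show ?thesis by blast
  qed
qed

lemma orthonormal_basis:
  obtains r w where "r \<le> d" "\<And>a b. a < r \<Longrightarrow> b < r \<Longrightarrow> Q (w a) (w b) = of_bool (a = b)"
    "\<And>x y. Q x y = (\<Sum>a<r. Q x (w a) * Q y (w a))"
proof -
  obtain r w where r: "r \<le> d" and orth: "\<And>a b. a < r \<Longrightarrow> b < r \<Longrightarrow> Q (w a) (w b) = of_bool (a = b)"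
    and ex: "\<And>i y. i < d \<Longrightarrow> Q (unitv i) y = (\<Sum>a<r. Q (unitv i) (w a) * Q y (w a))"
    using orthonormal_aux[OF order_refl] by metis
  have "Q x y = (\<Sum>a<r. Q x (w a) * Q y (w a))" for x y
  proof -
    have "Q x y = (\<Sum>i<d. x i * (\<Sum>a<r. Q (unitv i) (w a) * Q y (w a)))"
      by (subst expand) (rule sum.cong, auto simp: ex[symmetric])
    also have "\<dots> = (\<Sum>a<r. (\<Sum>i<d. x i * Q (unitv i) (w a)) * Q y (w a))"
      by (simp add: sum_distrib_left sum_distrib_right sum.swap[of _ "{..<d}"] mult.assoc)
    also have "\<dots> = (\<Sum>a<r. Q x (w a) * Q y (w a))" by (simp flip: expand)
    finally show ?thesis .
  qed
  with r orth that show thesis by blast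
qed

text \<open>The residual \<open>z\<close> of \<open>x\<close> lies in the radical of
  \<open>Q\<close>, where a functional dominated by \<open>Q\<close> vanishes. So rows and sketches
  have coordinates although \<open>w\<close> need not span the whole space.\<close>

lemma dominated_functional:
  fixes r :: nat
  assumes dom: "\<And>x. (ip d u x)\<^sup>2 \<le> c * Q x x"
    and ex: "\<And>x y. Q x y = (\<Sum>a<r. Q x (w a) * Q y (w a))"
    and orth: "\<And>a b. a < r \<Longrightarrow> b < r \<Longrightarrow> Q (w a) (w b) = of_bool (a = b)"
  shows "ip d u x = (\<Sum>a<r. ip d u (w a) * Q x (w a))"
proof -
  define z where "z = (\<lambda>i. x i - (\<Sum>a<r. Q x (w a) * w a i))"
  have zw: "Q z (w b) = 0" if "b < r" for b
    using that unfolding z_def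
    by (simp add: diff_left sum_left scale_left orth sum_of_bool_eq)
  have "Q z z = 0" by (subst ex) (simp add: zw)
  with dom[of z] have "ip d u z = 0" by simp
  moreover have "ip d u z = ip d u x - (\<Sum>a<r. ip d u (w a) * Q x (w a))"
  proof -
    have "ip d u z = ip d u x - (\<Sum>i<d. \<Sum>a<r. u i * (Q x (w a) * w a i))"
      by (simp add: z_def ip_def right_diff_distrib sum_subtractf sum_distrib_left)
    also have "(\<Sum>i<d. \<Sum>a<r. u i * (Q x (w a) * w a i)) = (\<Sum>a<r. ip d u (w a) * Q x (w a))"
      by (subst sum.swap) (simp add: ip_def sum_distrib_right sum_distrib_left mult_ac)
    finally show ?thesis .
  qed
  ultimately show ?thesis by simp
qed

end

section \<open>Moments of a symmetric operator and traces of its powers\<close>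

lemma ip_expand: "ip r x y = (\<Sum>i<r. x i * ip r (unitv i) y)"
  by (simp add: ip_unitv) (simp add: ip_def)

text \<open>By symmetry the form of S^(2b) is a squared length at S^b x, and that of S^(2b+1) is the
  form of S at S^b x. No square root of S is taken.\<close>

lemma psd_form_mop_pow:
  assumes S: "symm S" and psd: "mgeq r 0 S"
  shows "psd_form r (\<lambda>x y. ip r x ((mop r S ^^ a) y))"
proof
  show "ip r x ((mop r S ^^ a) y) = ip r y ((mop r S ^^ a) x)" for x y
    by (metis ip_mop_pow_sym[OF S] ip_commute)
  show "ip r x ((mop r S ^^ a) y) = (\<Sum>i<r. x i * ip r (unitv i) ((mop r S ^^ a) y))" for x y
    by (rule ip_expand)
  show "0 \<le> ip r x ((mop r S ^^ a) x)" for x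
  proof (cases "even a")
    case True
    then obtain b where "a = b + b" by (metis evenE mult_2)
    then have "ip r x ((mop r S ^^ a) x) = ip r ((mop r S ^^ b) x) ((mop r S ^^ b) x)"
      by (simp add: funpow_add ip_mop_pow_sym[OF S])
    then show ?thesis by (simp add: ip_self_nonneg)
  next
    case False
    then obtain b where "a = b + Suc b" by (metis oddE mult_2 add.assoc Suc_eq_plus1 add_Suc_right)
    then have "ip r x ((mop r S ^^ a) x) = ip r ((mop r S ^^ b) x) (mop r S ((mop r S ^^ b) x))"
      by (simp only: funpow_add o_apply ip_mop_pow_sym[OF S] funpow.simps)
    then show ?thesis using psd by (simp add: mgeq_def)
  qed
qed

lemma mgeq_mono: "mgeq r c S \<Longrightarrow> c' \<le> c \<Longrightarrow> mgeq r c' S"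
  unfolding mgeq_def by (meson ip_self_nonneg mult_right_mono order_trans)

text \<open>With a = 2b + e and e \<le> 1, this is Cauchy-Schwarz in the form of S^e at the vectors
  S^b v and S^(b+1) v.\<close>

lemma moment_log_convex:
  assumes S: "symm S" and psd: "mgeq r 0 S"
  shows "(ip r v ((mop r S ^^ Suc a) v))\<^sup>2
      \<le> ip r v ((mop r S ^^ a) v) * ip r v ((mop r S ^^ Suc (Suc a)) v)"
proof -
  let ?B = "mop r S"
  have cs: "(ip r x ((?B ^^ e) y))\<^sup>2 \<le> ip r x ((?B ^^ e) x) * ip r y ((?B ^^ e) y)" for e x y
    by (rule psd_form.cauchy_schwarz[OF psd_form_mop_pow[OF S psd]])
  have M: "ip r v ((?B ^^ (b + (e + c))) v) = ip r ((?B ^^ b) v) ((?B ^^ e) ((?B ^^ c) v))" for b e c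
    by (simp add: funpow_add ip_mop_pow_sym[OF S])
  obtain b e where a: "a = b + (e + b)"
  proof (cases "even a")
    case True
    then obtain b where "a = b + (0 + b)" by (metis evenE mult_2 add_0)
    then show thesis by (rule that)
  next
    case False
    then obtain b where "a = b + (1 + b)" by (metis oddE mult_2 add.assoc add.commute)
    then show thesis by (rule that)
  qed
  then have "Suc a = b + (e + Suc b)" "Suc (Suc a) = Suc b + (e + Suc b)" by simp_all
  then show ?thesis using cs[of "(?B ^^ b) v" e "(?B ^^ Suc b) v"] a by (simp only: M)
qed

text \<open>The ratios of successive terms of a log-convex sequence increase. Hence moving one unit
  from the smaller index to the larger one does not decrease the product, and this can be repeated
  until the smaller index is 0.\<close>

lemma log_convex_product:
  fixes M :: "nat \<Rightarrow> real"
  assumes pos: "\<And>a. 0 < M a" and lc: "\<And>a. (M (Suc a))\<^sup>2 \<le> M a * M (Suc (Suc a))"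
  shows "M a * M b \<le> M 0 * M (a + b)"
proof -
  have ratio: "M (Suc b) * M a \<le> M b * M (Suc a)" if "b \<le> a" for a b
    using that
  proof (induction a rule: dec_induct)
    case (step a)
    have "M (Suc b) * M (Suc a) * M a \<le> M b * M (Suc a) * M (Suc a)"
      using step.IH pos[of "Suc a"] by (simp add: mult.commute mult.left_commute)
    also have "\<dots> \<le> M b * (M a * M (Suc (Suc a)))"
      using lc[of a] pos[of b] by (simp add: power2_eq_square mult.assoc)
    finally have "M a * (M (Suc b) * M (Suc a)) \<le> M a * (M b * M (Suc (Suc a)))"
      by (simp add: mult_ac)
    then show ?case using pos[of a] by simp
  qed (simp add: mult.commute)
  have le: "M a * M b \<le> M 0 * M (a + b)" if "b \<le> Suc a" for a b
    using that
  proof (induction b arbitrary: a)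
    case (Suc b)
    then have "M (Suc b) * M a \<le> M b * M (Suc a)" by (intro ratio) simp
    also have "\<dots> \<le> M 0 * M (Suc a + b)" using Suc.IH[of "Suc a"] Suc.prems by (simp add: mult.commute)
    finally show ?case by (simp add: mult.commute)
  qed simp
  show ?thesis using le[of b a] le[of a b] by (metis add.commute le_SucI linear mult.commute)
qed

context
  fixes r :: nat and S :: "nat \<Rightarrow> nat \<Rightarrow> real" and v :: "nat \<Rightarrow> real"
  assumes S: "symm S" and ge1: "mgeq r 1 S"
begin

lemma moment_nonneg: "0 \<le> ip r v ((mop r S ^^ a) v)"
proof -
  have "mgeq r 0 S" by (rule mgeq_mono[OF ge1]) simp
  then show ?thesis using psd_form.nonneg[OF psd_form_mop_pow[OF S]] by blast
qed

text \<open>S \<ge> I gives the first inequality only; log-convexity propagates it to the higher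
  moments.\<close>

lemma moment_mono: "ip r v ((mop r S ^^ a) v) \<le> ip r v ((mop r S ^^ Suc a) v)"
proof (induction a)
  case 0
  show ?case using ge1 by (simp add: mgeq_def)
next
  case (Suc a)
  let ?M = "\<lambda>a. ip r v ((mop r S ^^ a) v)"
  have "mgeq r 0 S" by (rule mgeq_mono[OF ge1]) simp
  then have lc: "(?M (Suc a))\<^sup>2 \<le> ?M a * ?M (Suc (Suc a))" by (rule moment_log_convex[OF S])
  show ?case
  proof (rule ccontr)
    assume "\<not> ?thesis"
    then have lt: "?M (Suc (Suc a)) < ?M (Suc a)" by simp
    then have pos: "0 < ?M (Suc a)" using moment_nonneg[of "Suc (Suc a)"] by linarith
    have "?M a * ?M (Suc (Suc a)) \<le> ?M (Suc a) * ?M (Suc (Suc a))"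
      using Suc moment_nonneg[of "Suc (Suc a)"] by (rule mult_right_mono)
    also have "\<dots> < ?M (Suc a) * ?M (Suc a)" using lt pos by simp
    finally show False using lc by (simp add: power2_eq_square)
  qed
qed

lemma moment_mono_le: "a \<le> b \<Longrightarrow> ip r v ((mop r S ^^ a) v) \<le> ip r v ((mop r S ^^ b) v)"
  by (rule lift_Suc_mono_le[of "\<lambda>a. ip r v ((mop r S ^^ a) v)"]) (use moment_mono in auto)

lemma moment_product:
  "ip r v ((mop r S ^^ a) v) * ip r v ((mop r S ^^ b) v) \<le> ip r v v * ip r v ((mop r S ^^ (a + b)) v)"
proof (cases "ip r v v = 0")
  case True
  have "psd_form r (\<lambda>x y. ip r x ((mop r S ^^ 0) y))"
    by (rule psd_form_mop_pow[OF S mgeq_mono[OF ge1]]) simp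
  from psd_form.null_vector[OF this, of v] True show ?thesis by simp
next
  case False
  let ?M = "\<lambda>a. ip r v ((mop r S ^^ a) v)"
  have 0: "?M 0 > 0" using False ip_self_nonneg[of r v] by simp
  have pos: "?M a > 0" for a using moment_mono_le[of 0 a] 0 by simp
  have "mgeq r 0 S" by (rule mgeq_mono[OF ge1]) simp
  then show ?thesis
    using log_convex_product[of ?M a b] pos moment_log_convex[OF S] by simp
qed

text \<open>Here X = S + v v^T. Peeling one factor X off leaves the moment with one more S, plus a
  product of two moments. By \<open>moment_product\<close> and the bound on the length of
  \<open>v\<close>, that product is at most \<eta> times the target, so each exchange of an X for an
  S costs at most a factor 1 + \<eta>.\<close>

lemma rank_one_moments:
  assumes X: "\<And>x y. ip r x (mop r X y) = ip r x (mop r S y) + ip r v x * ip r v y"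
    and eta: "ip r v v \<le> \<eta>"
  shows "ip r ((mop r S ^^ a) v) ((mop r X ^^ j) v) \<le> (1 + \<eta>) ^ j * ip r v ((mop r S ^^ (a + j)) v)"
    and "ip r v ((mop r S ^^ (a + j)) v) \<le> ip r ((mop r S ^^ a) v) ((mop r X ^^ j) v)"
proof -
  let ?B = "mop r S" and ?X = "mop r X"
  let ?M = "\<lambda>a. ip r v ((?B ^^ a) v)"
  have eta0: "0 \<le> \<eta>" using eta ip_self_nonneg[of r v] by linarith
  have step: "ip r ((?B ^^ a) v) ((?X ^^ Suc j) v)
      = ip r ((?B ^^ Suc a) v) ((?X ^^ j) v) + ?M a * ip r v ((?X ^^ j) v)" for a j
    by (simp add: X ip_mop_sym[OF S])
  have up: "ip r ((?B ^^ a) v) ((?X ^^ j) v) \<le> (1 + \<eta>) ^ j * ?M (a + j)" for a j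
  proof (induction j arbitrary: a)
    case 0
    show ?case by (simp add: ip_commute)
  next
    case (Suc j)
    have "?M a * ip r v ((?X ^^ j) v) \<le> ?M a * ((1 + \<eta>) ^ j * ?M j)"
      using Suc[of 0] moment_nonneg[of a] by (intro mult_left_mono) auto
    also have "\<dots> = (1 + \<eta>) ^ j * (?M a * ?M j)" by simp
    also have "\<dots> \<le> (1 + \<eta>) ^ j * (\<eta> * ?M (Suc a + j))"
    proof (intro mult_left_mono)
      have "?M a * ?M j \<le> ip r v v * ?M (a + j)" by (rule moment_product)
      also have "\<dots> \<le> \<eta> * ?M (a + j)" using eta moment_nonneg by (rule mult_right_mono)
      also have "\<dots> \<le> \<eta> * ?M (Suc a + j)" using eta0 by (intro mult_left_mono moment_mono_le) auto
      finally show "?M a * ?M j \<le> \<eta> * ?M (Suc a + j)" .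
    qed (use eta0 in auto)
    finally have "ip r ((?B ^^ a) v) ((?X ^^ Suc j) v)
        \<le> (1 + \<eta>) ^ j * ?M (Suc a + j) + (1 + \<eta>) ^ j * (\<eta> * ?M (Suc a + j))"
      unfolding step using Suc[of "Suc a"] by linarith
    then show ?case by (simp add: algebra_simps)
  qed
  then show "ip r ((?B ^^ a) v) ((?X ^^ j) v) \<le> (1 + \<eta>) ^ j * ?M (a + j)" .
  have low: "?M (a + j) \<le> ip r ((?B ^^ a) v) ((?X ^^ j) v)" for a j
  proof (induction j arbitrary: a)
    case 0
    show ?case by (simp add: ip_commute)
  next
    case (Suc j)
    have "0 \<le> ip r v ((?X ^^ j) v)" using Suc[of 0] moment_nonneg[of j] by simp
    then have "0 \<le> ?M a * ip r v ((?X ^^ j) v)" using moment_nonneg by (intro mult_nonneg_nonneg)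
    then show ?case unfolding step using Suc[of "Suc a"] by simp
  qed
  then show "?M (a + j) \<le> ip r ((?B ^^ a) v) ((?X ^^ j) v)" .
qed

end

text \<open>Telescoping over the traces of S^(q-j) X^j. The weights \<open>c\<close> may have either
  sign, so that the identity serves for additions and for subtractions of means.\<close>

lemma trace_diff:
  assumes S: "symm S" and X: "symm X"
    and rel: "\<And>x y. ip r x (mop r X y) = ip r x (mop r S y) + (\<Sum>\<omega>\<in>\<Omega>. c \<omega> * ip r (v \<omega>) x * ip r (v \<omega>) y)"
  shows "mtr r X q - mtr r S q
    = (\<Sum>j<q. \<Sum>\<omega>\<in>\<Omega>. c \<omega> * ip r ((mop r S ^^ (q - Suc j)) (v \<omega>)) ((mop r X ^^ j) (v \<omega>)))"
proof -
  let ?B = "mop r S" and ?X = "mop r X"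
  define h where "h j = (\<Sum>i<r. ip r ((?B ^^ (q - j)) (unitv i)) ((?X ^^ j) (unitv i)))" for j
  have "h (Suc j) - h j = (\<Sum>\<omega>\<in>\<Omega>. c \<omega> * ip r ((?B ^^ (q - Suc j)) (v \<omega>)) ((?X ^^ j) (v \<omega>)))"
    if "j < q" for j
  proof -
    let ?b = "q - Suc j"
    have q: "q - j = Suc ?b" using that by simp
    have "h (Suc j) - h j = (\<Sum>i<r. ip r ((?B ^^ ?b) (unitv i)) (?X ((?X ^^ j) (unitv i)))
        - ip r ((?B ^^ ?b) (unitv i)) (?B ((?X ^^ j) (unitv i))))"
      unfolding h_def q by (simp add: sum_subtractf ip_mop_sym[OF S])
    also have "\<dots> = (\<Sum>i<r. \<Sum>\<omega>\<in>\<Omega>. c \<omega> * (ip r (v \<omega>) ((?B ^^ ?b) (unitv i)) * ip r (v \<omega>) ((?X ^^ j) (unitv i))))"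
      unfolding rel by (simp add: mult.assoc)
    also have "\<dots> = (\<Sum>i<r. \<Sum>\<omega>\<in>\<Omega>. c \<omega> * (ip r ((?B ^^ ?b) (v \<omega>)) (unitv i) * ip r ((?X ^^ j) (v \<omega>)) (unitv i)))"
      by (simp only: ip_mop_pow_sym[OF S] ip_mop_pow_sym[OF X])
    also have "\<dots> = (\<Sum>\<omega>\<in>\<Omega>. c \<omega> * ip r ((?B ^^ ?b) (v \<omega>)) ((?X ^^ j) (v \<omega>)))"
      by (subst sum.swap) (simp add: parseval flip: sum_distrib_left)
    finally show ?thesis .
  qed
  then have "(\<Sum>j<q. \<Sum>\<omega>\<in>\<Omega>. c \<omega> * ip r ((?B ^^ (q - Suc j)) (v \<omega>)) ((?X ^^ j) (v \<omega>)))
      = (\<Sum>j<q. h (Suc j) - h j)" by simp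
  also have "\<dots> = h q - h 0" by (rule sum_lessThan_telescope)
  also have "\<dots> = mtr r X q - mtr r S q"
    by (simp add: h_def mtr_def ip_mop_pow_sym[OF S])
  finally show ?thesis by simp
qed

text \<open>Schur's product theorem: after expanding \<open>P\<close> in an orthonormal basis, each
  basis vector contributes the \<open>Z\<close>-length of one linear combination of the
  \<open>v \<omega>\<close>.\<close>

lemma psd_kernel_product:
  assumes P: "psd_form r P" and Z: "psd_form r Z"
  shows "0 \<le> (\<Sum>\<omega>\<in>\<Omega>. \<Sum>\<nu>\<in>\<Omega>. c \<omega> * c \<nu> * P (v \<omega>) (v \<nu>) * Z (v \<omega>) (v \<nu>))"
proof -
  interpret P: psd_form r P by fact
  interpret Z: psd_form r Z by fact
  obtain m w where "m \<le> r" "\<And>a b. a < m \<Longrightarrow> b < m \<Longrightarrow> P (w a) (w b) = of_bool (a = b)"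
    and ex: "\<And>x y. P x y = (\<Sum>a<m. P x (w a) * P y (w a))"
    by (rule P.orthonormal_basis) (rule that)
  have Zc: "Z (\<lambda>i. \<Sum>\<omega>\<in>\<Omega>. k \<omega> * v \<omega> i) (\<lambda>i. \<Sum>\<nu>\<in>\<Omega>. k \<nu> * v \<nu> i)
      = (\<Sum>\<omega>\<in>\<Omega>. \<Sum>\<nu>\<in>\<Omega>. k \<omega> * k \<nu> * Z (v \<omega>) (v \<nu>))" for k
  proof -
    let ?y = "\<lambda>i. \<Sum>\<nu>\<in>\<Omega>. k \<nu> * v \<nu> i"
    have l: "Z ?y x = (\<Sum>\<omega>\<in>\<Omega>. k \<omega> * Z (v \<omega>) x)" for x by (simp only: Z.sum_left Z.scale_left)
    have "Z (v \<omega>) ?y = (\<Sum>\<nu>\<in>\<Omega>. k \<nu> * Z (v \<omega>) (v \<nu>))" for \<omega>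
      unfolding Z.sym[of "v \<omega>" ?y] l by (simp only: Z.sym[of _ "v \<omega>"])
    then show ?thesis unfolding l by (simp add: sum_distrib_left mult.assoc)
  qed
  have "(\<Sum>\<omega>\<in>\<Omega>. \<Sum>\<nu>\<in>\<Omega>. c \<omega> * c \<nu> * P (v \<omega>) (v \<nu>) * Z (v \<omega>) (v \<nu>))
     = (\<Sum>\<omega>\<in>\<Omega>. \<Sum>\<nu>\<in>\<Omega>. \<Sum>a<m. (c \<omega> * P (v \<omega>) (w a)) * (c \<nu> * P (v \<nu>) (w a)) * Z (v \<omega>) (v \<nu>))"
  proof (intro sum.cong refl)
    fix \<omega> \<nu>
    show "c \<omega> * c \<nu> * P (v \<omega>) (v \<nu>) * Z (v \<omega>) (v \<nu>)
        = (\<Sum>a<m. c \<omega> * P (v \<omega>) (w a) * (c \<nu> * P (v \<nu>) (w a)) * Z (v \<omega>) (v \<nu>))"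
      unfolding ex[of "v \<omega>" "v \<nu>"] sum_distrib_left sum_distrib_right
      by (intro sum.cong refl) (simp only: mult_ac)
  qed
  also have "\<dots> = (\<Sum>\<omega>\<in>\<Omega>. \<Sum>a<m. \<Sum>\<nu>\<in>\<Omega>. (c \<omega> * P (v \<omega>) (w a)) * (c \<nu> * P (v \<nu>) (w a)) * Z (v \<omega>) (v \<nu>))"
    by (intro sum.cong refl sum.swap)
  also have "\<dots> = (\<Sum>a<m. \<Sum>\<omega>\<in>\<Omega>. \<Sum>\<nu>\<in>\<Omega>. (c \<omega> * P (v \<omega>) (w a)) * (c \<nu> * P (v \<nu>) (w a)) * Z (v \<omega>) (v \<nu>))"
    by (rule sum.swap)
  also have "\<dots> \<ge> 0" unfolding Zc[symmetric] by (intro sum_nonneg Z.nonneg)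
  finally show ?thesis .
qed

text \<open>Klein's inequality. The differences of the summands in \<open>trace_diff\<close> are sums of entrywise
  products of two positive kernels.\<close>

lemma trace_pow_convex:
  assumes S: "symm S" "mgeq r 0 S" and X: "symm X" "mgeq r 0 X" and fin: "finite \<Omega>"
    and rel: "\<And>x y. ip r x (mop r X y) = ip r x (mop r S y) + (\<Sum>\<omega>\<in>\<Omega>. c \<omega> * ip r (v \<omega>) x * ip r (v \<omega>) y)"
  shows "mtr r S q + q * (\<Sum>\<omega>\<in>\<Omega>. c \<omega> * ip r (v \<omega>) ((mop r S ^^ (q - 1)) (v \<omega>))) \<le> mtr r X q"
proof -
  let ?B = "mop r S" and ?X = "mop r X"
  define f where "f j = (\<Sum>\<omega>\<in>\<Omega>. c \<omega> * ip r ((?B ^^ (q - Suc j)) (v \<omega>)) ((?X ^^ j) (v \<omega>)))" for j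
  have step: "f j \<le> f (Suc j)" if "Suc j < q" for j
  proof -
    let ?b = "q - Suc (Suc j)"
    have q: "q - Suc j = Suc ?b" using that by simp
    have "f (Suc j) - f j = (\<Sum>\<omega>\<in>\<Omega>. c \<omega> * (ip r ((?B ^^ ?b) (v \<omega>)) (?X ((?X ^^ j) (v \<omega>)))
        - ip r ((?B ^^ ?b) (v \<omega>)) (?B ((?X ^^ j) (v \<omega>)))))"
      unfolding f_def q by (simp add: sum_subtractf ip_mop_sym[OF S(1)] right_diff_distrib)
    also have "\<dots> = (\<Sum>\<omega>\<in>\<Omega>. \<Sum>\<nu>\<in>\<Omega>. c \<omega> * (c \<nu> * ip r (v \<nu>) ((?B ^^ ?b) (v \<omega>)) * ip r (v \<nu>) ((?X ^^ j) (v \<omega>))))"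
      unfolding rel by (simp add: sum_distrib_left)
    also have "\<dots> = (\<Sum>\<omega>\<in>\<Omega>. \<Sum>\<nu>\<in>\<Omega>. c \<omega> * c \<nu> * ip r (v \<omega>) ((?B ^^ ?b) (v \<nu>)) * ip r (v \<omega>) ((?X ^^ j) (v \<nu>)))"
    proof (intro sum.cong refl)
      fix \<omega> \<nu>
      have "ip r (v \<nu>) ((?B ^^ ?b) (v \<omega>)) = ip r (v \<omega>) ((?B ^^ ?b) (v \<nu>))"
        "ip r (v \<nu>) ((?X ^^ j) (v \<omega>)) = ip r (v \<omega>) ((?X ^^ j) (v \<nu>))"
        by (metis ip_mop_pow_sym[OF S(1)] ip_commute, metis ip_mop_pow_sym[OF X(1)] ip_commute)
      then show "c \<omega> * (c \<nu> * ip r (v \<nu>) ((?B ^^ ?b) (v \<omega>)) * ip r (v \<nu>) ((?X ^^ j) (v \<omega>)))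
          = c \<omega> * c \<nu> * ip r (v \<omega>) ((?B ^^ ?b) (v \<nu>)) * ip r (v \<omega>) ((?X ^^ j) (v \<nu>))" by simp
    qed
    also have "\<dots> \<ge> 0"
      by (rule psd_kernel_product[OF psd_form_mop_pow[OF S] psd_form_mop_pow[OF X]])
    finally show ?thesis by simp
  qed
  have f0: "f 0 \<le> f j" if "j < q" for j
    using that by (induction j) (auto intro: order_trans step)
  \<comment> \<open>\<open>f 0\<close> is the first-order term of the claim; none of the
    \<open>q\<close> summands of the telescoped difference is smaller.\<close>
  have "q * f 0 = (\<Sum>j<q. f 0)" by simp
  also have "\<dots> \<le> (\<Sum>j<q. f j)" by (intro sum_mono f0) simp
  also have "\<dots> = mtr r X q - mtr r S q"
    unfolding f_def using trace_diff[OF S(1) X(1) rel, of q] by simp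
  finally show ?thesis by (simp add: f_def ip_mop_pow_sym[OF S(1)])
qed

text \<open>All mixed moments in \<open>trace_diff\<close> have total exponent q - 1, so they share
  one bound. What matters is that it is linear in v v^T for fixed \<open>S\<close>: its expectation
  involves only the mean of v v^T.\<close>

lemma trace_rank_one_upper:
  assumes S: "symm S" "mgeq r 1 S" and X: "symm X"
    and rel: "\<And>x y. ip r x (mop r X y) = ip r x (mop r S y) + ip r v x * ip r v y"
    and eta: "ip r v v \<le> \<eta>"
  shows "mtr r X q \<le> mtr r S q + q * ((1 + \<eta>) ^ q * ip r v ((mop r S ^^ (q - 1)) v))"
proof -
  have eta0: "0 \<le> \<eta>" using eta ip_self_nonneg[of r v] by linarith
  have rel': "ip r x (mop r X y) = ip r x (mop r S y) + (\<Sum>\<omega>\<in>{()}. 1 * ip r v x * ip r v y)" for x y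
    by (simp add: rel)
  have "mtr r X q - mtr r S q = (\<Sum>j<q. ip r ((mop r S ^^ (q - Suc j)) v) ((mop r X ^^ j) v))"
    using trace_diff[OF S(1) X rel', of q] by simp
  also have "\<dots> \<le> (\<Sum>j<q. (1 + \<eta>) ^ q * ip r v ((mop r S ^^ (q - 1)) v))"
  proof (rule sum_mono)
    fix j assume "j \<in> {..<q}"
    then have j: "q - Suc j + j = q - 1" "j \<le> q" by auto
    have "ip r ((mop r S ^^ (q - Suc j)) v) ((mop r X ^^ j) v) \<le> (1 + \<eta>) ^ j * ip r v ((mop r S ^^ (q - 1)) v)"
      using rank_one_moments(1)[OF S rel eta, of "q - Suc j" j] j by simp
    also have "\<dots> \<le> (1 + \<eta>) ^ q * ip r v ((mop r S ^^ (q - 1)) v)"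
      using j eta0 moment_nonneg[OF S] by (intro mult_right_mono power_increasing) auto
    finally show "ip r ((mop r S ^^ (q - Suc j)) v) ((mop r X ^^ j) v) \<le> (1 + \<eta>) ^ q * ip r v ((mop r S ^^ (q - 1)) v)" .
  qed
  finally show ?thesis by simp
qed

text \<open>The hypotheses are those of the upper bound, but \<open>S\<close> is now the matrix after the step.\<close>

lemma trace_rank_one_lower:
  assumes S: "symm S" "mgeq r 1 S" and X: "symm X"
    and rel: "\<And>x y. ip r x (mop r X y) = ip r x (mop r S y) + ip r v x * ip r v y"
    and eta: "ip r v v \<le> \<eta>"
  shows "mtr r S q \<le> mtr r X q - q * (ip r v ((mop r X ^^ (q - 1)) v) / (1 + \<eta>) ^ q)"
proof -
  have eta0: "0 \<le> \<eta>" using eta ip_self_nonneg[of r v] by linarith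
  have rel': "ip r x (mop r X y) = ip r x (mop r S y) + (\<Sum>\<omega>\<in>{()}. 1 * ip r v x * ip r v y)" for x y
    by (simp add: rel)
  let ?m = "ip r v ((mop r S ^^ (q - 1)) v)"
  have "q * ?m = (\<Sum>j<q. ?m)" by simp
  also have "\<dots> \<le> (\<Sum>j<q. ip r ((mop r S ^^ (q - Suc j)) v) ((mop r X ^^ j) v))"
  proof (rule sum_mono)
    fix j assume "j \<in> {..<q}"
    then have j: "q - Suc j + j = q - 1" "j \<le> q" by auto
    then show "?m \<le> ip r ((mop r S ^^ (q - Suc j)) v) ((mop r X ^^ j) v)"
      using rank_one_moments(2)[OF S rel eta, of "q - Suc j" j] by simp
  qed
  also have "\<dots> = mtr r X q - mtr r S q" using trace_diff[OF S(1) X rel', of q] by simp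
  finally have 1: "q * ?m \<le> mtr r X q - mtr r S q" .
  \<comment> \<open>Passes from a moment of the matrix after the step to one of the matrix before
    it. Only the latter is independent of \<open>v\<close> when \<open>v\<close> is random.\<close>
  have "ip r v ((mop r X ^^ (q - 1)) v) \<le> (1 + \<eta>) ^ (q - 1) * ?m"
    using rank_one_moments(1)[OF S rel eta, of 0 "q - 1"] by simp
  also have "\<dots> \<le> (1 + \<eta>) ^ q * ?m"
    using eta0 moment_nonneg[OF S] by (intro mult_right_mono power_increasing) auto
  finally have "ip r v ((mop r X ^^ (q - 1)) v) / (1 + \<eta>) ^ q \<le> ?m"
    using eta0 by (simp add: pos_divide_le_eq mult.commute)
  then have "q * (ip r v ((mop r X ^^ (q - 1)) v) / (1 + \<eta>) ^ q) \<le> q * ?m"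
    by (intro mult_left_mono) auto
  then show ?thesis using 1 by linarith
qed

section \<open>Concentration of sums of independent rank-one matrices\<close>

text \<open>Stands in for the fact that the largest eigenvalue is at most the trace.\<close>

lemma (in psd_form) le_trace: "Q v v \<le> ip d v v * (\<Sum>i<d. Q (unitv i) (unitv i))"
proof -
  obtain r w where ex: "\<And>x y. Q x y = (\<Sum>a<(r::nat). Q x (w a) * Q y (w a))"
    by (rule orthonormal_basis) (rule that)
  have "(Q v (w a))\<^sup>2 \<le> ip d v v * (\<Sum>i<d. (Q (unitv i) (w a))\<^sup>2)" for a
  proof -
    have "Q v (w a) = (\<Sum>i<d. v i * Q (unitv i) (w a))" by (rule expand)
    then show ?thesis
      using Cauchy_Schwarz_ineq_sum[of v "\<lambda>i. Q (unitv i) (w a)" "{..<d}"]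
      by (simp add: ip_def power2_eq_square)
  qed
  then have "(\<Sum>a<r. (Q v (w a))\<^sup>2) \<le> (\<Sum>a<r. ip d v v * (\<Sum>i<d. (Q (unitv i) (w a))\<^sup>2))"
    by (rule sum_mono)
  also have "\<dots> = ip d v v * (\<Sum>i<d. \<Sum>a<r. (Q (unitv i) (w a))\<^sup>2)"
    by (simp add: sum_distrib_left sum.swap[of _ "{..<d}"])
  also have "(\<Sum>a<r. (Q v (w a))\<^sup>2) = Q v v" unfolding ex[of v v] by (simp add: power2_eq_square)
  also have "(\<lambda>i. \<Sum>a<r. (Q (unitv i) (w a))\<^sup>2) = (\<lambda>i. Q (unitv i) (unitv i))"
    unfolding ex[of "unitv _" "unitv _"] by (simp add: power2_eq_square)
  finally show ?thesis .
qed

lemma mtr_nonneg: "symm S \<Longrightarrow> mgeq r 0 S \<Longrightarrow> 0 \<le> mtr r S q"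
  unfolding mtr_def by (intro sum_nonneg psd_form.nonneg[OF psd_form_mop_pow])

lemma moment_le_trace:
  "symm S \<Longrightarrow> mgeq r 0 S \<Longrightarrow> ip r v ((mop r S ^^ q) v) \<le> ip r v v * mtr r S q"
  unfolding mtr_def by (rule psd_form.le_trace[OF psd_form_mop_pow])

text \<open>Together with \<open>moment_le_trace\<close> this makes one large value of the quadratic
  form force a large trace of the power, without an eigenvector.\<close>

lemma moment_ge_power:
  assumes S: "symm S" "mgeq r 1 S" and c: "0 \<le> c" "c * ip r v v \<le> ip r v (mop r S v)"
  shows "c ^ q * ip r v v \<le> ip r v ((mop r S ^^ q) v)"
proof (cases "ip r v v = 0")
  case True
  then show ?thesis using moment_nonneg[OF S] by simp
next
  case False
  then have pos: "0 < ip r v v" using ip_self_nonneg[of r v] by simp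
  show ?thesis
  proof (induction q)
    case (Suc q)
    let ?m = "ip r v ((mop r S ^^ q) v)"
    have "ip r v v * (c * ?m) = ?m * (c * ip r v v)" by simp
    also have "\<dots> \<le> ?m * ip r v (mop r S v)"
      using c moment_nonneg[OF S] by (intro mult_left_mono) auto
    also have "\<dots> \<le> ip r v v * ip r v ((mop r S ^^ Suc q) v)"
      using moment_product[OF S, of v q 1] by simp
    finally have "c * ?m \<le> ip r v ((mop r S ^^ Suc q) v)" using pos by simp
    moreover have "c * (c ^ q * ip r v v) \<le> c * ?m" using Suc c by (intro mult_left_mono)
    ultimately show ?case by (simp add: mult.assoc)
  qed simp
qed

lemma moment_le_power:
  assumes S: "symm S" "mgeq r 0 S" and c: "0 \<le> c" "\<And>x. ip r x (mop r S x) \<le> c * ip r x x"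
  shows "ip r v ((mop r S ^^ q) v) \<le> c ^ q * ip r v v"
proof (induction q)
  case (Suc q)
  let ?B = "mop r S"
  have "ip r v ((?B ^^ Suc q) v) \<le> c * ip r v ((?B ^^ q) v)"
  proof (cases "even q")
    case True
    then obtain b where b: "q = b + b" by (metis evenE mult_2)
    have "Suc q = b + Suc b" using b by simp
    then have "ip r v ((?B ^^ Suc q) v) = ip r ((?B ^^ b) v) (?B ((?B ^^ b) v))"
      by (simp only: funpow_add o_apply ip_mop_pow_sym[OF S(1)] funpow.simps)
    also have "\<dots> \<le> c * ip r ((?B ^^ b) v) ((?B ^^ b) v)" by (rule c)
    also have "ip r ((?B ^^ b) v) ((?B ^^ b) v) = ip r v ((?B ^^ q) v)"
      by (simp add: b funpow_add ip_mop_pow_sym[OF S(1)])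
    finally show ?thesis .
  next
    case False
    then obtain b where b: "q = b + Suc b" by (metis oddE mult_2 add.assoc Suc_eq_plus1 add_Suc_right)
    define y where "y = (?B ^^ b) v"
    define z where "z = ?B y"
    have q: "Suc q = Suc b + Suc b" and z: "z = (?B ^^ Suc b) v" using b by (simp_all add: y_def z_def)
    have 1: "ip r v ((?B ^^ q) v) = ip r y z"
      unfolding b z y_def by (simp only: funpow_add o_apply ip_mop_pow_sym[OF S(1)])
    from q z have 2: "ip r v ((?B ^^ Suc q) v) = ip r z z"
      by (simp only: funpow_add o_apply ip_mop_pow_sym[OF S(1)])
    \<comment> \<open>For odd \<open>q\<close> the two moments are <y, B y> and |B y|^2.
      Cauchy-Schwarz in the form of B at \<open>y\<close> and \<open>z = B y\<close> compares them
      after one division by |z|^2.\<close>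
    interpret psd_form r "\<lambda>x y. ip r x ((?B ^^ 1) y)" by (rule psd_form_mop_pow[OF S])
    have "(ip r z z)\<^sup>2 \<le> ip r y z * ip r z (?B z)"
      using cauchy_schwarz[of y z] ip_mop_sym[OF S(1), of r y z] by (simp add: z_def)
    also have "\<dots> \<le> ip r y z * (c * ip r z z)"
      using nonneg[of y] c by (intro mult_left_mono) (auto simp: z_def)
    finally have "ip r z z * ip r z z \<le> ip r z z * (c * ip r y z)"
      by (simp add: power2_eq_square mult_ac)
    moreover have "0 \<le> c * ip r y z" using c nonneg[of y] by (simp add: z_def)
    ultimately have "ip r z z \<le> c * ip r y z"
      using ip_self_nonneg[of r z] by (cases "ip r z z = 0") auto
    then show ?thesis using 1 2 by simp
  qed
  also have "\<dots> \<le> c * (c ^ q * ip r v v)" using Suc c by (intro mult_left_mono)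
  finally show ?case by (simp add: mult.assoc)
qed simp

lemma mtr_le_power:
  assumes "symm S" "mgeq r 0 S" "0 \<le> c" "\<And>x. ip r x (mop r S x) \<le> c * ip r x x"
  shows "mtr r S q \<le> r * c ^ q"
proof -
  have "mtr r S q \<le> (\<Sum>i<r. c ^ q)"
    unfolding mtr_def
  proof (rule sum_mono)
    fix i assume "i \<in> {..<r}"
    then have "ip r (unitv i) (unitv i) = 1" by (simp add: ip_unitv) (simp add: unitv_def)
    then show "ip r (unitv i) ((mop r S ^^ q) (unitv i)) \<le> c ^ q"
      using moment_le_power[OF assms, of "unitv i" q] by simp
  qed
  then show ?thesis by simp
qed

lemma ip_mop_add: "ip r x (mop r (\<lambda>i j. A i j + B i j) y) = ip r x (mop r A y) + ip r x (mop r B y)"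
  by (simp add: ip_def mop_def algebra_simps sum.distrib)

lemma ip_mop_diff: "ip r x (mop r (\<lambda>i j. A i j - B i j) y) = ip r x (mop r A y) - ip r x (mop r B y)"
  by (simp add: ip_def mop_def algebra_simps sum_subtractf)

lemma ip_mop_scale: "ip r x (mop r (\<lambda>i j. c * A i j) y) = c * ip r x (mop r A y)"
  by (simp add: ip_def mop_def algebra_simps sum_distrib_left)

lemma ip_mop_sum: "ip r x (mop r (\<lambda>i j. \<Sum>k\<in>K. A k i j) y) = (\<Sum>k\<in>K. ip r x (mop r (A k) y))"
  by (induction K rule: infinite_finite_induct)
     (simp_all add: ip_mop_add, simp_all add: ip_def mop_def)

lemma ip_mop_outer: "ip r x (mop r (\<lambda>i j. v i * v j) y) = ip r v x * ip r v y"
  unfolding ip_def mop_def sum_product unfolding sum_distrib_left by (intro sum.cong refl) simp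

abbreviation expect :: "'a pmf \<Rightarrow> ('a \<Rightarrow> real) \<Rightarrow> real" where
  "expect \<equiv> measure_pmf.expectation"

abbreviation prob_of :: "'a pmf \<Rightarrow> 'a set \<Rightarrow> real" where
  "prob_of \<equiv> measure_pmf.prob"

definition scalm :: "real \<Rightarrow> nat \<Rightarrow> nat \<Rightarrow> real" where
  "scalm c = (\<lambda>i j. if i = j then c else 0)"

lemma ip_mop_scalm: "ip r x (mop r (scalm c) y) = c * ip r x y"
proof -
  have "mop r (scalm c) y i = c * y i" if "i < r" for i
    using that by (simp add: mop_def scalm_def if_distrib[where f = "\<lambda>t. t * _"] cong: if_cong)
  then show ?thesis by (simp add: ip_def sum_distrib_left mult_ac)
qed

lemma symm_scalm: "symm (scalm c)"
  by (simp add: symm_def scalm_def)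

section \<open>Expectations over finitely supported distributions\<close>

lemma expectation_finite:
  fixes f :: "'a \<Rightarrow> real"
  assumes "finite (set_pmf p)"
  shows "expect p f = (\<Sum>x\<in>set_pmf p. pmf p x * f x)"
  using assms by (subst integral_measure_pmf[of "set_pmf p"]) auto

lemma sum_pmf_set: "finite (set_pmf p) \<Longrightarrow> (\<Sum>x\<in>set_pmf p. pmf p x) = 1"
  by (rule sum_pmf_eq_1) auto

lemma expectation_mono_finite:
  fixes f g :: "'a \<Rightarrow> real"
  assumes "finite (set_pmf p)" "\<And>x. x \<in> set_pmf p \<Longrightarrow> f x \<le> g x"
  shows "expect p f \<le> expect p g"
  unfolding expectation_finite[OF assms(1)] using assms(2)
  by (intro sum_mono mult_left_mono) auto

lemma expectation_cong:
  fixes f g :: "'a \<Rightarrow> real"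
  assumes "\<And>x. x \<in> set_pmf p \<Longrightarrow> f x = g x"
  shows "expect p f = expect p g"
  by (rule integral_cong_AE) (auto simp: AE_measure_pmf_iff assms)

lemma finite_set_Pi_pmf:
  assumes "finite K" "\<And>k. k \<in> K \<Longrightarrow> finite (set_pmf (p k))"
  shows "finite (set_pmf (Pi_pmf K dflt p))"
  using assms by (subst set_Pi_pmf) auto

lemma expectation_Pi_insert:
  fixes F :: "_ \<Rightarrow> real"
  assumes K: "finite K" "k \<notin> K" and fin: "\<And>j. j \<in> insert k K \<Longrightarrow> finite (set_pmf (p j))"
  shows "expect (Pi_pmf (insert k K) dflt p) F
    = expect (Pi_pmf K dflt p) (\<lambda>\<omega>. expect (p k) (\<lambda>\<sigma>. F (\<omega> (k := \<sigma>))))"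
proof -
  have f1: "finite (set_pmf (Pi_pmf K dflt p))" using assms by (intro finite_set_Pi_pmf) auto
  have f2: "finite (set_pmf (p k))" using fin by auto
  have "expect (Pi_pmf (insert k K) dflt p) F
    = (\<Sum>\<sigma>\<in>set_pmf (p k). \<Sum>\<omega>\<in>set_pmf (Pi_pmf K dflt p). pmf (p k) \<sigma> * pmf (Pi_pmf K dflt p) \<omega> * F (\<omega> (k := \<sigma>)))"
    using f1 f2 K
    by (simp add: Pi_pmf_insert expectation_finite sum.cartesian_product case_prod_beta)
      (intro sum.cong refl, auto simp: pmf_pair)
  also have "\<dots> = expect (Pi_pmf K dflt p) (\<lambda>\<omega>. expect (p k) (\<lambda>\<sigma>. F (\<omega> (k := \<sigma>))))"
    using f1 f2 by (subst sum.swap) (simp add: expectation_finite sum_distrib_left mult_ac)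
  finally show ?thesis .
qed

lemma markov_finite:
  fixes f :: "'a \<Rightarrow> real"
  assumes fin: "finite (set_pmf p)" and nn: "\<And>x. x \<in> set_pmf p \<Longrightarrow> 0 \<le> f x" and c: "0 < c"
    and A: "\<And>x. x \<in> set_pmf p \<Longrightarrow> x \<in> A \<Longrightarrow> c \<le> f x"
  shows "prob_of p A \<le> expect p f / c"
proof -
  have "prob_of p A = expect p (indicator A)" by simp
  also have "\<dots> \<le> expect p (\<lambda>x. f x / c)"
    using nn c A by (intro expectation_mono_finite[OF fin]) (auto simp: indicator_def)
  finally show ?thesis by simp
qed

section \<open>Replacement of independent rank-one summands by their means, and the resulting
  tails\<close>

locale rank_one_sum =
  fixes K :: "'k set" and dflt :: 's and p :: "'k \<Rightarrow> 's pmf" and r :: nat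
    and v :: "'k \<Rightarrow> 's \<Rightarrow> nat \<Rightarrow> real" and \<eta> :: real
  assumes finK: "finite K" and finp: "\<And>k. k \<in> K \<Longrightarrow> finite (set_pmf (p k))"
    and eta: "\<And>k \<sigma>. k \<in> K \<Longrightarrow> \<sigma> \<in> set_pmf (p k) \<Longrightarrow> ip r (v k \<sigma>) (v k \<sigma>) \<le> \<eta>"
    and eta0: "0 \<le> \<eta>"
begin

abbreviation "mean_form x \<equiv> \<Sum>k\<in>K. expect (p k) (\<lambda>\<sigma>. (ip r (v k \<sigma>) x)\<^sup>2)"
abbreviation "sample_form \<omega> x \<equiv> \<Sum>k\<in>K. (ip r (v k (\<omega> k)) x)\<^sup>2"

definition mean :: "'k \<Rightarrow> nat \<Rightarrow> nat \<Rightarrow> real" where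
  "mean k = (\<lambda>i j. expect (p k) (\<lambda>\<sigma>. v k \<sigma> i * v k \<sigma> j))"

definition rsum :: "'k set \<Rightarrow> ('k \<Rightarrow> 's) \<Rightarrow> nat \<Rightarrow> nat \<Rightarrow> real" where
  "rsum J \<omega> = (\<lambda>i j. \<Sum>k\<in>J. v k (\<omega> k) i * v k (\<omega> k) j)"

lemma ip_mean:
  assumes "k \<in> K"
  shows "ip r x (mop r (mean k) y) = (\<Sum>\<sigma>\<in>set_pmf (p k). pmf (p k) \<sigma> * ip r (v k \<sigma>) x * ip r (v k \<sigma>) y)"
  unfolding mean_def expectation_finite[OF finp[OF assms]]
  by (subst ip_mop_sum) (simp add: ip_mop_scale ip_mop_outer mult.assoc)

lemma ip_mean_self:
  assumes "k \<in> K"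
  shows "ip r x (mop r (mean k) x) = expect (p k) (\<lambda>\<sigma>. (ip r (v k \<sigma>) x)\<^sup>2)"
  unfolding ip_mean[OF assms] by (simp add: expectation_finite[OF finp[OF assms]] power2_eq_square mult.assoc)

lemma ip_mean_nonneg: "k \<in> K \<Longrightarrow> 0 \<le> ip r x (mop r (mean k) x)"
  unfolding ip_mean_self by simp

lemma ip_rsum: "ip r x (mop r (rsum J \<omega>) y) = (\<Sum>k\<in>J. ip r (v k (\<omega> k)) x * ip r (v k (\<omega> k)) y)"
  unfolding rsum_def by (simp add: ip_mop_sum ip_mop_outer)

lemma ip_rsum_nonneg: "0 \<le> ip r x (mop r (rsum J \<omega>) x)"
  unfolding ip_rsum by (simp add: sum_nonneg)

lemma symm_mean: "symm (mean k)"
  by (simp add: symm_def mean_def mult.commute)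

lemma symm_rsum: "symm (rsum J \<omega>)"
  by (simp add: symm_def rsum_def mult.commute)

lemma rsum_insert: "finite J \<Longrightarrow> k \<notin> J \<Longrightarrow>
   rsum (insert k J) (\<omega> (k := \<sigma>)) = (\<lambda>i j. rsum J \<omega> i j + v k \<sigma> i * v k \<sigma> j)"
  unfolding rsum_def by (intro ext) (auto intro!: sum.cong)

text \<open>\<open>S\<close> is general because it absorbs the means already replaced. The step
  bound gives a first-order term at \<open>S\<close>, and \<open>trace_pow_convex\<close> turns this
  term back into the trace of \<open>S\<close> plus the inflated mean, so that the induction
  continues in the same form.\<close>

lemma lindeberg_upper:
  assumes "J \<subseteq> K" "symm S" "mgeq r 1 S"
  shows "expect (Pi_pmf J dflt p) (\<lambda>\<omega>. mtr r (\<lambda>i j. S i j + rsum J \<omega> i j) q)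
    \<le> mtr r (\<lambda>i j. S i j + (1 + \<eta>) ^ q * (\<Sum>k\<in>J. mean k i j)) q"
proof -
  have "finite J" using assms(1) finK by (rule finite_subset)
  then show ?thesis using assms
  proof (induction J arbitrary: S rule: finite_induct)
    case empty
    show ?case by (simp add: rsum_def)
  next
    case (insert k J)
    define \<mu> where "\<mu> = (1 + \<eta>) ^ q"
    have mu: "0 \<le> \<mu>" using eta0 by (simp add: \<mu>_def)
    have k: "k \<in> K" using insert.prems by auto
    note fin = finp[OF k]
    have one: "expect (p k) (\<lambda>\<sigma>. mtr r (\<lambda>i j. T i j + v k \<sigma> i * v k \<sigma> j) q)
        \<le> mtr r (\<lambda>i j. T i j + \<mu> * mean k i j) q" (is "?L \<le> ?R") if T: "symm T" "mgeq r 1 T" for T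
    proof -
      let ?m = "\<lambda>\<sigma>. ip r (v k \<sigma>) ((mop r T ^^ (q - 1)) (v k \<sigma>))"
      have "?L \<le> expect (p k) (\<lambda>\<sigma>. mtr r T q + q * (\<mu> * ?m \<sigma>))"
      proof (rule expectation_mono_finite[OF fin])
        fix \<sigma> assume s: "\<sigma> \<in> set_pmf (p k)"
        have "symm (\<lambda>i j. T i j + v k \<sigma> i * v k \<sigma> j)" using T by (simp add: symm_def mult.commute)
        then show "mtr r (\<lambda>i j. T i j + v k \<sigma> i * v k \<sigma> j) q \<le> mtr r T q + q * (\<mu> * ?m \<sigma>)"
          unfolding \<mu>_def
          by (rule trace_rank_one_upper[OF T _ _ eta[OF k s]]) (simp add: ip_mop_add ip_mop_outer)
      qed
      also have "\<dots> = mtr r T q + q * (\<Sum>\<sigma>\<in>set_pmf (p k). (\<mu> * pmf (p k) \<sigma>) * ?m \<sigma>)"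
        by (simp add: expectation_finite[OF fin] distrib_left sum.distrib sum_pmf_set[OF fin]
            flip: sum_distrib_right) (simp add: sum_distrib_left mult_ac)
      also have "\<dots> \<le> ?R"
      proof (rule trace_pow_convex)
        show "mgeq r 0 T" by (rule mgeq_mono[OF T(2)]) simp
        show "symm (\<lambda>i j. T i j + \<mu> * mean k i j)" using T symm_mean by (simp add: symm_def)
        show "mgeq r 0 (\<lambda>i j. T i j + \<mu> * mean k i j)"
          using \<open>mgeq r 0 T\<close> mu ip_mean_nonneg[OF k]
          by (simp add: mgeq_def ip_mop_add ip_mop_scale)
        show "ip r x (mop r (\<lambda>i j. T i j + \<mu> * mean k i j) y) = ip r x (mop r T y) +
          (\<Sum>\<omega>\<in>set_pmf (p k). \<mu> * pmf (p k) \<omega> * ip r (v k \<omega>) x * ip r (v k \<omega>) y)" for x y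
          by (simp add: ip_mop_add ip_mop_scale ip_mean[OF k] sum_distrib_left mult.assoc)
      qed (use fin T in auto)
      finally show ?thesis .
    qed
    let ?S = "\<lambda>i j. S i j + \<mu> * mean k i j"
    have finP: "finite (set_pmf (Pi_pmf J dflt p))"
      using insert.hyps insert.prems finp by (intro finite_set_Pi_pmf) auto
    have "expect (Pi_pmf (insert k J) dflt p) (\<lambda>\<omega>. mtr r (\<lambda>i j. S i j + rsum (insert k J) \<omega> i j) q)
      = expect (Pi_pmf J dflt p) (\<lambda>\<omega>. expect (p k)
          (\<lambda>\<sigma>. mtr r (\<lambda>i j. (S i j + rsum J \<omega> i j) + v k \<sigma> i * v k \<sigma> j) q))"
      using insert.hyps insert.prems finp
      by (subst expectation_Pi_insert) (auto simp: rsum_insert add.assoc)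
    also have "\<dots> \<le> expect (Pi_pmf J dflt p) (\<lambda>\<omega>. mtr r (\<lambda>i j. (S i j + rsum J \<omega> i j) + \<mu> * mean k i j) q)"
    proof (rule expectation_mono_finite[OF finP], rule one)
      fix \<omega>
      show "symm (\<lambda>i j. S i j + rsum J \<omega> i j)" using insert.prems symm_rsum by (simp add: symm_def)
      show "mgeq r 1 (\<lambda>i j. S i j + rsum J \<omega> i j)"
        using insert.prems ip_rsum_nonneg[of _ J \<omega>] by (simp add: mgeq_def ip_mop_add add_increasing2)
    qed
    also have "\<dots> = expect (Pi_pmf J dflt p) (\<lambda>\<omega>. mtr r (\<lambda>i j. ?S i j + rsum J \<omega> i j) q)"
      by (simp add: add_ac)
    also have "\<dots> \<le> mtr r (\<lambda>i j. ?S i j + (1 + \<eta>) ^ q * (\<Sum>k\<in>J. mean k i j)) q"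
    proof (rule insert.IH)
      show "symm ?S" using insert.prems symm_mean by (simp add: symm_def)
      show "mgeq r 1 ?S"
        using insert.prems mu ip_mean_nonneg[OF k]
        by (simp add: mgeq_def ip_mop_add ip_mop_scale add_increasing2)
    qed (use insert.prems in auto)
    also have "\<dots> = mtr r (\<lambda>i j. S i j + (1 + \<eta>) ^ q * (\<Sum>k\<in>insert k J. mean k i j)) q"
      using insert.hyps by (simp add: \<mu>_def distrib_left add.assoc)
    finally show ?case .
  qed
qed

text \<open>The matrices have to stay bounded from below, hence the restriction to an event that shrinks with
  every summand. The means of the summands already replaced are collected in \<open>D\<close>.\<close>

lemma lindeberg_lower:
  assumes "J \<subseteq> K" "symm S" "mgeq r 2 S" "symm D"
    and "\<And>x. ip r x (mop r D x) + (\<Sum>k\<in>J. ip r x (mop r (mean k) x)) \<le> ip r x x"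
    and q: "q * \<eta> \<le> 1"
  shows "expect (Pi_pmf J dflt p)
      (\<lambda>\<omega>. of_bool (mgeq r 2 (\<lambda>i j. S i j - rsum J \<omega> i j)) * mtr r (\<lambda>i j. S i j - rsum J \<omega> i j - D i j) q)
    \<le> mtr r (\<lambda>i j. S i j - D i j - (\<Sum>k\<in>J. mean k i j) / (1 + \<eta>) ^ q) q"
proof -
  have "finite J" using assms(1) finK by (rule finite_subset)
  then show ?thesis using assms(1-5)
  proof (induction J arbitrary: D rule: finite_induct)
    case empty
    then show ?case by (simp add: rsum_def)
  next
    case (insert k J)
    define \<mu> where "\<mu> = (1 + \<eta>) ^ q"
    have mu: "1 \<le> \<mu>" using eta0 by (simp add: \<mu>_def)
    have k: "k \<in> K" using insert.prems by auto
    note fin = finp[OF k]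
    have mJ: "0 \<le> (\<Sum>k\<in>J. ip r x (mop r (mean k) x))" for x
      using insert.prems(1) by (intro sum_nonneg ip_mean_nonneg) auto
    have mk: "ip r x (mop r (mean k) x) / \<mu> \<le> ip r x (mop r (mean k) x)" for x
      using mu ip_mean_nonneg[OF k, of x] by (simp add: divide_le_eq mult_le_cancel_left1)
    have Dx: "ip r x (mop r D x) + (ip r x (mop r (mean k) x) + (\<Sum>k\<in>J. ip r x (mop r (mean k) x))) \<le> ip r x x" for x
      using insert.prems(5)[of x] insert.hyps by simp
    have div: "ip r x (mop r (\<lambda>i j. A i j / \<mu>) y) = ip r x (mop r A y) / \<mu>" for x y A
      using ip_mop_scale[of r x "1 / \<mu>" A y] by simp
    have one: "expect (p k) (\<lambda>\<sigma>. of_bool (mgeq r 2 (\<lambda>i j. T i j - v k \<sigma> i * v k \<sigma> j)) *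
          mtr r (\<lambda>i j. T i j - v k \<sigma> i * v k \<sigma> j - D i j) q)
        \<le> of_bool (mgeq r 2 T) * mtr r (\<lambda>i j. T i j - (D i j + mean k i j / \<mu>)) q" (is "?L \<le> ?R")
      if T: "symm T" for T
    proof (cases "mgeq r 2 T")
      case False
      have "\<not> mgeq r 2 (\<lambda>i j. T i j - v k \<sigma> i * v k \<sigma> j)" for \<sigma>
      proof
        assume A: "mgeq r 2 (\<lambda>i j. T i j - v k \<sigma> i * v k \<sigma> j)"
        have "2 * ip r x x \<le> ip r x (mop r T x)" for x
        proof -
          have "2 * ip r x x \<le> ip r x (mop r T x) - ip r (v k \<sigma>) x * ip r (v k \<sigma>) x"
            using A by (simp add: mgeq_def ip_mop_diff ip_mop_outer)
          then show ?thesis using zero_le_square[of "ip r (v k \<sigma>) x"] by linarith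
        qed
        then show False using False by (simp add: mgeq_def)
      qed
      then show ?thesis using False by simp
    next
      case True
      define P where "P = (\<lambda>i j. T i j - D i j)"
      have P: "symm P" using T insert.prems by (simp add: P_def symm_def)
      \<comment> \<open>T \<ge> 2 I on the event, and the collected means \<open>D\<close> are at
        most I.\<close>
      have P1: "mgeq r 1 P"
        unfolding mgeq_def
      proof
        fix x
        have "2 * ip r x x \<le> ip r x (mop r T x)" using True by (simp add: mgeq_def)
        then show "1 * ip r x x \<le> ip r x (mop r P x)"
          using Dx[of x] mJ[of x] ip_mean_nonneg[OF k, of x] by (simp add: P_def ip_mop_diff)
      qed
      have P0: "mgeq r 0 P" by (rule mgeq_mono[OF P1]) simp
      let ?m = "\<lambda>\<sigma>. ip r (v k \<sigma>) ((mop r P ^^ (q - 1)) (v k \<sigma>))"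
      have "?L \<le> expect (p k) (\<lambda>\<sigma>. mtr r P q - q * (?m \<sigma> / \<mu>))"
      proof (rule expectation_mono_finite[OF fin])
        fix \<sigma> assume s: "\<sigma> \<in> set_pmf (p k)"
        let ?N = "\<lambda>i j. T i j - v k \<sigma> i * v k \<sigma> j - D i j"
        show "of_bool (mgeq r 2 (\<lambda>i j. T i j - v k \<sigma> i * v k \<sigma> j)) * mtr r ?N q \<le> mtr r P q - q * (?m \<sigma> / \<mu>)"
        proof (cases "mgeq r 2 (\<lambda>i j. T i j - v k \<sigma> i * v k \<sigma> j)")
          case N2: True
          have N: "symm ?N" using T insert.prems by (simp add: symm_def mult.commute)
          have N1: "mgeq r 1 ?N"
            unfolding mgeq_def
          proof
            fix x
            have "2 * ip r x x \<le> ip r x (mop r (\<lambda>i j. T i j - v k \<sigma> i * v k \<sigma> j) x)"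
              using N2 by (simp add: mgeq_def)
            then show "1 * ip r x x \<le> ip r x (mop r ?N x)"
              using Dx[of x] mJ[of x] ip_mean_nonneg[OF k, of x]
              by (subst ip_mop_diff) linarith
          qed
          have "mtr r ?N q \<le> mtr r P q - q * (?m \<sigma> / \<mu>)"
            unfolding \<mu>_def
            by (rule trace_rank_one_lower[OF N N1 P _ eta[OF k s]])
               (simp add: P_def ip_mop_diff ip_mop_outer)
          then show ?thesis using N2 by simp
        next
          case False
          \<comment> \<open>Here the step leaves the event and the left side is 0. What remains is
            that the right side is nonnegative, and this is what q \<eta> \<le> 1 provides.\<close>
          have tr0: "0 \<le> mtr r P q" by (rule mtr_nonneg[OF P P0])
          have "?m \<sigma> \<le> ip r (v k \<sigma>) ((mop r P ^^ q) (v k \<sigma>))"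
            by (rule moment_mono_le[OF P P1]) simp
          also have "\<dots> \<le> ip r (v k \<sigma>) (v k \<sigma>) * mtr r P q" by (rule moment_le_trace[OF P P0])
          also have "\<dots> \<le> \<eta> * mtr r P q" using eta[OF k s] tr0 by (rule mult_right_mono)
          finally have m: "?m \<sigma> \<le> \<eta> * mtr r P q" .
          have "?m \<sigma> / \<mu> \<le> ?m \<sigma>"
            using mu moment_nonneg[OF P P1, of "v k \<sigma>" "q - 1"] by (simp add: divide_le_eq mult_le_cancel_left1)
          then have "q * (?m \<sigma> / \<mu>) \<le> q * (\<eta> * mtr r P q)" using m by (intro mult_left_mono) auto
          also have "\<dots> \<le> 1 * mtr r P q"
            unfolding mult.assoc[symmetric] using q tr0 by (rule mult_right_mono)
          finally show ?thesis using False by simp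
        qed
      qed
      also have "\<dots> = mtr r P q + q * (\<Sum>\<sigma>\<in>set_pmf (p k). (- pmf (p k) \<sigma> / \<mu>) * ?m \<sigma>)"
        by (simp add: expectation_finite[OF fin] right_diff_distrib sum_subtractf sum_pmf_set[OF fin] sum_negf
            flip: sum_distrib_right) (simp add: sum_distrib_left mult_ac)
      also have "\<dots> \<le> mtr r (\<lambda>i j. T i j - (D i j + mean k i j / \<mu>)) q"
      proof (rule trace_pow_convex[OF P P0])
        show "symm (\<lambda>i j. T i j - (D i j + mean k i j / \<mu>))"
          using T insert.prems symm_mean by (simp add: symm_def)
        show "mgeq r 0 (\<lambda>i j. T i j - (D i j + mean k i j / \<mu>))"
          unfolding mgeq_def
        proof
          fix x
          have "2 * ip r x x \<le> ip r x (mop r T x)" using True by (simp add: mgeq_def)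
          then show "0 * ip r x x \<le> ip r x (mop r (\<lambda>i j. T i j - (D i j + mean k i j / \<mu>)) x)"
            using Dx[of x] mJ[of x] mk[of x] ip_self_nonneg[of r x]
            unfolding ip_mop_diff ip_mop_add div by linarith
        qed
        show "ip r x (mop r (\<lambda>i j. T i j - (D i j + mean k i j / \<mu>)) y) = ip r x (mop r P y) +
          (\<Sum>\<omega>\<in>set_pmf (p k). (- pmf (p k) \<omega> / \<mu>) * ip r (v k \<omega>) x * ip r (v k \<omega>) y)" for x y
          unfolding P_def ip_mop_diff ip_mop_add div ip_mean[OF k]
          by (simp add: sum_negf sum_divide_distrib)
      qed (rule fin)
      finally show ?thesis using True by simp
    qed
    let ?D = "\<lambda>i j. D i j + mean k i j / \<mu>"
    have finP: "finite (set_pmf (Pi_pmf J dflt p))"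
      using insert.hyps insert.prems finp by (intro finite_set_Pi_pmf) auto
    have "expect (Pi_pmf (insert k J) dflt p)
        (\<lambda>\<omega>. of_bool (mgeq r 2 (\<lambda>i j. S i j - rsum (insert k J) \<omega> i j)) * mtr r (\<lambda>i j. S i j - rsum (insert k J) \<omega> i j - D i j) q)
      = expect (Pi_pmf J dflt p) (\<lambda>\<omega>. expect (p k)
          (\<lambda>\<sigma>. of_bool (mgeq r 2 (\<lambda>i j. (S i j - rsum J \<omega> i j) - v k \<sigma> i * v k \<sigma> j)) *
            mtr r (\<lambda>i j. (S i j - rsum J \<omega> i j) - v k \<sigma> i * v k \<sigma> j - D i j) q))"
      using insert.hyps insert.prems finp
      by (subst expectation_Pi_insert) (auto simp: rsum_insert diff_diff_eq)
    also have "\<dots> \<le> expect (Pi_pmf J dflt p)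
        (\<lambda>\<omega>. of_bool (mgeq r 2 (\<lambda>i j. S i j - rsum J \<omega> i j)) * mtr r (\<lambda>i j. (S i j - rsum J \<omega> i j) - ?D i j) q)"
    proof (rule expectation_mono_finite[OF finP], rule one)
      show "symm (\<lambda>i j. S i j - rsum J \<omega> i j)" for \<omega>
        using insert.prems symm_rsum by (simp add: symm_def)
    qed
    also have "\<dots> \<le> mtr r (\<lambda>i j. S i j - ?D i j - (\<Sum>k\<in>J. mean k i j) / (1 + \<eta>) ^ q) q"
    proof (rule insert.IH)
      show "symm ?D" using insert.prems symm_mean by (simp add: symm_def)
      show "ip r x (mop r ?D x) + (\<Sum>k\<in>J. ip r x (mop r (mean k) x)) \<le> ip r x x" for x
        unfolding ip_mop_add div using Dx[of x] mk[of x] by linarith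
    qed (use insert.prems in auto)
    also have "\<dots> = mtr r (\<lambda>i j. S i j - D i j - (\<Sum>k\<in>insert k J. mean k i j) / (1 + \<eta>) ^ q) q"
      using insert.hyps by (simp add: \<mu>_def add_divide_distrib algebra_simps)
    finally show ?case .
  qed
qed

lemma rsum_self: "ip r x (mop r (rsum J \<omega>) x) = (\<Sum>k\<in>J. (ip r (v k (\<omega> k)) x)\<^sup>2)"
  by (simp add: ip_rsum power2_eq_square)

lemma ip_vanish: "ip r x x = 0 \<Longrightarrow> ip r y x = 0"
  by (simp add: ip_def sum_nonneg_eq_0_iff)

text \<open>Markov's inequality for the trace of the q-th power of I plus the sum. The added
  identity keeps every intermediate matrix at least I; it turns the threshold 1 + t into 2 + t and
  the mean bound into 1 + (1 + \<eta>)^q.\<close>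

lemma upper_tail:
  assumes mean: "\<And>x. mean_form x \<le> ip r x x"
    and t: "0 \<le> t"
  shows "prob_of (Pi_pmf K dflt p) {\<omega>. \<exists>x. (1 + t) * ip r x x < sample_form \<omega> x}
    \<le> r * ((1 + (1 + \<eta>) ^ q) / (2 + t)) ^ q" (is "prob_of ?P ?A \<le> _")
proof -
  define \<mu> where "\<mu> = (1 + \<eta>) ^ q"
  have mu: "0 \<le> \<mu>" using eta0 by (simp add: \<mu>_def)
  have fin: "finite (set_pmf ?P)" using finK finp by (rule finite_set_Pi_pmf)
  have sR: "symm (\<lambda>i j. scalm 1 i j + rsum K \<omega> i j)" for \<omega>
    using symm_rsum symm_scalm by (simp add: symm_def)
  have gR: "mgeq r 1 (\<lambda>i j. scalm 1 i j + rsum K \<omega> i j)" for \<omega>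
    using ip_rsum_nonneg by (simp add: mgeq_def ip_mop_add ip_mop_scalm)
  have "prob_of ?P ?A \<le> expect ?P (\<lambda>\<omega>. mtr r (\<lambda>i j. scalm 1 i j + rsum K \<omega> i j) q) / (2 + t) ^ q"
  proof (rule markov_finite[OF fin])
    fix \<omega>
    show "0 \<le> mtr r (\<lambda>i j. scalm 1 i j + rsum K \<omega> i j) q"
      by (rule mtr_nonneg[OF sR mgeq_mono[OF gR]]) simp
    assume "\<omega> \<in> ?A"
    then obtain x where x: "(1 + t) * ip r x x < sample_form \<omega> x" by auto
    then have pos: "0 < ip r x x"
      using ip_vanish[of x] ip_self_nonneg[of r x] by (cases "ip r x x = 0") auto
    have "(2 + t) ^ q * ip r x x \<le> ip r x ((mop r (\<lambda>i j. scalm 1 i j + rsum K \<omega> i j) ^^ q) x)"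
      using x t by (intro moment_ge_power[OF sR gR]) (auto simp: ip_mop_add ip_mop_scalm rsum_self algebra_simps)
    also have "\<dots> \<le> ip r x x * mtr r (\<lambda>i j. scalm 1 i j + rsum K \<omega> i j) q"
      by (rule moment_le_trace[OF sR mgeq_mono[OF gR]]) simp
    finally show "(2 + t) ^ q \<le> mtr r (\<lambda>i j. scalm 1 i j + rsum K \<omega> i j) q" using pos by simp
  qed (use t in auto)
  also have "\<dots> \<le> (r * (1 + \<mu>) ^ q) / (2 + t) ^ q"
  proof (rule divide_right_mono)
    have "expect ?P (\<lambda>\<omega>. mtr r (\<lambda>i j. scalm 1 i j + rsum K \<omega> i j) q)
      \<le> mtr r (\<lambda>i j. scalm 1 i j + (1 + \<eta>) ^ q * (\<Sum>k\<in>K. mean k i j)) q"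
      by (rule lindeberg_upper) (auto simp: symm_scalm mgeq_def ip_mop_scalm)
    also have "\<dots> \<le> r * (1 + \<mu>) ^ q"
    proof (rule mtr_le_power)
      have e: "ip r x (mop r (\<lambda>i j. scalm 1 i j + (1 + \<eta>) ^ q * (\<Sum>k\<in>K. mean k i j)) x)
          = ip r x x + \<mu> * (\<Sum>k\<in>K. ip r x (mop r (mean k) x))" for x
        by (simp add: ip_mop_add ip_mop_scale ip_mop_scalm ip_mop_sum \<mu>_def)
      show "symm (\<lambda>i j. scalm 1 i j + (1 + \<eta>) ^ q * (\<Sum>k\<in>K. mean k i j))"
        using symm_scalm symm_mean by (simp add: symm_def)
      show "mgeq r 0 (\<lambda>i j. scalm 1 i j + (1 + \<eta>) ^ q * (\<Sum>k\<in>K. mean k i j))"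
        unfolding mgeq_def e using mu ip_self_nonneg by (auto intro!: add_nonneg_nonneg mult_nonneg_nonneg sum_nonneg ip_mean_nonneg)
      show "ip r x (mop r (\<lambda>i j. scalm 1 i j + (1 + \<eta>) ^ q * (\<Sum>k\<in>K. mean k i j)) x) \<le> (1 + \<mu>) * ip r x x" for x
      proof -
        have "(\<Sum>k\<in>K. ip r x (mop r (mean k) x)) \<le> ip r x x"
          using mean[of x] by (simp add: ip_mean_self)
        then have "\<mu> * (\<Sum>k\<in>K. ip r x (mop r (mean k) x)) \<le> \<mu> * ip r x x" using mu by (rule mult_left_mono)
        then show ?thesis unfolding e by (simp add: algebra_simps)
      qed
    qed (use mu in auto)
    finally show "expect ?P (\<lambda>\<omega>. mtr r (\<lambda>i j. scalm 1 i j + rsum K \<omega> i j) q) \<le> r * (1 + \<mu>) ^ q" .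
  qed (use t in auto)
  finally show ?thesis by (simp add: \<mu>_def power_divide)
qed

text \<open>Reflection: a small value of the sum is a value of at least 3 + t of 4 I minus the sum.
  The 4 is 2 + 2: where the sum is at most 2 I, the difference is at least 2 I, and it stays at
  least I when means of total at most I are subtracted as well.\<close>

lemma lower_tail:
  assumes mean: "\<And>x. mean_form x \<le> ip r x x"
    and mean': "\<And>x. (1 - e) * ip r x x \<le> mean_form x"
    and q: "q * \<eta> \<le> 1" and t: "0 \<le> t" and e: "e \<le> 1" "0 \<le> e"
  shows "prob_of (Pi_pmf K dflt p)
      {\<omega>. (\<forall>x. sample_form \<omega> x \<le> 2 * ip r x x) \<and>
          (\<exists>x. sample_form \<omega> x < (1 - t) * ip r x x)}
    \<le> r * ((4 - (1 - e) / (1 + \<eta>) ^ q) / (3 + t)) ^ q" (is "prob_of ?P ?A \<le> _")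
proof -
  define \<mu> where "\<mu> = (1 + \<eta>) ^ q"
  have mu: "1 \<le> \<mu>" using eta0 by (simp add: \<mu>_def)
  have fin: "finite (set_pmf ?P)" using finK finp by (rule finite_set_Pi_pmf)
  let ?S = "\<lambda>\<omega> i j. scalm 4 i j - rsum K \<omega> i j"
  have sR: "symm (?S \<omega>)" for \<omega> using symm_rsum symm_scalm by (simp add: symm_def)
  let ?f = "\<lambda>\<omega>. of_bool (mgeq r 2 (?S \<omega>)) * mtr r (\<lambda>i j. scalm 4 i j - rsum K \<omega> i j - (\<lambda>_ _. 0) i j) q"
  have z: "ip r x (mop r (\<lambda>_ _. 0) x) = 0" for x by (simp add: ip_def mop_def)
  have "prob_of ?P ?A \<le> expect ?P ?f / (3 + t) ^ q"
  proof (rule markov_finite[OF fin])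
    fix \<omega>
    show "0 \<le> ?f \<omega>"
      using mtr_nonneg[OF sR[of \<omega>] mgeq_mono[of r 2 "?S \<omega>" 0]] by simp
    assume A: "\<omega> \<in> ?A"
    then have le: "sample_form \<omega> x \<le> 2 * ip r x x" for x by auto
    have g2: "mgeq r 2 (?S \<omega>)"
      unfolding mgeq_def
    proof
      fix x show "2 * ip r x x \<le> ip r x (mop r (?S \<omega>) x)"
        using le[of x] by (simp add: ip_mop_diff ip_mop_scalm rsum_self)
    qed
    then have g1: "mgeq r 1 (?S \<omega>)" by (rule mgeq_mono) simp
    from A obtain x where x: "sample_form \<omega> x < (1 - t) * ip r x x" by auto
    have "0 \<le> sample_form \<omega> x" by (simp add: sum_nonneg)
    with x have "ip r x x \<noteq> 0" by auto
    then have pos: "0 < ip r x x" using ip_self_nonneg[of r x] by simp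
    have "(3 + t) ^ q * ip r x x \<le> ip r x ((mop r (?S \<omega>) ^^ q) x)"
      using x t by (intro moment_ge_power[OF sR g1]) (auto simp: ip_mop_diff ip_mop_scalm rsum_self algebra_simps)
    also have "\<dots> \<le> ip r x x * mtr r (?S \<omega>) q"
      by (rule moment_le_trace[OF sR mgeq_mono[OF g1]]) simp
    finally show "(3 + t) ^ q \<le> ?f \<omega>" using pos g2 by simp
  qed (use t in auto)
  also have "\<dots> \<le> (r * (4 - (1 - e) / \<mu>) ^ q) / (3 + t) ^ q"
  proof (rule divide_right_mono)
    have mle: "(\<Sum>k\<in>K. ip r x (mop r (mean k) x)) \<le> ip r x x" for x
      using mean[of x] by (simp add: ip_mean_self)
    have mge: "(1 - e) * ip r x x \<le> (\<Sum>k\<in>K. ip r x (mop r (mean k) x))" for x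
      using mean'[of x] by (simp add: ip_mean_self)
    have "expect ?P ?f
      \<le> mtr r (\<lambda>i j. scalm 4 i j - (\<lambda>_ _. 0) i j - (\<Sum>k\<in>K. mean k i j) / (1 + \<eta>) ^ q) q"
    proof (rule lindeberg_lower)
      show "mgeq r 2 (scalm 4)" by (simp add: mgeq_def ip_mop_scalm ip_self_nonneg)
      show "symm (\<lambda>_ _. 0)" by (simp add: symm_def)
    qed (use mle q in \<open>auto simp: symm_scalm z\<close>)
    also have "\<dots> = mtr r (\<lambda>i j. scalm 4 i j - (1 / \<mu>) * (\<Sum>k\<in>K. mean k i j)) q" by (simp add: \<mu>_def)
    also have "\<dots> \<le> r * (4 - (1 - e) / \<mu>) ^ q"
    proof (rule mtr_le_power)
      have f: "ip r x (mop r (\<lambda>i j. scalm 4 i j - (1 / \<mu>) * (\<Sum>k\<in>K. mean k i j)) x)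
          = 4 * ip r x x - (1 / \<mu>) * (\<Sum>k\<in>K. ip r x (mop r (mean k) x))" for x
        by (simp only: ip_mop_diff ip_mop_scale ip_mop_scalm ip_mop_sum)
      show "symm (\<lambda>i j. scalm 4 i j - (1 / \<mu>) * (\<Sum>k\<in>K. mean k i j))"
        using symm_scalm symm_mean by (simp add: symm_def)
      have up: "(1 / \<mu>) * (\<Sum>k\<in>K. ip r x (mop r (mean k) x)) \<le> ip r x x" for x
      proof -
        have "(1 / \<mu>) * (\<Sum>k\<in>K. ip r x (mop r (mean k) x)) \<le> 1 * (\<Sum>k\<in>K. ip r x (mop r (mean k) x))"
          using mu by (intro mult_right_mono sum_nonneg ip_mean_nonneg) auto
        then show ?thesis using mle[of x] by simp
      qed
      show "mgeq r 0 (\<lambda>i j. scalm 4 i j - (1 / \<mu>) * (\<Sum>k\<in>K. mean k i j))"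
        unfolding mgeq_def f
      proof
        fix x show "0 * ip r x x \<le> 4 * ip r x x - (1 / \<mu>) * (\<Sum>k\<in>K. ip r x (mop r (mean k) x))"
          using up[of x] ip_self_nonneg[of r x] by linarith
      qed
      show "ip r x (mop r (\<lambda>i j. scalm 4 i j - (1 / \<mu>) * (\<Sum>k\<in>K. mean k i j)) x) \<le> (4 - (1 - e) / \<mu>) * ip r x x" for x
      proof -
        have "(1 / \<mu>) * ((1 - e) * ip r x x) \<le> (1 / \<mu>) * (\<Sum>k\<in>K. ip r x (mop r (mean k) x))"
          using mu mge[of x] by (intro mult_left_mono) auto
        then show ?thesis unfolding f by (simp add: algebra_simps diff_divide_distrib)
      qed
      have "(1 - e) / \<mu> \<le> 1 / 1" using mu e by (intro frac_le) auto
      then show "0 \<le> 4 - (1 - e) / \<mu>" by simp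
    qed
    finally show "expect ?P ?f \<le> r * (4 - (1 - e) / \<mu>) ^ q" .
  qed (use t in auto)
  finally show ?thesis by (simp add: \<mu>_def power_divide)
qed

end

section \<open>Random signs\<close>

lemma ratio_power_le_exp:
  fixes a b e :: real
  assumes "0 \<le> a" "0 < b" "a \<le> (1 - e) * b"
  shows "(a / b) ^ q \<le> exp (- (real q * e))"
proof -
  have "a / b \<le> 1 - e" using assms by (simp add: pos_divide_le_eq)
  also have "\<dots> \<le> exp (- e)" using exp_ge_add_one_self[of "- e"] by simp
  finally have "(a / b) ^ q \<le> exp (- e) ^ q" using assms by (intro power_mono) auto
  then show ?thesis by (simp add: exp_of_nat_mult[symmetric])
qed

context rank_one_sum
begin

text \<open>The constraint on \<open>q\<close> from above: the accumulated factor must not exceed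
  the accuracy \<open>e\<close>. The constraint from below is that the tail exp (- q e / 2) beats
  the dimension.\<close>

lemma inflation_bounds:
  assumes e: "0 < e" "e \<le> 1 / 8" and q: "real q * \<eta> \<le> e / 2"
  shows "(1 + \<eta>) ^ q \<le> 1 + e" "1 - e \<le> 1 / (1 + \<eta>) ^ q"
proof -
  have "(1 + \<eta>) ^ q \<le> exp \<eta> ^ q" using eta0 by (intro power_mono) auto
  also have "\<dots> = exp (q * \<eta>)" by (simp add: exp_of_nat_mult)
  also have "\<dots> \<le> exp (e / 2)" using q by simp
  also have "\<dots> \<le> 1 + e / 2 + (e / 2)\<^sup>2" using e by (intro exp_bound) auto
  also have "\<dots> \<le> 1 + e" using e by (simp add: power2_eq_square field_simps)
  finally show le: "(1 + \<eta>) ^ q \<le> 1 + e" .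
  have "1 - e \<le> 1 / (1 + e)" using e by (simp add: field_simps)
  also have "\<dots> \<le> 1 / (1 + \<eta>) ^ q" using le eta0 e by (intro divide_left_mono) auto
  finally show "1 - e \<le> 1 / (1 + \<eta>) ^ q" .
qed

lemma upper_tail_exp:
  assumes e: "0 < e" "e \<le> 1 / 8" and q: "real q * \<eta> \<le> e / 2"
    and mean: "\<And>x. mean_form x \<le> ip r x x"
  shows "prob_of (Pi_pmf K dflt p) {\<omega>. \<exists>x. (1 + 3 * e) * ip r x x < sample_form \<omega> x}
    \<le> r * exp (- (q * (e / 2)))"
proof -
  \<comment> \<open>Of the deviation \<open>3 * e\<close>, one \<open>e\<close> covers the
    inflation; the rest leaves the gap 1 - e / 2 per power that yields the exponential.\<close>
  have "(1 + (1 + \<eta>) ^ q) \<le> (1 - e / 2) * (2 + 3 * e)"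
  proof -
    have "0 \<le> e * (1 - 3 / 2 * e)" using e by (intro mult_nonneg_nonneg) auto
    then show ?thesis using inflation_bounds(1)[OF e q] by (simp add: algebra_simps)
  qed
  then have "((1 + (1 + \<eta>) ^ q) / (2 + 3 * e)) ^ q \<le> exp (- (q * (e / 2)))"
    using e eta0 by (intro ratio_power_le_exp) auto
  then have "r * ((1 + (1 + \<eta>) ^ q) / (2 + 3 * e)) ^ q \<le> r * exp (- (q * (e / 2)))"
    by (intro mult_left_mono) auto
  then show ?thesis using upper_tail[OF mean, of "3 * e" q] e by linarith
qed

lemma two_sided_tail:
  assumes e: "0 < e" "e \<le> 1 / 8" and q: "real q * \<eta> \<le> e / 2"
    and mean: "\<And>x. mean_form x \<le> ip r x x"
    and mean': "\<And>x. (1 - e) * ip r x x \<le> mean_form x"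
  shows "prob_of (Pi_pmf K dflt p)
      {\<omega>. \<exists>x. (1 + 3 * e) * ip r x x < sample_form \<omega> x \<or>
              sample_form \<omega> x < (1 - 4 * e) * ip r x x}
    \<le> 2 * r * exp (- (q * (e / 2)))" (is "prob_of ?P ?A \<le> _")
proof -
  let ?U = "{\<omega>. \<exists>x. (1 + 3 * e) * ip r x x < sample_form \<omega> x}"
  let ?L = "{\<omega>. (\<forall>x. sample_form \<omega> x \<le> 2 * ip r x x) \<and>
          (\<exists>x. sample_form \<omega> x < (1 - 4 * e) * ip r x x)}"
  \<comment> \<open>Outside \<open>?U\<close> the form is at most twice the squared length, as 1 + 3
    e \<le> 2; this is the event that \<open>lower_tail\<close> presupposes.\<close>
  have "?A \<subseteq> ?U \<union> ?L"
  proof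
    fix \<omega> assume A: "\<omega> \<in> ?A"
    have le: "(1 + 3 * e) * ip r x x \<le> 2 * ip r x x" for x
      using e by (intro mult_right_mono ip_self_nonneg) auto
    have "sample_form \<omega> x \<le> 2 * ip r x x" if "\<omega> \<notin> ?U" for x
    proof -
      have "sample_form \<omega> x \<le> (1 + 3 * e) * ip r x x"
        using that unfolding mem_Collect_eq not_ex not_less by blast
      then show ?thesis using le[of x] by linarith
    qed
    then show "\<omega> \<in> ?U \<union> ?L" using A by blast
  qed
  then have "prob_of ?P ?A \<le> prob_of ?P (?U \<union> ?L)"
    by (intro measure_pmf.finite_measure_mono) auto
  also have "\<dots> \<le> prob_of ?P ?U + prob_of ?P ?L"
    by (rule measure_Un_le) auto
  also have "prob_of ?P ?U \<le> r * exp (- (q * (e / 2)))"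
    by (rule upper_tail_exp[OF e q mean])
  also have "prob_of ?P ?L \<le> r * ((4 - (1 - e) / (1 + \<eta>) ^ q) / (3 + 4 * e)) ^ q"
    by (rule lower_tail[OF mean mean']) (use e q in auto)
  also have "\<dots> \<le> r * exp (- (q * (e / 2)))"
  proof (intro mult_left_mono ratio_power_le_exp)
    \<comment> \<open>The mean may be short by a factor 1 - e and the deflation costs another one,
      hence \<open>4 * e\<close> on this side.\<close>
    have 1: "(1 - e) * (1 - e) \<le> (1 - e) * (1 / (1 + \<eta>) ^ q)"
      using inflation_bounds(2)[OF e q] e by (intro mult_left_mono) auto
    moreover have "0 \<le> e * (1 / 2 - e)" using e by (intro mult_nonneg_nonneg) auto
    ultimately show "4 - (1 - e) / (1 + \<eta>) ^ q \<le> (1 - e / 2) * (3 + 4 * e)"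
      by (simp add: algebra_simps)
    have "(1 - e) / (1 + \<eta>) ^ q \<le> 1 / 1" using eta0 e by (intro frac_le) auto
    then show "0 \<le> 4 - (1 - e) / (1 + \<eta>) ^ q" by simp
  qed (use e in auto)
  finally show ?thesis by simp
qed

end

section \<open>Sign combinations: second moment and subgaussian tail\<close>

definition sgnb :: "bool \<Rightarrow> real" where
  "sgnb b = (if b then 1 else - 1)"

definition signs :: "nat \<Rightarrow> (nat \<Rightarrow> bool) pmf" where
  "signs n = Pi_pmf {..<n} False (\<lambda>_. bernoulli_pmf (1 / 2))"

definition lin :: "nat \<Rightarrow> (nat \<Rightarrow> bool) \<Rightarrow> (nat \<Rightarrow> real) \<Rightarrow> real" where
  "lin n \<sigma> y = (\<Sum>a<n. sgnb (\<sigma> a) * y a)"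

lemma sgnb_square [simp]: "sgnb b * sgnb b = 1"
  by (simp add: sgnb_def)

lemma finite_set_signs: "finite (set_pmf (signs n))"
  unfolding signs_def by (intro finite_set_Pi_pmf) auto

lemma expectation_signs_Suc:
  fixes F :: "(nat \<Rightarrow> bool) \<Rightarrow> real"
  shows "expect (signs (Suc n)) F
    = expect (signs n) (\<lambda>\<sigma>. (F (\<sigma>(n := True)) + F (\<sigma>(n := False))) / 2)"
proof -
  have "expect (signs (Suc n)) F = expect (signs n)
      (\<lambda>\<sigma>. expect (bernoulli_pmf (1/2)) (\<lambda>b. F (\<sigma>(n := b))))"
    unfolding signs_def lessThan_Suc by (rule expectation_Pi_insert) auto
  also have "\<dots> = expect (signs n) (\<lambda>\<sigma>. (F (\<sigma>(n := True)) + F (\<sigma>(n := False))) / 2)"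
    by (simp add: add_divide_distrib)
  finally show ?thesis .
qed

lemma lin_Suc: "lin (Suc n) (\<sigma>(n := b)) y = lin n \<sigma> y + sgnb b * y n"
  by (simp add: lin_def)

lemma expectation_lin_square:
  "expect (signs n) (\<lambda>\<sigma>. (lin n \<sigma> y)\<^sup>2) = (\<Sum>a<n. (y a)\<^sup>2)"
proof (induction n)
  case 0
  show ?case by (simp add: signs_def lin_def)
next
  case (Suc n)
  have "((lin n \<sigma> y + y n)\<^sup>2 + (lin n \<sigma> y - y n)\<^sup>2) / 2 = (lin n \<sigma> y)\<^sup>2 + (y n)\<^sup>2" for \<sigma>
    by (simp add: power2_eq_square algebra_simps)
  moreover have "expect (signs (Suc n)) (\<lambda>\<sigma>. (lin (Suc n) \<sigma> y)\<^sup>2)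
      = expect (signs n) (\<lambda>\<sigma>. ((lin n \<sigma> y + y n)\<^sup>2 + (lin n \<sigma> y - y n)\<^sup>2) / 2)"
    by (simp add: expectation_signs_Suc lin_Suc sgnb_def)
  ultimately have "expect (signs (Suc n)) (\<lambda>\<sigma>. (lin (Suc n) \<sigma> y)\<^sup>2)
      = expect (signs n) (\<lambda>\<sigma>. (lin n \<sigma> y)\<^sup>2 + (y n)\<^sup>2)"
    by (simp only:)
  also have "\<dots> = expect (signs n) (\<lambda>\<sigma>. (lin n \<sigma> y)\<^sup>2) + (y n)\<^sup>2"
    by (simp add: expectation_finite finite_set_signs distrib_left sum.distrib
        sum_pmf_set flip: sum_distrib_right)
  finally show ?case by (simp add: Suc)
qed

lemma lin_square_le: "(lin n \<sigma> y)\<^sup>2 \<le> n * (\<Sum>a<n. (y a)\<^sup>2)"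
proof -
  have "(\<Sum>a<n. (sgnb (\<sigma> a))\<^sup>2) = (\<Sum>a<n. 1)" by (simp add: power2_eq_square)
  then show ?thesis
    using Cauchy_Schwarz_ineq_sum[of "\<lambda>a. sgnb (\<sigma> a)" y "{..<n}"] by (simp add: lin_def)
qed

lemma cosh_le_exp: "(exp x + exp (- x)) / 2 \<le> exp (x\<^sup>2 / 2)" for x :: real
proof -
  have nn: "(exp x + exp (- x)) / 2 \<le> exp (x\<^sup>2 / 2)" if "0 \<le> x" for x :: real
  proof -
    have pos: "0 < (1 + exp (2 * x)) / 2" by (intro divide_pos_pos add_pos_pos) auto
    \<comment> \<open>Hoeffding's lemma for a fair coin with steps 0 and 2 x; the shift by -x
      centres it.\<close>
    have "- x + ln ((1 + exp (2 * x)) / 2) \<le> (2 * x)\<^sup>2 / 8"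
      using Hoeffdings_lemma_aux[of "2 * x" "1 / 2"] that by (simp add: add_divide_distrib diff_divide_distrib)
    then have "exp (- x + ln ((1 + exp (2 * x)) / 2)) \<le> exp (x\<^sup>2 / 2)"
      by (simp add: power2_eq_square)
    also have "exp (- x + ln ((1 + exp (2 * x)) / 2)) = exp (- x) * ((1 + exp (2 * x)) / 2)"
      using pos by (simp only: exp_add exp_ln)
    also have "\<dots> = (exp x + exp (- x)) / 2"
      by (simp add: distrib_left flip: exp_add)
    finally show ?thesis .
  qed
  show ?thesis
  proof (cases "0 \<le> x")
    case False
    then show ?thesis using nn[of "- x"] by (simp add: add.commute)
  qed (rule nn)
qed

lemma expectation_exp_lin:
  "expect (signs n) (\<lambda>\<sigma>. exp (c * lin n \<sigma> y)) \<le> exp (c\<^sup>2 * (\<Sum>a<n. (y a)\<^sup>2) / 2)"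
proof (induction n)
  case 0
  show ?case by (simp add: signs_def lin_def)
next
  case (Suc n)
  have e: "(exp (c * (l + y n)) + exp (c * (l - y n))) / 2 \<le> exp (c\<^sup>2 * (y n)\<^sup>2 / 2) * exp (c * l)" for l
  proof -
    have "(exp (c * (l + y n)) + exp (c * (l - y n))) / 2 = exp (c * l) * ((exp (c * y n) + exp (- (c * y n))) / 2)"
      by (simp add: distrib_left right_diff_distrib exp_add exp_diff exp_minus field_simps)
    also have "\<dots> \<le> exp (c * l) * exp ((c * y n)\<^sup>2 / 2)" by (intro mult_left_mono cosh_le_exp) auto
    finally show ?thesis by (simp add: power_mult_distrib mult.commute)
  qed
  have "expect (signs (Suc n)) (\<lambda>\<sigma>. exp (c * lin (Suc n) \<sigma> y))
      = expect (signs n) (\<lambda>\<sigma>. (exp (c * (lin n \<sigma> y + y n)) + exp (c * (lin n \<sigma> y - y n))) / 2)"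
    by (simp add: expectation_signs_Suc lin_Suc sgnb_def)
  also have "\<dots> \<le> expect (signs n) (\<lambda>\<sigma>. exp (c\<^sup>2 * (y n)\<^sup>2 / 2) * exp (c * lin n \<sigma> y))"
    by (intro expectation_mono_finite finite_set_signs e)
  also have "\<dots> \<le> exp (c\<^sup>2 * (y n)\<^sup>2 / 2) * exp (c\<^sup>2 * (\<Sum>a<n. (y a)\<^sup>2) / 2)"
    using Suc by simp
  finally show ?case by (simp add: exp_add[symmetric] algebra_simps add_divide_distrib)
qed

lemma lin_tail_one_sided:
  assumes "0 < (\<Sum>a<n. (y a)\<^sup>2)" "0 < \<tau>"
  shows "prob_of (signs n) {\<sigma>. \<tau> * sqrt (\<Sum>a<n. (y a)\<^sup>2) \<le> lin n \<sigma> y} \<le> exp (- (\<tau>\<^sup>2 / 2))"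
proof -
  define N where "N = (\<Sum>a<n. (y a)\<^sup>2)"
  define c where "c = \<tau> / sqrt N"
  have N: "0 < N" using assms by (simp add: N_def)
  have c: "0 < c" "c * sqrt N = \<tau>" "c\<^sup>2 * N = \<tau>\<^sup>2"
    using N assms by (auto simp: c_def power_divide)
  have "prob_of (signs n) {\<sigma>. \<tau> * sqrt N \<le> lin n \<sigma> y}
      \<le> expect (signs n) (\<lambda>\<sigma>. exp (c * lin n \<sigma> y)) / exp (\<tau>\<^sup>2)"
  proof (rule markov_finite[OF finite_set_signs])
    fix \<sigma> assume "\<sigma> \<in> {\<sigma>. \<tau> * sqrt N \<le> lin n \<sigma> y}"
    then have "c * (\<tau> * sqrt N) \<le> c * lin n \<sigma> y" using c by (intro mult_left_mono) auto
    moreover have "c * (\<tau> * sqrt N) = \<tau>\<^sup>2" using c(2) by (metis mult.left_commute power2_eq_square)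
    ultimately show "exp (\<tau>\<^sup>2) \<le> exp (c * lin n \<sigma> y)" by simp
  qed auto
  also have "\<dots> \<le> exp (\<tau>\<^sup>2 / 2) / exp (\<tau>\<^sup>2)"
    using expectation_exp_lin[of n c y] c by (intro divide_right_mono) (auto simp: N_def)
  also have "\<dots> = exp (- (\<tau>\<^sup>2 / 2))" by (simp add: exp_diff[symmetric] field_simps)
  finally show ?thesis by (simp add: N_def)
qed

lemma lin_tail:
  assumes t: "0 < t"
  shows "prob_of (signs n) {\<sigma>. t * (\<Sum>a<n. (y a)\<^sup>2) < (lin n \<sigma> y)\<^sup>2} \<le> 2 * exp (- (t / 2))"
    (is "prob_of _ ?A \<le> _")
proof (cases "(\<Sum>a<n. (y a)\<^sup>2) = 0")
  case True
  then have "?A = {}" using lin_square_le[of n _ y] by (auto simp: True not_less)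
  then show ?thesis by simp
next
  case False
  have neg: "lin n \<sigma> (\<lambda>a. - y a) = - lin n \<sigma> y" for \<sigma> by (simp add: lin_def sum_negf)
  define N where "N = (\<Sum>a<n. (y a)\<^sup>2)"
  have N: "0 < N" using False by (simp add: N_def less_le sum_nonneg)
  let ?B = "\<lambda>y. {\<sigma>. sqrt t * sqrt N \<le> lin n \<sigma> y}"
  have "?A \<subseteq> ?B y \<union> ?B (\<lambda>a. - y a)"
  proof
    fix \<sigma> assume "\<sigma> \<in> ?A"
    then have "sqrt (t * N) \<le> sqrt ((lin n \<sigma> y)\<^sup>2)"
      unfolding N_def mem_Collect_eq by (intro real_sqrt_le_mono) linarith
    then show "\<sigma> \<in> ?B y \<union> ?B (\<lambda>a. - y a)" by (auto simp: real_sqrt_mult neg)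
  qed
  then have "prob_of (signs n) ?A \<le> prob_of (signs n) (?B y \<union> ?B (\<lambda>a. - y a))"
    by (intro measure_pmf.finite_measure_mono) auto
  also have "\<dots> \<le> prob_of (signs n) (?B y) + prob_of (signs n) (?B (\<lambda>a. - y a))"
    by (rule measure_Un_le) auto
  also have "\<dots> \<le> exp (- (t / 2)) + exp (- (t / 2))"
    using lin_tail_one_sided[of y n "sqrt t"] lin_tail_one_sided[of "\<lambda>a. - y a" n "sqrt t"] N t
    by (intro add_mono) (auto simp: N_def)
  finally show ?thesis by simp
qed

section \<open>One round of sketching\<close>

lemma psd_form_gram:
  "psd_form d (\<lambda>x y. \<Sum>k\<in>J. c k * (ip d (u k) x * ip d (u k) y))"
  if "\<And>k. k \<in> J \<Longrightarrow> 0 \<le> c k" for c :: "'k \<Rightarrow> real"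
proof
  show "(\<Sum>k\<in>J. c k * (ip d (u k) x * ip d (u k) y)) = (\<Sum>k\<in>J. c k * (ip d (u k) y * ip d (u k) x))" for x y
    by (simp add: mult.commute)
  show "(\<Sum>k\<in>J. c k * (ip d (u k) x * ip d (u k) y))
      = (\<Sum>i<d. x i * (\<Sum>k\<in>J. c k * (ip d (u k) (unitv i) * ip d (u k) y)))" for x y
  proof -
    have "ip d (u k) x = (\<Sum>i<d. x i * ip d (u k) (unitv i))" for k
      by (subst ip_commute, subst ip_expand) (simp add: ip_commute)
    then have "(\<Sum>k\<in>J. c k * (ip d (u k) x * ip d (u k) y))
        = (\<Sum>k\<in>J. \<Sum>i<d. x i * (c k * (ip d (u k) (unitv i) * ip d (u k) y)))"
      by (simp add: sum_distrib_left sum_distrib_right mult_ac)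
    also have "\<dots> = (\<Sum>i<d. x i * (\<Sum>k\<in>J. c k * (ip d (u k) (unitv i) * ip d (u k) y)))"
      by (subst sum.swap) (simp add: sum_distrib_left)
    finally show ?thesis .
  qed
  show "0 \<le> (\<Sum>k\<in>J. c k * (ip d (u k) x * ip d (u k) x))" for x
    using that by (intro sum_nonneg mult_nonneg_nonneg[OF _ zero_le_square])
qed

text \<open>Coins are indexed by a fixed product set, whatever the numbers \<open>t i\<close> are;
  surplus indices contribute zero.\<close>

lemma sum_truncated_pairs:
  fixes f :: "nat \<Rightarrow> nat \<Rightarrow> real"
  assumes "\<And>i. i < s \<Longrightarrow> t i \<le> K"
  shows "(\<Sum>(i,k)\<in>{..<s} \<times> {..<K}. if k < t i then f i k else 0) = (\<Sum>i<s. \<Sum>k<t i. f i k)"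
proof -
  have "(\<Sum>(i,k)\<in>{..<s} \<times> {..<K}. if k < t i then f i k else 0) = (\<Sum>i<s. \<Sum>k<K. if k < t i then f i k else 0)"
    by (simp add: sum.cartesian_product)
  also have "\<dots> = (\<Sum>i<s. \<Sum>k<t i. f i k)"
  proof (rule sum.cong[OF refl])
    fix i assume "i \<in> {..<s}"
    then have "{..<K} \<inter> {k. k < t i} = {..<t i}" using assms[of i] by auto
    then show "(\<Sum>k<K. if k < t i then f i k else 0) = (\<Sum>k<t i. f i k)"
      by (simp add: sum.If_cases)
  qed
  finally show ?thesis .
qed

lemma lin_sum: "lin n \<sigma> (\<lambda>a. \<Sum>b\<in>B. y b a * z b) = (\<Sum>b\<in>B. lin n \<sigma> (y b) * z b)"
  unfolding lin_def sum_distrib_left sum_distrib_right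
  by (subst sum.swap) (simp add: mult.assoc)

definition sketch :: "nat \<Rightarrow> (nat \<Rightarrow> nat \<Rightarrow> nat \<Rightarrow> real) \<Rightarrow> nat \<Rightarrow> (nat \<Rightarrow> bool) \<Rightarrow> nat \<Rightarrow> real" where
  "sketch n A i \<sigma> c = lin n \<sigma> (\<lambda>a. A i a c)"

definition gram_form :: "nat \<Rightarrow> nat \<Rightarrow> nat \<Rightarrow> (nat \<Rightarrow> nat \<Rightarrow> nat \<Rightarrow> real) \<Rightarrow> (nat \<Rightarrow> real) \<Rightarrow> (nat \<Rightarrow> real) \<Rightarrow> real" where
  "gram_form s n d A x y = (\<Sum>(i, a)\<in>{..<s} \<times> {..<n}. 1 * (ip d (A i a) x * ip d (A i a) y))"

lemma psd_form_gram_form: "psd_form d (gram_form s n d A)"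
  using psd_form_gram[of "{..<s} \<times> {..<n}" "\<lambda>_. 1" d "\<lambda>j. A (fst j) (snd j)"]
  by (simp add: gram_form_def[abs_def] case_prod_beta)

text \<open>\<open>w\<close> whitens A: in the coordinates \<open>coef\<close> the Gram form becomes
  the Euclidean form in \<open>r\<close> dimensions, so that concentration relative to A^T A becomes
  concentration relative to the identity. \<open>T\<close> is the truncation level.\<close>

locale isotropic =
  fixes s n d r :: nat and A :: "nat \<Rightarrow> nat \<Rightarrow> nat \<Rightarrow> real" and w :: "nat \<Rightarrow> nat \<Rightarrow> real" and T :: real
  assumes r: "r \<le> d"
    and orth: "\<And>a b. a < r \<Longrightarrow> b < r \<Longrightarrow> gram_form s n d A (w a) (w b) = of_bool (a = b)"
    and ex: "\<And>x y. gram_form s n d A x y = (\<Sum>a<r. gram_form s n d A x (w a) * gram_form s n d A y (w a))"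
    and T: "0 < T"
begin

abbreviation "gram \<equiv> gram_form s n d A"
abbreviation "sk \<equiv> sketch n A"

sublocale gram: psd_form d gram
  by (rule psd_form_gram_form)

definition col :: "nat \<Rightarrow> nat \<Rightarrow> nat \<Rightarrow> real" where
  "col i b a = ip d (A i a) (w b)"

text \<open>The sum of the leverage scores of the rows of server \<open>i\<close>, as the squared
  Frobenius norm of its whitened block.\<close>

definition lev :: "nat \<Rightarrow> real" where
  "lev i = (\<Sum>b<r. \<Sum>a<n. (col i b a)\<^sup>2)"

definition coords :: "nat \<Rightarrow> (nat \<Rightarrow> bool) \<Rightarrow> nat \<Rightarrow> real" where
  "coords i \<sigma> b = lin n \<sigma> (col i b)"

definition coef :: "(nat \<Rightarrow> real) \<Rightarrow> nat \<Rightarrow> real" where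
  "coef x b = gram x (w b)"

definition rowq :: "nat \<Rightarrow> (nat \<Rightarrow> real) \<Rightarrow> real" where
  "rowq i z = (\<Sum>a<n. (\<Sum>b<r. col i b a * z b)\<^sup>2)"

definition \<beta> :: real where
  "\<beta> = 2 * d * exp (- (T / 2))"

text \<open>The truncation event. The whitened sketch has mean squared length \<open>lev i\<close>;
  its \<open>r\<close> coordinates are subgaussian, and \<open>\<beta>\<close> is the union bound
  over them.\<close>

definition good :: "nat \<Rightarrow> (nat \<Rightarrow> bool) \<Rightarrow> bool" where
  "good i \<sigma> \<longleftrightarrow> ip r (coords i \<sigma>) (coords i \<sigma>) \<le> T * lev i"

lemma gram_coef: "gram x x = ip r (coef x) (coef x)"
  by (subst ex) (simp add: ip_def coef_def)

lemma row_expand: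
  assumes "i < s" "a < n"
  shows "ip d (A i a) x = (\<Sum>b<r. col i b a * coef x b)"
proof -
  have dom: "(ip d (A i a) x)\<^sup>2 \<le> 1 * gram x x" for x
  proof -
    have "(ip d (A i a) x)\<^sup>2 = (\<Sum>(i, a)\<in>{(i, a)}. 1 * (ip d (A i a) x * ip d (A i a) x))"
      by (simp add: power2_eq_square)
    also have "\<dots> \<le> gram x x"
      unfolding gram_form_def using assms by (intro sum_mono2) auto
    finally show ?thesis by simp
  qed
  show ?thesis
    unfolding col_def coef_def by (rule gram.dominated_functional[OF dom ex orth])
qed

lemma ip_coords: "ip r (coords i \<sigma>) z = lin n \<sigma> (\<lambda>a. \<Sum>b<r. col i b a * z b)"
  unfolding lin_sum by (simp add: ip_def coords_def)

lemma ip_sk: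
  assumes "i < s"
  shows "ip d (sk i \<sigma>) x = ip r (coords i \<sigma>) (coef x)"
proof -
  have "ip d (sk i \<sigma>) x = lin n \<sigma> (\<lambda>a. \<Sum>c<d. A i a c * x c)"
    by (simp add: ip_def sketch_def lin_sum)
  also have "\<dots> = lin n \<sigma> (\<lambda>a. \<Sum>b<r. col i b a * coef x b)"
    unfolding lin_def
  proof (rule sum.cong[OF refl])
    fix a assume "a \<in> {..<n}"
    then have "(\<Sum>c<d. A i a c * x c) = (\<Sum>b<r. col i b a * coef x b)"
      using row_expand[OF assms, of a x] by (simp add: ip_def)
    then show "sgnb (\<sigma> a) * (\<Sum>c<d. A i a c * x c) = sgnb (\<sigma> a) * (\<Sum>b<r. col i b a * coef x b)" by simp
  qed
  finally show ?thesis by (simp add: ip_coords)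
qed

lemma sum_rowq: "(\<Sum>i<s. rowq i z) = ip r z z"
proof -
  have "(\<Sum>i<s. rowq i z) = (\<Sum>i<s. \<Sum>a<n. \<Sum>b<r. \<Sum>c<r. z b * z c * (col i b a * col i c a))"
    by (simp add: rowq_def power2_eq_square sum_product mult_ac)
  also have "\<dots> = (\<Sum>(i, a)\<in>{..<s} \<times> {..<n}. \<Sum>b<r. \<Sum>c<r. z b * z c * (col i b a * col i c a))"
    by (rule sum.cartesian_product)
  also have "\<dots> = (\<Sum>b<r. \<Sum>c<r. \<Sum>(i, a)\<in>{..<s} \<times> {..<n}. z b * z c * (col i b a * col i c a))"
    unfolding case_prod_beta by (subst sum.swap, intro sum.cong refl, rule sum.swap)
  also have "\<dots> = (\<Sum>b<r. \<Sum>c<r. z b * z c * gram (w b) (w c))"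
    by (simp add: gram_form_def col_def sum_distrib_left case_prod_beta)
  also have "\<dots> = (\<Sum>b<r. \<Sum>c<r. z b * (z c * of_bool (c = b)))"
    by (intro sum.cong refl) (auto simp: orth)
  also have "\<dots> = ip r z z"
    by (simp add: ip_def sum_of_bool_eq flip: sum_distrib_left)
  finally show ?thesis .
qed

lemma lev_nonneg: "0 \<le> lev i"
  by (simp add: lev_def sum_nonneg)

lemma sum_lev: "(\<Sum>i<s. lev i) = r"
proof -
  have "(\<Sum>i<s. lev i) = (\<Sum>b<r. \<Sum>i<s. \<Sum>a<n. (col i b a)\<^sup>2)"
    unfolding lev_def by (rule sum.swap)
  also have "\<dots> = (\<Sum>b<r. gram (w b) (w b))"
    by (simp add: gram_form_def col_def power2_eq_square sum.cartesian_product)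
  finally show ?thesis by (simp add: orth)
qed

lemma lev_le: "i < s \<Longrightarrow> lev i \<le> d"
proof -
  assume "i < s"
  then have "lev i \<le> (\<Sum>i<s. lev i)" by (intro member_le_sum) (auto simp: lev_nonneg)
  then show ?thesis using r by (simp add: sum_lev)
qed

lemma beta_nonneg: "0 \<le> \<beta>"
  by (simp add: \<beta>_def)

lemma prob_not_good: "prob_of (signs n) {\<sigma>. \<not> good i \<sigma>} \<le> \<beta>"
proof -
  let ?B = "\<lambda>b. {\<sigma>. T * (\<Sum>a<n. (col i b a)\<^sup>2) < (lin n \<sigma> (col i b))\<^sup>2}"
  have "{\<sigma>. \<not> good i \<sigma>} \<subseteq> (\<Union>b<r. ?B b)"
  proof
    fix \<sigma> assume "\<sigma> \<in> {\<sigma>. \<not> good i \<sigma>}"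
    then have "(\<Sum>b<r. T * (\<Sum>a<n. (col i b a)\<^sup>2)) < (\<Sum>b<r. (lin n \<sigma> (col i b))\<^sup>2)"
      by (simp add: good_def ip_def coords_def lev_def power2_eq_square sum_distrib_left)
    moreover have "(\<Sum>b<r. (lin n \<sigma> (col i b))\<^sup>2) \<le> (\<Sum>b<r. T * (\<Sum>a<n. (col i b a)\<^sup>2))" if "\<sigma> \<notin> (\<Union>b<r. ?B b)"
      using that by (intro sum_mono) (simp add: not_less)
    ultimately show "\<sigma> \<in> (\<Union>b<r. ?B b)" by linarith
  qed
  then have "prob_of (signs n) {\<sigma>. \<not> good i \<sigma>} \<le> prob_of (signs n) (\<Union>b<r. ?B b)"
    by (intro measure_pmf.finite_measure_mono) auto
  also have "\<dots> \<le> (\<Sum>b<r. prob_of (signs n) (?B b))"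
    by (intro measure_UNION_le) auto
  also have "\<dots> \<le> (\<Sum>b<r. 2 * exp (- (T / 2)))" by (intro sum_mono lin_tail T)
  also have "\<dots> \<le> \<beta>" using r by (simp add: \<beta>_def)
  finally show ?thesis .
qed

text \<open>The mass lost by truncation is bounded crudely: a sign combination never exceeds its
  mean square by more than a factor \<open>n\<close>, and \<open>\<beta>\<close> will be chosen
  small compared with 1 / n.\<close>

lemma expectation_lin_not_good:
  "expect (signs n) (\<lambda>\<sigma>. of_bool (\<not> good i \<sigma>) * (lin n \<sigma> y)\<^sup>2) \<le> n * \<beta> * (\<Sum>a<n. (y a)\<^sup>2)"
proof -
  let ?N = "n * (\<Sum>a<n. (y a)\<^sup>2)"
  have "expect (signs n) (\<lambda>\<sigma>. of_bool (\<not> good i \<sigma>) * (lin n \<sigma> y)\<^sup>2)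
      \<le> expect (signs n) (\<lambda>\<sigma>. ?N * indicator {\<sigma>. \<not> good i \<sigma>} \<sigma>)"
    using lin_square_le[of n _ y]
    by (intro expectation_mono_finite finite_set_signs) (auto simp: indicator_def)
  also have "\<dots> = ?N * prob_of (signs n) {\<sigma>. \<not> good i \<sigma>}" by simp
  also have "\<dots> \<le> ?N * \<beta>" by (intro mult_left_mono prob_not_good) (simp add: sum_nonneg)
  finally show ?thesis by (simp add: mult_ac)
qed

lemma expectation_lin_good:
  "expect (signs n) (\<lambda>\<sigma>. of_bool (good i \<sigma>) * (lin n \<sigma> y)\<^sup>2) \<le> (\<Sum>a<n. (y a)\<^sup>2)"
  "(1 - n * \<beta>) * (\<Sum>a<n. (y a)\<^sup>2) \<le> expect (signs n) (\<lambda>\<sigma>. of_bool (good i \<sigma>) * (lin n \<sigma> y)\<^sup>2)"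
proof -
  have "(\<Sum>a<n. (y a)\<^sup>2) = expect (signs n) (\<lambda>\<sigma>. of_bool (good i \<sigma>) * (lin n \<sigma> y)\<^sup>2
      + of_bool (\<not> good i \<sigma>) * (lin n \<sigma> y)\<^sup>2)"
    unfolding expectation_lin_square[symmetric] by (intro expectation_cong) simp
  also have "\<dots> = expect (signs n) (\<lambda>\<sigma>. of_bool (good i \<sigma>) * (lin n \<sigma> y)\<^sup>2)
      + expect (signs n) (\<lambda>\<sigma>. of_bool (\<not> good i \<sigma>) * (lin n \<sigma> y)\<^sup>2)"
    by (simp add: expectation_finite[OF finite_set_signs] distrib_left sum.distrib)
  finally have eq: "(\<Sum>a<n. (y a)\<^sup>2) = \<dots>" .
  have "0 \<le> expect (signs n) (\<lambda>\<sigma>. of_bool (\<not> good i \<sigma>) * (lin n \<sigma> y)\<^sup>2)"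
    by (simp add: expectation_finite[OF finite_set_signs] sum_nonneg)
  with eq show "expect (signs n) (\<lambda>\<sigma>. of_bool (good i \<sigma>) * (lin n \<sigma> y)\<^sup>2) \<le> (\<Sum>a<n. (y a)\<^sup>2)"
    by linarith
  show "(1 - n * \<beta>) * (\<Sum>a<n. (y a)\<^sup>2) \<le> expect (signs n) (\<lambda>\<sigma>. of_bool (good i \<sigma>) * (lin n \<sigma> y)\<^sup>2)"
    using eq expectation_lin_not_good[of i y] by (simp add: algebra_simps)
qed

end

text \<open>\<open>weight\<close> bounds the squared length of one truncated and scaled summand.
  Read as a condition on \<open>t i\<close>, it asks for sketches in proportion to the leverage of
  the server at scale \<alpha>.\<close>

locale sampling_round = isotropic +
  fixes t :: "nat \<Rightarrow> nat" and K :: nat and \<alpha> \<eta> :: real and dflt :: "nat \<Rightarrow> bool"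
  assumes t: "\<And>i. i < s \<Longrightarrow> 1 \<le> t i" "\<And>i. i < s \<Longrightarrow> t i \<le> K"
    and \<alpha>: "0 < \<alpha>" "\<alpha> \<le> 1"
    and weight: "\<And>i. i < s \<Longrightarrow> T * (\<alpha> / t i) * lev i \<le> \<eta>"
    and \<eta>: "0 \<le> \<eta>"
begin

abbreviation "I \<equiv> {..<s} \<times> {..<K}"
abbreviation "coinsI \<equiv> Pi_pmf I dflt (\<lambda>_. signs n)"

definition energy :: "(nat \<times> nat \<Rightarrow> nat \<Rightarrow> bool) \<Rightarrow> (nat \<Rightarrow> real) \<Rightarrow> real" where
  "energy \<omega> x = (\<Sum>i<s. \<Sum>k<t i. \<alpha> / t i * (ip d (sk i (\<omega> (i, k))) x)\<^sup>2)"

definition tv :: "nat \<times> nat \<Rightarrow> (nat \<Rightarrow> bool) \<Rightarrow> nat \<Rightarrow> real" where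
  "tv = (\<lambda>(i, k) \<sigma> b. if k < t i then of_bool (good i \<sigma>) * sqrt (\<alpha> / t i) * coords i \<sigma> b else 0)"

lemma ip_tv: "ip r (tv (i, k) \<sigma>) z = (if k < t i then of_bool (good i \<sigma>) * sqrt (\<alpha> / t i) * ip r (coords i \<sigma>) z else 0)"
  by (simp add: tv_def ip_def sum_distrib_left mult_ac)

lemma ip_tv_square: "(ip r (tv (i, k) \<sigma>) z)\<^sup>2
    = (if k < t i then \<alpha> / t i * (of_bool (good i \<sigma>) * (ip r (coords i \<sigma>) z)\<^sup>2) else 0)"
proof -
  have "(of_bool (good i \<sigma>))\<^sup>2 = (of_bool (good i \<sigma>) :: real)" by simp
  moreover have "(sqrt (\<alpha> / t i))\<^sup>2 = \<alpha> / t i" using \<alpha> by simp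
  ultimately show ?thesis unfolding ip_tv by (simp only: power_mult_distrib if_distrib[of "\<lambda>x. x\<^sup>2"]) simp
qed

sublocale tv: rank_one_sum I dflt "\<lambda>_. signs n" r tv \<eta>
proof
  fix k :: "nat \<times> nat" and \<sigma>
  assume k: "k \<in> I"
  obtain i j where ij: "k = (i, j)" "i < s" using k by auto
  have "ip r (tv k \<sigma>) (tv k \<sigma>) = (if j < t i then of_bool (good i \<sigma>) * (\<alpha> / t i * ip r (coords i \<sigma>) (coords i \<sigma>)) else 0)"
  proof -
    define g where "g = sqrt (\<alpha> / t i)"
    have "g * g = \<alpha> / t i" using \<alpha> by (simp add: g_def)
    then have "of_bool (good i \<sigma>) * sqrt (\<alpha> / t i) * (of_bool (good i \<sigma>) * sqrt (\<alpha> / t i) * c)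
        = of_bool (good i \<sigma>) * (\<alpha> / t i * c)" for c
      unfolding g_def[symmetric] by (cases "good i \<sigma>") (simp_all flip: mult.assoc)
    moreover have "ip r (coords i \<sigma>) (tv (i, j) \<sigma>) = of_bool (good i \<sigma>) * sqrt (\<alpha> / t i) * ip r (coords i \<sigma>) (coords i \<sigma>)"
      if "j < t i" using that ip_tv[of i j \<sigma> "coords i \<sigma>"] by (simp add: ip_commute)
    ultimately show ?thesis unfolding ij(1) by (subst ip_tv) simp
  qed
  also have "\<dots> \<le> \<eta>"
  proof (cases "j < t i \<and> good i \<sigma>")
    case True
    then have "\<alpha> / t i * ip r (coords i \<sigma>) (coords i \<sigma>) \<le> \<alpha> / t i * (T * lev i)"
      using \<alpha> by (intro mult_left_mono) (auto simp: good_def)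
    also have "\<dots> \<le> \<eta>" using weight[OF ij(2)] by (simp add: mult_ac)
    finally show ?thesis using True by simp
  qed (use \<eta> in auto)
  finally show "ip r (tv k \<sigma>) (tv k \<sigma>) \<le> \<eta>" .
qed (use \<eta> finite_set_signs in auto)

lemma expectation_tv:
  "tv.mean_form z
    = \<alpha> * (\<Sum>i<s. expect (signs n) (\<lambda>\<sigma>. of_bool (good i \<sigma>) * (ip r (coords i \<sigma>) z)\<^sup>2))"
proof -
  let ?E = "\<lambda>i. expect (signs n) (\<lambda>\<sigma>. of_bool (good i \<sigma>) * (ip r (coords i \<sigma>) z)\<^sup>2)"
  have "tv.mean_form z
      = (\<Sum>(i, k)\<in>I. if k < t i then \<alpha> / t i * ?E i else 0)"
    by (rule sum.cong) (auto simp: ip_tv_square)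
  also have "\<dots> = (\<Sum>i<s. \<Sum>k<t i. \<alpha> / t i * ?E i)" by (rule sum_truncated_pairs) (rule t)
  also have "\<dots> = (\<Sum>i<s. \<alpha> * ?E i)"
    by (intro sum.cong refl) (use t(1) in \<open>force simp: field_simps\<close>)
  finally show ?thesis by (simp add: sum_distrib_left)
qed

lemma expectation_tv_le: "tv.mean_form z \<le> ip r z z"
proof -
  have "\<alpha> * (\<Sum>i<s. expect (signs n) (\<lambda>\<sigma>. of_bool (good i \<sigma>) * (ip r (coords i \<sigma>) z)\<^sup>2))
      \<le> 1 * (\<Sum>i<s. rowq i z)"
    using \<alpha> unfolding ip_coords rowq_def
    by (intro mult_mono sum_mono expectation_lin_good sum_nonneg) (auto simp: expectation_finite[OF finite_set_signs] intro!: sum_nonneg)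
  then show ?thesis by (simp add: expectation_tv sum_rowq)
qed

lemma expectation_tv_ge: "\<alpha> * ((1 - n * \<beta>) * ip r z z) \<le> tv.mean_form z"
proof -
  have "\<alpha> * (\<Sum>i<s. (1 - n * \<beta>) * rowq i z) \<le> \<alpha> * (\<Sum>i<s. expect (signs n) (\<lambda>\<sigma>. of_bool (good i \<sigma>) * (ip r (coords i \<sigma>) z)\<^sup>2))"
    using \<alpha> unfolding ip_coords rowq_def
    by (intro mult_left_mono sum_mono expectation_lin_good) auto
  then show ?thesis by (simp add: expectation_tv sum_rowq flip: sum_distrib_left)
qed

lemma energy_tv:
  assumes "\<And>i k. i < s \<Longrightarrow> k < K \<Longrightarrow> good i (\<omega> (i, k))"
  shows "energy \<omega> x = tv.sample_form \<omega> (coef x)"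
proof -
  have "tv.sample_form \<omega> (coef x)
      = (\<Sum>(i, k)\<in>I. if k < t i then \<alpha> / t i * (ip d (sk i (\<omega> (i, k))) x)\<^sup>2 else 0)"
    by (rule sum.cong) (use assms in \<open>auto simp: ip_tv_square ip_sk\<close>)
  also have "\<dots> = energy \<omega> x" unfolding energy_def by (rule sum_truncated_pairs) (rule t)
  finally show ?thesis by simp
qed

lemma prob_some_not_good:
  "prob_of coinsI {\<omega>. \<exists>i<s. \<exists>k<K. \<not> good i (\<omega> (i, k))} \<le> s * K * \<beta>"
proof -
  have "prob_of coinsI {\<omega>. \<not> good (fst j) (\<omega> j)} \<le> \<beta>" if "j \<in> I" for j
  proof -
    have "prob_of coinsI {\<omega>. \<not> good (fst j) (\<omega> j)} = prob_of (map_pmf (\<lambda>\<omega>. \<omega> j) coinsI) {\<sigma>. \<not> good (fst j) \<sigma>}"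
      by (simp add: vimage_def)
    also have "map_pmf (\<lambda>\<omega>. \<omega> j) coinsI = signs n" using that by (subst Pi_pmf_component) auto
    finally show ?thesis using prob_not_good by simp
  qed
  then have "(\<Sum>j\<in>I. prob_of coinsI {\<omega>. \<not> good (fst j) (\<omega> j)}) \<le> (\<Sum>j\<in>I. \<beta>)"
    by (rule sum_mono)
  moreover have "prob_of coinsI {\<omega>. \<exists>i<s. \<exists>k<K. \<not> good i (\<omega> (i, k))}
      \<le> prob_of coinsI (\<Union>j\<in>I. {\<omega>. \<not> good (fst j) (\<omega> j)})"
    by (intro measure_pmf.finite_measure_mono) force+
  moreover have "\<dots> \<le> (\<Sum>j\<in>I. prob_of coinsI {\<omega>. \<not> good (fst j) (\<omega> j)})"
    by (intro measure_UNION_le) auto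
  ultimately show ?thesis by (simp add: mult.assoc)
qed

text \<open>An upper bound by a multiple of the unscaled Gram form needs no lower bound on the mean.
  It is therefore available at every scale \<alpha> \<le> 1, which is all that the intermediate
  rounds use.\<close>

lemma energy_upper:
  assumes q: "real q * \<eta> \<le> 1 / 16"
  shows "prob_of coinsI {\<omega>. \<exists>x. 2 * gram x x < energy \<omega> x} \<le> s * K * \<beta> + d * exp (- (q / 16))"
    (is "prob_of _ ?A \<le> _")
proof -
  let ?B = "{\<omega>. \<exists>i<s. \<exists>k<K. \<not> good i (\<omega> (i, k))}"
  let ?U = "{\<omega>. \<exists>z. (1 + 3 * (1 / 8)) * ip r z z < tv.sample_form \<omega> z}"
  have "?A \<subseteq> ?B \<union> ?U"
  proof
    fix \<omega> assume "\<omega> \<in> ?A"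
    then obtain x where x: "2 * gram x x < energy \<omega> x" by auto
    show "\<omega> \<in> ?B \<union> ?U"
    proof (cases "\<omega> \<in> ?B")
      case False
      then have "energy \<omega> x = tv.sample_form \<omega> (coef x)" by (intro energy_tv) auto
      moreover have "(1 + 3 * (1 / 8)) * gram x x \<le> 2 * gram x x"
        by (intro mult_right_mono gram.nonneg) auto
      ultimately have "(1 + 3 * (1 / 8)) * ip r (coef x) (coef x) < tv.sample_form \<omega> (coef x)"
        using x unfolding gram_coef by linarith
      then show ?thesis by blast
    qed simp
  qed
  then have "prob_of coinsI ?A \<le> prob_of coinsI (?B \<union> ?U)"
    by (intro measure_pmf.finite_measure_mono) auto
  also have "\<dots> \<le> prob_of coinsI ?B + prob_of coinsI ?U"
    by (rule measure_Un_le) auto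
  also have "prob_of coinsI ?U \<le> r * exp (- (q * (1 / 8 / 2)))"
    using q by (intro tv.upper_tail_exp expectation_tv_le) auto
  also have "\<dots> \<le> d * exp (- (q / 16))" using r by simp
  finally show ?thesis using prob_some_not_good by linarith
qed

lemma energy_two_sided:
  assumes q: "real q * \<eta> \<le> e / 2" and e: "0 < e" "e \<le> 1 / 8" and 1: "\<alpha> = 1" and n: "n * \<beta> \<le> e"
  shows "prob_of coinsI {\<omega>. \<exists>x. (1 + 3 * e) * gram x x < energy \<omega> x \<or> energy \<omega> x < (1 - 4 * e) * gram x x}
    \<le> s * K * \<beta> + 2 * d * exp (- (q * (e / 2)))"
    (is "prob_of _ ?A \<le> _")
proof -
  let ?B = "{\<omega>. \<exists>i<s. \<exists>k<K. \<not> good i (\<omega> (i, k))}"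
  let ?U = "{\<omega>. \<exists>z. (1 + 3 * e) * ip r z z < tv.sample_form \<omega> z \<or>
                 tv.sample_form \<omega> z < (1 - 4 * e) * ip r z z}"
  have "?A \<subseteq> ?B \<union> ?U"
  proof
    fix \<omega> assume "\<omega> \<in> ?A"
    then obtain x where x: "(1 + 3 * e) * gram x x < energy \<omega> x \<or> energy \<omega> x < (1 - 4 * e) * gram x x" by auto
    show "\<omega> \<in> ?B \<union> ?U"
    proof (cases "\<omega> \<in> ?B")
      case False
      then have "energy \<omega> x = tv.sample_form \<omega> (coef x)" by (intro energy_tv) auto
      then show ?thesis using x unfolding gram_coef by auto
    qed simp
  qed
  then have "prob_of coinsI ?A \<le> prob_of coinsI (?B \<union> ?U)"
    by (intro measure_pmf.finite_measure_mono) auto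
  also have "\<dots> \<le> prob_of coinsI ?B + prob_of coinsI ?U"
    by (rule measure_Un_le) auto
  also have "prob_of coinsI ?U \<le> 2 * r * exp (- (q * (e / 2)))"
  proof (intro tv.two_sided_tail e q expectation_tv_le)
    fix z
    have "(1 - e) * ip r z z \<le> (1 - n * \<beta>) * ip r z z"
      using n by (intro mult_right_mono ip_self_nonneg) auto
    then show "(1 - e) * ip r z z \<le> tv.mean_form z"
      using expectation_tv_ge[of z] 1 by simp
  qed
  also have "\<dots> \<le> 2 * d * exp (- (q * (e / 2)))" using r by simp
  finally show ?thesis using prob_some_not_good by linarith
qed

text \<open>This is the one-dimensional instance of the concentration theorem, applied to the square roots
  of the squared lengths.\<close>

lemma average_length:
  assumes i: "i < s" and q: "real q * \<eta>' \<le> 1 / 16" and \<eta>': "T / t i \<le> \<eta>'" and n: "n * \<beta> \<le> 1 / 8"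
  shows "prob_of coinsI {\<omega>. (\<Sum>k<t i. ip r (coords i (\<omega> (i, k))) (coords i (\<omega> (i, k)))) < t i * lev i / 2}
    \<le> 2 * exp (- (q / 16))" (is "prob_of _ ?A \<le> _")
proof (cases "lev i = 0")
  case True
  then have "?A = {}" by (auto simp: not_less sum_nonneg ip_self_nonneg)
  then show ?thesis by simp
next
  case False
  then have l: "0 < lev i" using lev_nonneg[of i] by simp
  have ti: "0 < t i" using t[OF i] by simp
  let ?y = "\<lambda>\<sigma>. ip r (coords i \<sigma>) (coords i \<sigma>)"
  have ip_1: "ip 1 x y = x 0 * y 0" for x y by (simp add: ip_def)
  \<comment> \<open>Scaled by the expected total \<open>t i * lev i\<close>, so that the sum is to
    be compared with 1; only the sketches of server \<open>i\<close> take part.\<close>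
  define v where "v = (\<lambda>(j, k) \<sigma> (b :: nat). if j = i \<and> k < t i then of_bool (good i \<sigma>) * sqrt (?y \<sigma> / (t i * lev i)) else 0)"
  have v2: "(ip 1 (v (j, k) \<sigma>) x)\<^sup>2 = (if k < t i then if j = i then of_bool (good i \<sigma>) * ?y \<sigma> / (t i * lev i) * ip 1 x x else 0 else 0)" for j k \<sigma> x
  proof -
    have "0 \<le> ?y \<sigma> / (t i * lev i)" using l by (intro divide_nonneg_nonneg ip_self_nonneg) auto
    then have g: "(sqrt (?y \<sigma> / (t i * lev i)))\<^sup>2 = ?y \<sigma> / (t i * lev i)" by (rule real_sqrt_pow2)
    have "v (j, k) \<sigma> 0 = (if k < t i then if j = i then of_bool (good i \<sigma>) * sqrt (?y \<sigma> / (t i * lev i)) else 0 else 0)"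
      by (simp add: v_def)
    then have "(v (j, k) \<sigma> 0 * x 0)\<^sup>2 = (if k < t i then if j = i then
        (of_bool (good i \<sigma>))\<^sup>2 * (sqrt (?y \<sigma> / (t i * lev i)))\<^sup>2 * (x 0)\<^sup>2 else 0 else 0)"
      by (simp only: power_mult_distrib if_distrib[of "\<lambda>x. x\<^sup>2"] if_distrib[of "\<lambda>x. x * _"]) simp
    then show ?thesis unfolding g ip_1 by (simp add: power2_eq_square)
  qed
  have vv: "ip 1 (v (j, k) \<sigma>) (v (j, k) \<sigma>) = (if j = i \<and> k < t i then of_bool (good i \<sigma>) * (?y \<sigma> / (t i * lev i)) else 0)" for j k \<sigma>
  proof -
    have "0 \<le> ?y \<sigma> / (t i * lev i)" using l by (intro divide_nonneg_nonneg ip_self_nonneg) auto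
    then show ?thesis unfolding ip_1 by (simp add: v_def del: abs_divide)
  qed
  have eta'0: "0 \<le> \<eta>'" using \<eta>' T ti by (meson divide_nonneg_pos less_imp_le of_nat_0_less_iff order_trans)
  interpret v: rank_one_sum I dflt "\<lambda>_. signs n" 1 v \<eta>'
  proof
    fix k :: "nat \<times> nat" and \<sigma>
    obtain j k' where k: "k = (j, k')" by (cases k)
    have "of_bool (good i \<sigma>) * (?y \<sigma> / (t i * lev i)) \<le> \<eta>'"
    proof (cases "good i \<sigma>")
      case True
      \<comment> \<open>The leverage cancels against the truncation bound. So a number of sketches
        that does not depend on it controls the average length, and this is what \<open>t0\<close>
        is for.\<close>
      then have "?y \<sigma> / (t i * lev i) \<le> T * lev i / (t i * lev i)"
        using l by (intro divide_right_mono) (auto simp: good_def)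
      then show ?thesis using True \<eta>' l by simp
    qed (use eta'0 in auto)
    then show "ip 1 (v k \<sigma>) (v k \<sigma>) \<le> \<eta>'" unfolding k vv using eta'0 by simp
  qed (use eta'0 finite_set_signs in auto)
  have pairs: "(\<Sum>k\<in>I. if snd k < t i then if fst k = i then f (snd k) else 0 else 0) = (\<Sum>k<t i. f k)" for f :: "nat \<Rightarrow> real"
  proof -
    have "(\<Sum>k\<in>I. if snd k < t i then if fst k = i then f (snd k) else 0 else 0)
        = (\<Sum>j<s. \<Sum>k<K. if j = i then if k < t i then f k else 0 else 0)"
      unfolding sum.cartesian_product by (rule sum.cong) auto
    also have "\<dots> = (\<Sum>j<s. if j = i then \<Sum>k<K. if k < t i then f k else 0 else 0)"
      by (intro sum.cong refl) auto
    also have "\<dots> = (\<Sum>k<K. if k < t i then f k else 0)" using i by simp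
    also have "\<dots> = (\<Sum>k<t i. f k)"
    proof -
      have "{..<K} \<inter> {k. k < t i} = {..<t i}" using t(2)[OF i] by auto
      then show ?thesis by (simp add: sum.If_cases)
    qed
    finally show ?thesis .
  qed
  define E where "E = expect (signs n) (\<lambda>\<sigma>. of_bool (good i \<sigma>) * ?y \<sigma>)"
  have E: "E = (\<Sum>b<r. expect (signs n) (\<lambda>\<sigma>. of_bool (good i \<sigma>) * (lin n \<sigma> (col i b))\<^sup>2))"
    unfolding E_def expectation_finite[OF finite_set_signs]
    unfolding ip_def coords_def power2_eq_square sum_distrib_left by (rule sum.swap)
  have E_le: "E \<le> lev i" unfolding E lev_def by (intro sum_mono expectation_lin_good)
  have E_ge: "(1 - n * \<beta>) * lev i \<le> E" unfolding E lev_def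
    by (subst sum_distrib_left) (intro sum_mono expectation_lin_good)
  have mean: "v.mean_form x = E / lev i * ip 1 x x" for x
  proof -
    have "v.mean_form x
        = (\<Sum>k\<in>I. if snd k < t i then if fst k = i then (\<lambda>_. E / (t i * lev i) * ip 1 x x) (snd k) else 0 else 0)"
      by (rule sum.cong) (auto simp: v2[unfolded One_nat_def] E_def cong: if_cong)
    also have "\<dots> = t i * (E / (t i * lev i) * ip 1 x x)"
      using pairs[of "\<lambda>_. E / (t i * lev i) * ip 1 x x"] by simp
    finally show ?thesis using ti by simp
  qed
  have "prob_of coinsI ?A \<le> prob_of coinsI
      {\<omega>. \<exists>x. (1 + 3 * (1 / 8)) * ip 1 x x < v.sample_form \<omega> x \<or>
              v.sample_form \<omega> x < (1 - 4 * (1 / 8)) * ip 1 x x}"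
  proof (intro measure_pmf.finite_measure_mono subsetI CollectI exI disjI2)
    fix \<omega> assume "\<omega> \<in> ?A"
    then have A: "(\<Sum>k<t i. ?y (\<omega> (i, k))) < t i * lev i / 2" by simp
    have "v.sample_form \<omega> (\<lambda>_. 1) = (\<Sum>k\<in>I. if snd k < t i then if fst k = i then
        (\<lambda>k. of_bool (good i (\<omega> (i, k))) * ?y (\<omega> (i, k)) / (t i * lev i)) (snd k) else 0 else 0)"
    proof (rule sum.cong[OF refl])
      fix j assume "j \<in> I"
      obtain j1 j2 where j: "j = (j1, j2)" by (cases j)
      have "ip 1 (\<lambda>_. 1) (\<lambda>_. 1) = 1" by (simp add: ip_def)
      then show "(ip 1 (v j (\<omega> j)) (\<lambda>_. 1))\<^sup>2 = (if snd j < t i then if fst j = i then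
        (\<lambda>k. of_bool (good i (\<omega> (i, k))) * ?y (\<omega> (i, k)) / (t i * lev i)) (snd j) else 0 else 0)"
        unfolding j v2 by simp
    qed
    also have "\<dots> = (\<Sum>k<t i. of_bool (good i (\<omega> (i, k))) * ?y (\<omega> (i, k)) / (t i * lev i))"
      using pairs[of "\<lambda>k. of_bool (good i (\<omega> (i, k))) * ?y (\<omega> (i, k)) / (t i * lev i)"] by simp
    also have "\<dots> \<le> (\<Sum>k<t i. ?y (\<omega> (i, k)) / (t i * lev i))"
      using l by (intro sum_mono divide_right_mono) (auto simp: ip_self_nonneg)
    also have "\<dots> < 1 / 2" using A l ti by (simp add: pos_divide_less_eq flip: sum_divide_distrib)
    finally show "v.sample_form \<omega> (\<lambda>_. 1) < (1 - 4 * (1 / 8)) * ip 1 (\<lambda>_. 1) (\<lambda>_. 1)"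
      by (simp add: ip_def)
  qed simp
  also have "\<dots> \<le> real (2 * 1) * exp (- (q * (1 / 8 / 2)))"
  proof (rule v.two_sided_tail)
    fix x
    have "E / lev i \<le> 1" using E_le l by simp
    then have "E / lev i * ip 1 x x \<le> 1 * ip 1 x x" by (intro mult_right_mono ip_self_nonneg)
    then show "v.mean_form x \<le> ip 1 x x"
      unfolding mean by simp
    have "1 - 1 / 8 \<le> 1 - n * \<beta>" using n by simp
    also have "\<dots> \<le> E / lev i" using E_ge l by (simp add: pos_le_divide_eq)
    finally show "(1 - 1 / 8) * ip 1 x x \<le> v.mean_form x"
      unfolding mean by (intro mult_right_mono ip_self_nonneg)
  qed (use q in auto)
  finally show ?thesis by simp
qed

end

section \<open>Adaptive sampling\<close>

definition energy_form :: "nat \<Rightarrow> nat \<Rightarrow> real \<Rightarrow> (nat \<Rightarrow> nat) \<Rightarrow> (nat \<Rightarrow> nat \<Rightarrow> nat \<Rightarrow> real) \<Rightarrow> (nat \<Rightarrow> real) \<Rightarrow> real" where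
  "energy_form s d \<alpha> t u x = (\<Sum>i<s. \<Sum>k<t i. \<alpha> / t i * (ip d (u i k) x)\<^sup>2)"

text \<open>Everything the analysis uses of leverage scores: \<open>\<tau> i k\<close> dominates the
  sketch as a functional relative to the sketched form, and \<open>S i\<close> is the weighted total
  of server \<open>i\<close>.\<close>

definition score_spec :: "nat \<Rightarrow> nat \<Rightarrow> real \<Rightarrow> (nat \<Rightarrow> nat) \<Rightarrow> (nat \<Rightarrow> nat \<Rightarrow> nat \<Rightarrow> real) \<Rightarrow> (nat \<Rightarrow> real) \<Rightarrow> bool" where
  "score_spec s d \<alpha> t u S \<longleftrightarrow> (\<forall>i<s. 0 \<le> S i) \<and> (\<Sum>i<s. S i) \<le> d \<and>
     (\<exists>\<tau>. (\<forall>i<s. S i = (\<Sum>k<t i. \<alpha> / t i * \<tau> i k)) \<and>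
        (\<forall>i<s. \<forall>k<t i. 0 \<le> \<tau> i k \<and> (\<forall>x. (ip d (u i k) x)\<^sup>2 \<le> \<tau> i k * energy_form s d \<alpha> t u x)))"

text \<open>The scores are leverage scores of the sketched matrix itself, so they add up to its rank.\<close>

lemma score_spec_ex:
  assumes \<alpha>: "0 < \<alpha>"
  shows "\<exists>S. score_spec s d \<alpha> t u S"
proof -
  define J where "J = Sigma {..<s} (\<lambda>i. {..<t i})"
  define Q where "Q = (\<lambda>x y. \<Sum>j\<in>J. \<alpha> / t (fst j) * (ip d (u (fst j) (snd j)) x * ip d (u (fst j) (snd j)) y))"
  interpret Q: psd_form d Q
    unfolding Q_def by (rule psd_form_gram) (use \<alpha> in auto)
  have sumJ: "(\<Sum>j\<in>J. f (fst j) (snd j)) = (\<Sum>i<s. \<Sum>k<t i. f i k)" for f :: "nat \<Rightarrow> nat \<Rightarrow> real"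
    unfolding J_def by (subst sum.Sigma) (auto simp: case_prod_beta)
  have QE: "Q x x = energy_form s d \<alpha> t u x" for x
    using sumJ[of "\<lambda>i k. \<alpha> / t i * (ip d (u i k) x)\<^sup>2"] by (simp add: Q_def energy_form_def power2_eq_square)
  obtain r w where r: "r \<le> d" and orth: "\<And>a b. a < r \<Longrightarrow> b < r \<Longrightarrow> Q (w a) (w b) = of_bool (a = b)"
    and ex: "\<And>x y. Q x y = (\<Sum>a<r. Q x (w a) * Q y (w a))"
    by (rule Q.orthonormal_basis) (rule that)
  define \<tau> where "\<tau> = (\<lambda>i k. \<Sum>a<r. (ip d (u i k) (w a))\<^sup>2)"
  define S where "S = (\<lambda>i. \<Sum>k<t i. \<alpha> / t i * \<tau> i k)"
  have tau0: "0 \<le> \<tau> i k" for i k by (simp add: \<tau>_def sum_nonneg)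
  have "(\<Sum>i<s. S i) = (\<Sum>j\<in>J. \<alpha> / t (fst j) * \<tau> (fst j) (snd j))"
    unfolding S_def by (rule sumJ[symmetric])
  also have "\<dots> = (\<Sum>a<r. Q (w a) (w a))"
    unfolding Q_def \<tau>_def sum_distrib_left by (subst sum.swap) (simp add: power2_eq_square)
  also have "\<dots> \<le> d" using r by (simp add: orth)
  finally have S_sum: "(\<Sum>i<s. S i) \<le> d" .
  have dom: "(ip d (u i k) x)\<^sup>2 \<le> \<tau> i k * energy_form s d \<alpha> t u x" if "i < s" "k < t i" for i k x
  proof -
    define c where "c = \<alpha> / t i"
    have c: "0 < c" using \<alpha> that by (simp add: c_def)
    have "(ip d (u i k) x)\<^sup>2 \<le> (1 / c) * Q x x" for x
    proof -
      have "c * (ip d (u i k) x)\<^sup>2 = (\<Sum>j\<in>{(i, k)}. \<alpha> / t (fst j) * (ip d (u (fst j) (snd j)) x * ip d (u (fst j) (snd j)) x))"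
        by (simp add: c_def power2_eq_square)
      also have "\<dots> \<le> Q x x"
        unfolding Q_def using that \<alpha> by (intro sum_mono2) (auto simp: J_def)
      finally show ?thesis using c by (simp add: field_simps)
    qed
    then have "ip d (u i k) x = (\<Sum>a<r. ip d (u i k) (w a) * Q x (w a))"
      by (rule Q.dominated_functional[OF _ ex orth])
    then have "(ip d (u i k) x)\<^sup>2 \<le> \<tau> i k * (\<Sum>a<r. (Q x (w a))\<^sup>2)"
      unfolding \<tau>_def using Cauchy_Schwarz_ineq_sum[of "\<lambda>a. ip d (u i k) (w a)" "\<lambda>a. Q x (w a)" "{..<r}"] by simp
    also have "(\<Sum>a<r. (Q x (w a))\<^sup>2) = energy_form s d \<alpha> t u x"
      unfolding QE[symmetric] ex[of x x] by (simp add: power2_eq_square)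
    finally show ?thesis .
  qed
  have "score_spec s d \<alpha> t u S"
    unfolding score_spec_def using S_sum tau0 dom \<alpha>
    by (intro conjI exI[of _ \<tau>]) (auto simp: S_def intro!: sum_nonneg)
  then show ?thesis by blast
qed

definition score :: "nat \<Rightarrow> nat \<Rightarrow> real \<Rightarrow> (nat \<Rightarrow> nat) \<Rightarrow> (nat \<Rightarrow> nat \<Rightarrow> nat \<Rightarrow> real) \<Rightarrow> nat \<Rightarrow> real" where
  "score s d \<alpha> t u = (SOME S. score_spec s d \<alpha> t u S)"

lemma score_spec_score: "0 < \<alpha> \<Longrightarrow> score_spec s d \<alpha> t u (score s d \<alpha> t u)"
  unfolding score_def using someI_ex[OF score_spec_ex] .

text \<open>The summand \<open>t0\<close> serves the concentration of average lengths for every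
  server, however small its leverage; the multiple of the score serves the bound on a single
  summand.\<close>

definition next_counts :: "nat \<Rightarrow> real \<Rightarrow> nat \<Rightarrow> nat \<Rightarrow> real \<Rightarrow> (nat \<Rightarrow> nat) \<Rightarrow> (nat \<Rightarrow> nat \<Rightarrow> nat \<Rightarrow> real) \<Rightarrow> nat \<Rightarrow> nat" where
  "next_counts t0 C s d \<alpha> t u i = t0 + nat \<lceil>C * score s d \<alpha> t u i\<rceil>"

lemma next_counts_ge: "t0 \<le> next_counts t0 C s d \<alpha> t u i"
  "C * score s d \<alpha> t u i \<le> next_counts t0 C s d \<alpha> t u i"
  unfolding next_counts_def by (simp, linarith)

lemma next_counts_le:
  fixes C :: real
  assumes "0 < \<alpha>" "0 \<le> C" "i < s"
  shows "next_counts t0 C s d \<alpha> t u i \<le> t0 + 1 + C * score s d \<alpha> t u i"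
proof -
  have "0 \<le> score s d \<alpha> t u i" using score_spec_score[OF assms(1)] assms(3) by (auto simp: score_spec_def)
  then have "0 \<le> C * score s d \<alpha> t u i" using assms by simp
  then have "0 \<le> \<lceil>C * score s d \<alpha> t u i\<rceil>" by linarith
  moreover have "real_of_int \<lceil>C * score s d \<alpha> t u i\<rceil> \<le> C * score s d \<alpha> t u i + 1"
    by (rule of_int_ceiling_le_add_one)
  ultimately show ?thesis unfolding next_counts_def of_nat_add by (simp only: of_nat_nat)
qed

lemma sum_next_counts_le:
  fixes C :: real
  assumes "0 < \<alpha>" "0 \<le> C"
  shows "(\<Sum>i<s. real (next_counts t0 C s d \<alpha> t u i)) \<le> s * (t0 + 1) + C * d"
proof -
  have "(\<Sum>i<s. real (next_counts t0 C s d \<alpha> t u i)) \<le> (\<Sum>i<s. t0 + 1 + C * score s d \<alpha> t u i)"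
  proof (rule sum_mono)
    fix i assume "i \<in> {..<s}"
    then show "real (next_counts t0 C s d \<alpha> t u i) \<le> t0 + 1 + C * score s d \<alpha> t u i"
      using next_counts_le[OF assms, of i s t0 d t u] by simp
  qed
  also have "\<dots> = s * (t0 + 1) + C * (\<Sum>i<s. score s d \<alpha> t u i)"
    by (simp add: sum.distrib sum_distrib_left algebra_simps)
  also have "\<dots> \<le> s * (t0 + 1) + C * d"
    using score_spec_score[OF assms(1), of s d t u] assms(2)
    by (intro add_left_mono mult_left_mono) (auto simp: score_spec_def)
  finally show ?thesis by (simp add: algebra_simps)
qed

lemma next_counts_le_max:
  fixes C :: real
  assumes "0 < \<alpha>" "0 \<le> C" "i < s"
  shows "next_counts t0 C s d \<alpha> t u i \<le> t0 + 1 + C * d"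
proof -
  have sp: "score_spec s d \<alpha> t u (score s d \<alpha> t u)" by (rule score_spec_score) fact
  have "score s d \<alpha> t u i \<le> (\<Sum>i<s. score s d \<alpha> t u i)"
    using sp assms(3) by (intro member_le_sum) (auto simp: score_spec_def)
  also have "\<dots> \<le> d" using sp by (simp add: score_spec_def)
  finally have "C * score s d \<alpha> t u i \<le> C * d" using assms by (intro mult_left_mono)
  then show ?thesis using next_counts_le[OF assms, of t0 d t u] by linarith
qed

section \<open>The rounds and their failure probability\<close>

type_synonym coin_table = "nat \<Rightarrow> nat \<times> nat \<Rightarrow> nat \<Rightarrow> bool"

primrec counts :: "nat \<Rightarrow> real \<Rightarrow> nat \<Rightarrow> nat \<Rightarrow> nat \<Rightarrow> nat \<Rightarrow> (nat \<Rightarrow> nat \<Rightarrow> nat \<Rightarrow> real) \<Rightarrow> coin_table \<Rightarrow> nat \<Rightarrow> nat \<Rightarrow> nat" where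
  "counts t0 C s n d R A \<omega> 0 = (\<lambda>_. t0)"
| "counts t0 C s n d R A \<omega> (Suc j) = next_counts t0 C s d (2 ^ j / 2 ^ R) (counts t0 C s n d R A \<omega> j)
     (\<lambda>i k. sketch n A i (\<omega> j (i, k)))"

text \<open>The counts of a round are settled before its coins are drawn, so each round can be
  analysed with the earlier coins fixed.\<close>

lemma counts_cong:
  "(\<And>j. j < m \<Longrightarrow> \<omega> j = \<omega>' j) \<Longrightarrow> counts t0 C s n d R A \<omega> m = counts t0 C s n d R A \<omega>' m"
  by (induction m) auto

lemma counts_ge: "t0 \<le> counts t0 C s n d R A \<omega> j i"
  by (cases j) (auto simp: next_counts_ge)

lemma counts_le_max:
  fixes C :: real
  assumes "0 \<le> C" "i < s"
  shows "real (counts t0 C s n d R A \<omega> j i) \<le> t0 + 1 + C * d"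
  using assms by (cases j) (auto simp: next_counts_le_max)

lemma sum_counts_le:
  fixes C :: real
  assumes "0 \<le> C"
  shows "(\<Sum>i<s. real (counts t0 C s n d R A \<omega> j i)) \<le> s * (t0 + 1) + C * d"
proof (cases j)
  case 0
  have "real s * real t0 \<le> real s * (real t0 + 1)" by (intro mult_left_mono) auto
  then show ?thesis using 0 assms by (simp add: add_increasing2)
qed (use assms in \<open>simp add: sum_next_counts_le\<close>)

text \<open>Conditional union bound: \<open>B\<close> is the failure of the earlier rounds, and
  \<open>k\<close> is the index of the new one.\<close>

lemma prob_Pi_insert_le:
  fixes p :: "'k \<Rightarrow> 'a pmf"
  assumes K: "finite K" "k \<notin> K" and fin: "\<And>j. j \<in> insert k K \<Longrightarrow> finite (set_pmf (p j))"
    and c: "0 \<le> c" "\<And>f. f \<notin> B \<Longrightarrow> prob_of (p k) {y. f(k := y) \<in> A} \<le> c"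
  shows "prob_of (Pi_pmf (insert k K) dflt p) A \<le> prob_of (Pi_pmf K dflt p) B + c"
proof -
  have fK: "finite (set_pmf (Pi_pmf K dflt p))" using K fin by (intro finite_set_Pi_pmf) auto
  have "prob_of (Pi_pmf (insert k K) dflt p) A = expect (Pi_pmf (insert k K) dflt p) (indicator A)"
    by simp
  also have "\<dots> = expect (Pi_pmf K dflt p) (\<lambda>f. expect (p k) (\<lambda>y. indicator A (f(k := y))))"
    by (rule expectation_Pi_insert[OF K fin])
  also have "\<dots> \<le> expect (Pi_pmf K dflt p) (\<lambda>f. indicator B f + c)"
  proof (rule expectation_mono_finite[OF fK])
    fix f
    have eq: "expect (p k) (\<lambda>y. indicator A (f(k := y))) = prob_of (p k) {y. f(k := y) \<in> A}"
    proof -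
      have "(\<lambda>y. indicator A (f(k := y)) :: real) = indicator {y. f(k := y) \<in> A}" by (auto simp: indicator_def)
      then show ?thesis by simp
    qed
    show "expect (p k) (\<lambda>y. indicator A (f(k := y))) \<le> indicator B f + c"
    proof (cases "f \<in> B")
      case True
      show ?thesis
      proof -
        have "prob_of (p k) {y. f(k := y) \<in> A} \<le> 1" by (rule measure_pmf.prob_le_1)
        moreover have "indicator B f = (1 :: real)" using True by simp
        ultimately show ?thesis unfolding eq using c(1) by linarith
      qed
    qed (use eq c in simp)
  qed
  also have "\<dots> = expect (Pi_pmf K dflt p) (indicator B) + c"
    by (subst Bochner_Integration.integral_add) (auto intro: integrable_measure_pmf_finite fK)
  finally show ?thesis by simp
qed

text \<open>Two accuracies are kept apart. The pair \<open>\<eta>0\<close>, \<open>q0\<close> gives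
  constant accuracy and is enough for round 0 and for estimating scores; the finer pair
  \<open>\<eta>\<close>, \<open>q\<close> gives accuracy \<open>e\<close> in the last round.\<close>

locale adaptive_sampling = isotropic +
  fixes R K t0 q q0 :: nat and C \<eta> \<eta>0 e :: real
  assumes R: "1 \<le> R" "d \<le> 2 ^ R" and s: "1 \<le> s"
    and t0: "1 \<le> t0" "T / t0 \<le> \<eta>0" and K: "t0 + 1 + C * d \<le> K"
    and C: "0 < C" "8 * T / C \<le> \<eta>" and \<eta>: "\<eta> \<le> \<eta>0"
    and q0: "real q0 * \<eta>0 \<le> 1 / 16" and q: "real q * \<eta> \<le> e / 2"
    and e: "0 < e" "e \<le> 1 / 8" and n\<beta>: "n * \<beta> \<le> e"
begin

abbreviation "cnt \<equiv> counts t0 C s n d R A"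
abbreviation "sketches \<omega> j \<equiv> (\<lambda>i k. sketch n A i (\<omega> j (i, k)))"
abbreviation "\<alpha> j \<equiv> 2 ^ j / 2 ^ R :: real"
abbreviation "round_coins dflt \<equiv> Pi_pmf ({..<s} \<times> {..<K}) dflt (\<lambda>_. signs n)"
abbreviation "table dflt dflt' J \<equiv> Pi_pmf J dflt (\<lambda>_. round_coins dflt')"

text \<open>The invariant lags by one scale: the counts of round \<open>j\<close> come from scores
  at scale \<open>\<alpha> (j - 1)\<close>. Round 0 needs no condition, its scale being at most 1 /
  d.\<close>

definition large_enough :: "nat \<Rightarrow> coin_table \<Rightarrow> bool" where
  "large_enough j \<omega> \<longleftrightarrow> j = 0 \<or> (\<forall>i<s. C * \<alpha> (j - 1) * lev i / 4 \<le> cnt \<omega> j i)"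

text \<open>Every sketch has self score at least half its whitened squared length, because the
  sketched form is at most twice the true one. Average lengths of at least half the leverage then
  give the factor 1 / 4.\<close>

lemma score_ge:
  assumes \<alpha>: "0 < \<alpha>'" and upper: "\<And>x. energy_form s d \<alpha>' t (\<lambda>i k. sk i (\<sigma> (i, k))) x \<le> 2 * gram x x"
    and len: "t i * lev i / 2 \<le> (\<Sum>k<t i. ip r (coords i (\<sigma> (i, k))) (coords i (\<sigma> (i, k))))"
    and i: "i < s" and ti: "1 \<le> t i"
  shows "\<alpha>' * lev i / 4 \<le> score s d \<alpha>' t (\<lambda>i k. sk i (\<sigma> (i, k))) i"
proof -
  let ?u = "\<lambda>i k. sk i (\<sigma> (i, k))"
  obtain \<tau> where S: "score s d \<alpha>' t ?u i = (\<Sum>k<t i. \<alpha>' / t i * \<tau> i k)"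
    and tau: "\<And>k. k < t i \<Longrightarrow> 0 \<le> \<tau> i k"
    and dom: "\<And>k x. k < t i \<Longrightarrow> (ip d (?u i k) x)\<^sup>2 \<le> \<tau> i k * energy_form s d \<alpha>' t ?u x"
    using score_spec_score[OF \<alpha>, of s d t ?u] i unfolding score_spec_def by blast
  have y: "ip r (coords i (\<sigma> (i, k))) (coords i (\<sigma> (i, k))) / 2 \<le> \<tau> i k" if k: "k < t i" for k
  proof -
    define y where "y = coords i (\<sigma> (i, k))"
    \<comment> \<open>The vector with whitened coordinates \<open>y\<close>: on it the sketch takes
      the value |y|^2 and the Gram form as well, the extremal case of Cauchy-Schwarz.\<close>
    define x where "x = (\<lambda>c. \<Sum>b<r. y b * w b c)"
    have cx: "coef x b = y b" if "b < r" for b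
      using that unfolding coef_def x_def gram.sum_left gram.scale_left by (simp add: orth sum_of_bool_eq)
    have g: "gram x x = ip r y y" unfolding gram_coef by (simp add: ip_def cx)
    have u: "ip d (?u i k) x = ip r y y" unfolding ip_sk[OF i] y_def[symmetric] by (simp add: ip_def cx)
    have "(ip r y y)\<^sup>2 \<le> \<tau> i k * energy_form s d \<alpha>' t ?u x" using dom[OF k, of x] by (simp only: u)
    also have "\<dots> \<le> \<tau> i k * (2 * ip r y y)" using upper[of x] tau[OF k] by (intro mult_left_mono) (simp_all add: g)
    finally have "ip r y y * ip r y y \<le> ip r y y * (2 * \<tau> i k)" by (simp add: power2_eq_square mult_ac)
    then have "ip r y y \<le> 2 * \<tau> i k"
      using ip_self_nonneg[of r y] tau[OF k] by (cases "ip r y y = 0") auto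
    then show ?thesis by (simp add: y_def)
  qed
  have "\<alpha>' * lev i / 4 = \<alpha>' / t i * (t i * lev i / 2 / 2)" using ti by (simp add: field_simps)
  also have "\<dots> \<le> \<alpha>' / t i * ((\<Sum>k<t i. ip r (coords i (\<sigma> (i, k))) (coords i (\<sigma> (i, k)))) / 2)"
    using \<alpha> len by (intro mult_left_mono divide_right_mono) auto
  also have "\<dots> = (\<Sum>k<t i. \<alpha>' / t i * (ip r (coords i (\<sigma> (i, k))) (coords i (\<sigma> (i, k))) / 2))"
    by (simp add: sum_distrib_left sum_divide_distrib)
  also have "\<dots> \<le> score s d \<alpha>' t ?u i"
    unfolding S using \<alpha> y by (intro sum_mono mult_left_mono) auto
  finally show ?thesis .
qed

lemma eta_nonneg: "0 \<le> \<eta>"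
proof -
  have "0 \<le> 8 * T / C" using T C by simp
  then show ?thesis using C by linarith
qed

lemma weight_bound:
  assumes le: "large_enough j \<omega>" and i: "i < s"
  shows "T * (\<alpha> j / cnt \<omega> j i) * lev i \<le> (if j = 0 then \<eta>0 else \<eta>)"
proof (cases j)
  case 0
  have "lev i \<le> 2 ^ R"
  proof -
    have "real d \<le> 2 ^ R" using R(2) of_nat_le_iff[of d "2 ^ R", where 'a = real] by simp
    then show ?thesis using lev_le[OF i] by linarith
  qed
  then have "T / t0 * (lev i / 2 ^ R) \<le> T / t0 * 1"
    using T by (intro mult_left_mono) auto
  then show ?thesis using 0 t0(2) by (simp add: mult_ac)
next
  case (Suc m)
  let ?t = "real (cnt \<omega> j i)"
  have pos: "0 < ?t" using counts_ge[of t0 C s n d R A \<omega> j i] t0(1) by simp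
  have "C * \<alpha> m * lev i / 4 \<le> ?t" using le i Suc by (simp add: large_enough_def)
  then have "\<alpha> j * lev i \<le> 8 / C * ?t"
    using C by (simp add: Suc field_simps)
  then have "T * (\<alpha> j * lev i) \<le> T * (8 / C * ?t)" using T by (intro mult_left_mono) auto
  then have "T * (\<alpha> j * lev i) / ?t \<le> 8 * T / C" using pos C by (simp add: field_simps)
  then show ?thesis using Suc C by (simp add: mult_ac)
qed

lemma sampling_round:
  assumes "large_enough j \<omega>" "j \<le> R"
  shows "sampling_round s n d r A w T (cnt \<omega> j) K (\<alpha> j) (if j = 0 then \<eta>0 else \<eta>)"
proof unfold_locales
  fix i assume i: "i < s"
  show "1 \<le> cnt \<omega> j i" using counts_ge[of t0 C s n d R A \<omega> j i] t0(1) by simp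
  have "real (cnt \<omega> j i) \<le> real K" using counts_le_max[OF _ i, of C t0 n d R A \<omega> j] C K by linarith
  then show "cnt \<omega> j i \<le> K" by simp
  show "T * (\<alpha> j / cnt \<omega> j i) * lev i \<le> (if j = 0 then \<eta>0 else \<eta>)" by (rule weight_bound) fact+
next
  show "\<alpha> j \<le> 1" using assms(2) by simp
  show "0 \<le> (if j = 0 then \<eta>0 else \<eta>)" using eta_nonneg \<eta> by simp
qed simp

definition \<rho> :: real where
  "\<rho> = s * K * \<beta> + 3 * s * d * exp (- (q0 / 16))"

lemma large_enough_step:
  assumes le: "large_enough j \<omega>" and j: "j \<le> R" and d: "1 \<le> d"
  shows "prob_of (round_coins dflt) {\<sigma>. \<not> large_enough (Suc j) (\<omega> (j := \<sigma>))} \<le> \<rho>"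
    (is "prob_of ?P ?A \<le> _")
proof -
  interpret rd: sampling_round s n d r A w T "cnt \<omega> j" K "\<alpha> j" "if j = 0 then \<eta>0 else \<eta>" dflt
    by (rule sampling_round) fact+
  let ?U = "{\<sigma>. \<exists>x. 2 * gram x x < rd.energy \<sigma> x}"
  let ?V = "\<lambda>i. {\<sigma>. (\<Sum>k<cnt \<omega> j i. ip r (coords i (\<sigma> (i, k))) (coords i (\<sigma> (i, k)))) < cnt \<omega> j i * lev i / 2}"
  have "?A \<subseteq> ?U \<union> (\<Union>i<s. ?V i)"
  proof
    fix \<sigma> assume A: "\<sigma> \<in> ?A"
    show "\<sigma> \<in> ?U \<union> (\<Union>i<s. ?V i)"
    proof (rule ccontr)
      assume N: "\<sigma> \<notin> ?U \<union> (\<Union>i<s. ?V i)"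
      have c: "cnt (\<omega> (j := \<sigma>)) j = cnt \<omega> j" by (rule counts_cong) simp
      have "C * \<alpha> j * lev i / 4 \<le> cnt (\<omega> (j := \<sigma>)) (Suc j) i" if i: "i < s" for i
      proof -
        have "\<alpha> j * lev i / 4 \<le> score s d (\<alpha> j) (cnt \<omega> j) (\<lambda>i k. sk i (\<sigma> (i, k))) i"
        proof (rule score_ge[OF _ _ _ i])
          show "energy_form s d (\<alpha> j) (cnt \<omega> j) (\<lambda>i k. sk i (\<sigma> (i, k))) x \<le> 2 * gram x x" for x
          proof -
            have "energy_form s d (\<alpha> j) (cnt \<omega> j) (\<lambda>i k. sk i (\<sigma> (i, k))) x = rd.energy \<sigma> x"
              by (simp add: energy_form_def rd.energy_def)
            moreover have "rd.energy \<sigma> x \<le> 2 * gram x x" using N by (simp add: not_less)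
            ultimately show ?thesis by simp
          qed
          show "real (cnt \<omega> j i) * lev i / 2 \<le> (\<Sum>k<cnt \<omega> j i. ip r (coords i (\<sigma> (i, k))) (coords i (\<sigma> (i, k))))"
            using N i by (simp add: not_less)
        qed (use rd.t(1)[OF i] in auto)
        then have "C * (\<alpha> j * lev i / 4) \<le> C * score s d (\<alpha> j) (cnt \<omega> j) (\<lambda>i k. sk i (\<sigma> (i, k))) i"
          using C by (intro mult_left_mono) auto
        also have "\<dots> \<le> next_counts t0 C s d (\<alpha> j) (cnt \<omega> j) (\<lambda>i k. sk i (\<sigma> (i, k))) i"
          by (rule next_counts_ge)
        finally show ?thesis by (simp add: c mult.assoc)
      qed
      then have "large_enough (Suc j) (\<omega> (j := \<sigma>))" by (simp add: large_enough_def)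
      then show False using A by simp
    qed
  qed
  then have "prob_of ?P ?A \<le> prob_of ?P (?U \<union> (\<Union>i<s. ?V i))"
    by (intro measure_pmf.finite_measure_mono) auto
  also have "\<dots> \<le> prob_of ?P ?U + prob_of ?P (\<Union>i<s. ?V i)"
    by (rule measure_Un_le) auto
  also have "prob_of ?P ?U \<le> s * K * \<beta> + d * exp (- (q0 / 16))"
  proof (rule rd.energy_upper)
    have "real q0 * \<eta> \<le> real q0 * \<eta>0" using \<eta> by (intro mult_left_mono) auto
    then show "real q0 * (if j = 0 then \<eta>0 else \<eta>) \<le> 1 / 16" using q0 by auto
  qed
  also have "prob_of ?P (\<Union>i<s. ?V i) \<le> (\<Sum>i<s. prob_of ?P (?V i))"
    by (intro measure_UNION_le) auto
  also have "\<dots> \<le> (\<Sum>i<s. 2 * exp (- (q0 / 16)))"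
  proof (rule sum_mono, rule rd.average_length)
    fix i assume "i \<in> {..<s}"
    then show "i < s" by simp
    have "real t0 \<le> cnt \<omega> j i" using counts_ge[of t0 C s n d R A \<omega> j i] by simp
    then have "T / cnt \<omega> j i \<le> T / t0" using t0 T by (intro divide_left_mono) auto
    then show "T / cnt \<omega> j i \<le> \<eta>0" using t0 by linarith
  qed (use q0 n\<beta> e in auto)
  also have "s * K * \<beta> + d * exp (- (q0 / 16)) + (\<Sum>i<s. 2 * exp (- (q0 / 16))) \<le> \<rho>"
  proof -
    \<comment> \<open>\<open>d\<close> comes from the energy bound over all directions and 2 from
      the average length of each server.\<close>
    have "real d + 2 * real s \<le> 3 * real s * real d"
    proof -
      have "real d \<le> real s * real d" using s by (simp add: mult_le_cancel_right1)
      moreover have "real s \<le> real s * real d" using d by (simp add: mult_le_cancel_left1)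
      ultimately show ?thesis by linarith
    qed
    then have "(real d + 2 * real s) * exp (- (q0 / 16)) \<le> 3 * real s * real d * exp (- (q0 / 16))"
      by (rule mult_right_mono) simp
    then show ?thesis by (simp add: \<rho>_def algebra_simps)
  qed
  finally show ?thesis by simp
qed

lemma finite_round: "finite (set_pmf (round_coins dflt))"
  by (intro finite_set_Pi_pmf finite_set_signs) auto

lemma rho_nonneg: "0 \<le> \<rho>"
  using beta_nonneg by (simp add: \<rho>_def)

lemma prob_not_large_enough:
  assumes d: "1 \<le> d"
  shows "j \<le> R \<Longrightarrow> prob_of (table dflt dflt' {..<j}) {\<omega>. \<not> large_enough j \<omega>} \<le> j * \<rho>"
proof (induction j)
  case 0
  have "{\<omega>. \<not> large_enough 0 \<omega>} = {}" by (simp add: large_enough_def)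
  then show ?case by simp
next
  case (Suc j)
  have "prob_of (table dflt dflt' {..<Suc j}) {\<omega>. \<not> large_enough (Suc j) \<omega>}
      \<le> prob_of (table dflt dflt' {..<j}) {\<omega>. \<not> large_enough j \<omega>} + \<rho>"
    unfolding lessThan_Suc
  proof (rule prob_Pi_insert_le)
    fix \<omega> assume "\<omega> \<notin> {\<omega>. \<not> large_enough j \<omega>}"
    then show "prob_of (round_coins dflt') {y. \<omega> (j := y) \<in> {\<omega>. \<not> large_enough (Suc j) \<omega>}} \<le> \<rho>"
      using large_enough_step[of j \<omega> dflt'] Suc.prems d by simp
  qed (use rho_nonneg finite_round in auto)
  then show ?case using Suc by (simp add: algebra_simps)
qed

theorem adaptive_sampling_correct:
  assumes d: "1 \<le> d"
  shows "prob_of (table dflt dflt' {..<Suc R})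
      {\<omega>. \<exists>x. (1 + 3 * e) * gram x x < energy_form s d 1 (cnt \<omega> R) (sketches \<omega> R) x \<or>
              energy_form s d 1 (cnt \<omega> R) (sketches \<omega> R) x < (1 - 4 * e) * gram x x}
    \<le> (R + 1) * \<rho> + 2 * d * exp (- (q * (e / 2)))" (is "prob_of _ ?A \<le> _")
proof -
  have "prob_of (table dflt dflt' {..<Suc R}) ?A
      \<le> prob_of (table dflt dflt' {..<R}) {\<omega>. \<not> large_enough R \<omega>}
        + (s * K * \<beta> + 2 * d * exp (- (q * (e / 2))))"
    unfolding lessThan_Suc
  proof (rule prob_Pi_insert_le)
    fix \<omega> assume "\<omega> \<notin> {\<omega>. \<not> large_enough R \<omega>}"
    then interpret rd: sampling_round s n d r A w T "cnt \<omega> R" K "\<alpha> R" "if R = 0 then \<eta>0 else \<eta>" dflt'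
      using sampling_round[of R \<omega>] by simp
    have c: "cnt (\<omega> (R := \<sigma>)) R = cnt \<omega> R" for \<sigma> by (rule counts_cong) simp
    have E: "energy_form s d 1 (cnt (\<omega> (R := \<sigma>)) R) (sketches (\<omega> (R := \<sigma>)) R) x = rd.energy \<sigma> x" for \<sigma> x
      unfolding c energy_form_def rd.energy_def by simp
    \<comment> \<open>As R \<ge> 1, a summand of the last round is bounded by \<open>\<eta>\<close>
      and not merely by \<open>\<eta>0\<close>; its scale is 1.\<close>
    have "prob_of (round_coins dflt')
        {\<sigma>. \<exists>x. (1 + 3 * e) * gram x x < rd.energy \<sigma> x \<or> rd.energy \<sigma> x < (1 - 4 * e) * gram x x}
      \<le> s * K * \<beta> + 2 * d * exp (- (q * (e / 2)))"
      using q R(1) e n\<beta> by (intro rd.energy_two_sided) auto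
    then show "prob_of (round_coins dflt') {y. \<omega> (R := y) \<in> ?A}
      \<le> s * K * \<beta> + 2 * d * exp (- (q * (e / 2)))"
      unfolding mem_Collect_eq E .
  qed (use finite_round beta_nonneg in auto)
  also have "prob_of (table dflt dflt' {..<R}) {\<omega>. \<not> large_enough R \<omega>} \<le> R * \<rho>"
    by (rule prob_not_large_enough[OF d]) simp
  also have "s * K * \<beta> \<le> \<rho>" by (simp add: \<rho>_def)
  finally show ?thesis by (simp add: algebra_simps)
qed

end

section \<open>Short seeds and message encodings\<close>

text \<open>Newman's argument: a fixed input is bad for a random list with exponentially small
  probability.\<close>

lemma few_random_strings:
  fixes p :: "'a pmf" and bad :: "'x \<Rightarrow> 'a \<Rightarrow> bool" and \<delta> :: real
  assumes fin: "finite (set_pmf p)" and X: "finite X" and \<delta>: "0 < \<delta>"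
    and bad: "\<And>x. x \<in> X \<Longrightarrow> prob_of p {\<omega>. bad x \<omega>} \<le> \<delta> / 4"
    and m: "card X * exp (- (\<delta> * real m / 2)) < 1"
  shows "\<exists>c. (\<forall>z<m. c z \<in> set_pmf p) \<and> (\<forall>x\<in>X. card {z. z < m \<and> bad x (c z)} \<le> \<delta> * m)"
proof -
  define P where "P = Pi_pmf {..<m} (SOME a. a \<in> set_pmf p) (\<lambda>_. p)"
  have finP: "finite (set_pmf P)" unfolding P_def by (intro finite_set_Pi_pmf fin) auto
  let ?N = "\<lambda>x c. card {z. z < m \<and> bad x (c z)}"
  have one: "prob_of P {c. \<delta> * m < ?N x c} \<le> exp (- (\<delta> * real m / 2))" if x: "x \<in> X" for x
  proof -
    \<comment> \<open>Chernoff's bound with parameter 1. As e - 1 \<le> 2, failure probability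
      \<delta> / 4 gives at most exp (\<delta> / 2) per string, against exp \<delta> in Markov's
      inequality.\<close>
    let ?f = "\<lambda>\<omega>. if bad x \<omega> then exp 1 else (1 :: real)"
    have prod: "(\<Prod>z<m. ?f (c z)) = exp (?N x c)" for c
    proof -
      have "(\<Prod>z<m. ?f (c z)) = exp 1 ^ card ({..<m} \<inter> {z. bad x (c z)})"
        by (simp add: prod.If_cases)
      also have "{..<m} \<inter> {z. bad x (c z)} = {z. z < m \<and> bad x (c z)}" by auto
      finally show ?thesis by (simp add: exp_of_nat_mult[symmetric])
    qed
    have E: "expect p ?f \<le> exp (\<delta> / 2)"
    proof -
      have "expect p ?f = expect p (\<lambda>\<omega>. 1 + (exp 1 - 1) * indicator {\<omega>. bad x \<omega>} \<omega>)"
        by (intro expectation_cong) (auto simp: indicator_def)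
      also have "\<dots> = 1 + (exp 1 - 1) * prob_of p {\<omega>. bad x \<omega>}"
        by (subst Bochner_Integration.integral_add) (auto intro: integrable_measure_pmf_finite fin)
      also have "\<dots> \<le> 1 + 2 * (\<delta> / 4)"
      proof (intro add_left_mono mult_mono)
        have "exp (1::real) \<le> 3" using e_less_272 by simp
        then show "exp 1 - 1 \<le> (2 :: real)" by simp
      qed (use bad[OF x] in auto)
      also have "\<dots> \<le> exp (\<delta> / 2)" using exp_ge_add_one_self[of "\<delta> / 2"] by simp
      finally show ?thesis .
    qed
    have "prob_of P {c. \<delta> * m < ?N x c} \<le> expect P (\<lambda>c. \<Prod>z<m. ?f (c z)) / exp (\<delta> * m)"
    proof (rule markov_finite[OF finP])
      show "0 \<le> (\<Prod>z<m. ?f (c z))" for c unfolding prod by simp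
      fix c assume "c \<in> {c. \<delta> * m < ?N x c}"
      then show "exp (\<delta> * m) \<le> (\<Prod>z<m. ?f (c z))" unfolding prod by simp
    qed simp
    also have "expect P (\<lambda>c. \<Prod>z<m. ?f (c z)) = (\<Prod>z<m. expect p ?f)"
      unfolding P_def by (rule expectation_prod_Pi_pmf) (auto intro: integrable_measure_pmf_finite fin)
    also have "\<dots> / exp (\<delta> * m) \<le> exp (\<delta> / 2) ^ m / exp (\<delta> * m)"
      using E by (auto intro!: divide_right_mono power_mono simp: expectation_finite[OF fin] sum_nonneg)
    also have "\<dots> = exp (- (\<delta> * real m / 2))"
      by (simp add: exp_of_nat_mult[symmetric] exp_diff[symmetric] field_simps)
    finally show ?thesis .
  qed
  have "prob_of P (\<Union>x\<in>X. {c. \<delta> * m < ?N x c}) \<le> (\<Sum>x\<in>X. prob_of P {c. \<delta> * m < ?N x c})"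
    by (rule measure_UNION_le) (use X in auto)
  also have "\<dots> \<le> (\<Sum>x\<in>X. exp (- (\<delta> * real m / 2)))" by (rule sum_mono) (rule one)
  also have "\<dots> < 1" using m by simp
  finally have lt: "prob_of P (\<Union>x\<in>X. {c. \<delta> * m < ?N x c}) < 1" .
  have "\<exists>c\<in>set_pmf P. c \<notin> (\<Union>x\<in>X. {c. \<delta> * m < ?N x c})"
  proof (rule ccontr)
    assume "\<not> ?thesis"
    then have "prob_of P (\<Union>x\<in>X. {c. \<delta> * m < ?N x c}) = 1"
      by (subst measure_pmf.prob_eq_1) (auto simp: AE_measure_pmf_iff)
    then show False using lt by simp
  qed
  then obtain c where c: "c \<in> set_pmf P" "\<And>x. x \<in> X \<Longrightarrow> ?N x c \<le> \<delta> * m" by (auto simp: not_less)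
  have "\<forall>z<m. c z \<in> set_pmf p"
    using c(1) unfolding P_def by (subst (asm) set_Pi_pmf) (auto simp: PiE_dflt_def)
  then show ?thesis using c(2) by blast
qed

text \<open>\<open>dec\<close> also recovers the number of integers from the length of the message,
  so no separate length field is paid for.\<close>

definition fixed_width :: "nat \<Rightarrow> int set \<Rightarrow> (int list \<Rightarrow> bool list) \<Rightarrow> (bool list \<Rightarrow> int list) \<Rightarrow> bool" where
  "fixed_width w V enc dec \<longleftrightarrow>
     (\<forall>xs. set xs \<subseteq> V \<longrightarrow> length (enc xs) = w * length xs \<and> dec (enc xs) = xs)"

lemma fixed_width_code:
  fixes V :: "int set"
  assumes V: "finite V" "card V \<le> 2 ^ w" and w: "1 \<le> w"
  shows "\<exists>enc dec. fixed_width w V enc dec"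
proof -
  let ?W = "{bs :: bool list. length bs = w}"
  have "card ?W = 2 ^ w" using card_lists_length_eq[of "UNIV :: bool set" w] by (simp add: card_UNIV_bool)
  then obtain f :: "int \<Rightarrow> bool list" where f: "f ` V \<subseteq> ?W" "inj_on f V"
    using card_le_inj[of V ?W] V finite_lists_length_eq[of "UNIV :: bool set" w] by auto
  define enc where "enc = (\<lambda>xs. concat (map f xs))"
  have len: "length (enc xs) = w * length xs" if "set xs \<subseteq> V" for xs
    using that f(1) unfolding enc_def by (induction xs) auto
  have inj: "inj_on enc {xs. set xs \<subseteq> V}"
  proof (rule inj_onI)
    fix xs ys assume "xs \<in> {xs. set xs \<subseteq> V}" "ys \<in> {xs. set xs \<subseteq> V}" "enc xs = enc ys"
    then show "xs = ys"
    proof (induction xs arbitrary: ys)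
      case Nil
      then have "length (enc ys) = length (enc [])" by simp
      then have "w * length ys = 0" using len[of ys] len[of "[]"] Nil by simp
      then show ?case using w by simp
    next
      case (Cons x xs)
      have "w * length ys = w * length (x # xs)"
        using Cons.prems len[of ys] len[of "x # xs"] by simp
      then have "length ys = length (x # xs)" using w by (simp only: mult_cancel1) simp
      then obtain y ys' where ys: "ys = y # ys'" by (cases ys) auto
      have "length (f x) = w" "length (f y) = w" using Cons.prems f(1) ys by auto
      moreover have "f x @ enc xs = f y @ enc ys'" using Cons.prems(3) ys by (simp add: enc_def)
      ultimately have "f x = f y" "enc xs = enc ys'" by auto
      moreover from this have "x = y" using f(2) Cons.prems ys by (auto dest: inj_onD)
      moreover have "xs = ys'" using Cons.IH[of ys'] Cons.prems ys \<open>enc xs = enc ys'\<close> by auto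
      ultimately show ?case using ys by simp
    qed
  qed
  have "inv_into {xs. set xs \<subseteq> V} enc (enc xs) = xs" if "set xs \<subseteq> V" for xs
    using inv_into_f_f[OF inj] that by simp
  then have "fixed_width w V enc (inv_into {xs. set xs \<subseteq> V} enc)" using len by (simp add: fixed_width_def)
  then show ?thesis by blast
qed

text \<open>A block is coded by its number of rows and its entries, padded with zeros to length
  \<open>n * d\<close>. The bound may be crude, since only the logarithm of the logarithm of this
  number reaches the communication.\<close>

lemma valid_inputs_card:
  shows "finite {As. valid_input s n d L As}"
    and "card {As. valid_input s n d L As} \<le> ((n + 1) * 2 ^ ((L + 2) * (n * d))) ^ s"
proof -
  let ?V = "{- (2 ^ L) .. 2 ^ L :: int}"
  let ?T = "{..n} \<times> {xs. set xs \<subseteq> ?V \<and> length xs = n * d}"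
  let ?g = "\<lambda>(r, xs). mat r d (\<lambda>(a, b). xs ! (a * d + b))"
  let ?M = "{B :: int mat. dim_col B = d \<and> dim_row B \<le> n \<and> (\<forall>a\<in>elements_mat B. \<bar>a\<bar> \<le> 2 ^ L)}"
  have V: "card ?V \<le> 2 ^ (L + 2)"
  proof -
    have "(1 :: int) \<le> 2 * 2 ^ L" using one_le_power[of "2 :: int" L] by linarith
    then have "nat (2 ^ L + 1 - - (2 ^ L)) \<le> 4 * 2 ^ L" by (simp add: nat_le_iff)
    then show ?thesis by simp
  qed
  have finT: "finite ?T" by (intro finite_cartesian_product finite_lists_length_eq) auto
  have "card ?T = (n + 1) * card ?V ^ (n * d)"
    by (simp add: card_cartesian_product card_lists_length_eq del: card_atLeastAtMost_int)
  also have "\<dots> \<le> (n + 1) * (2 ^ (L + 2)) ^ (n * d)" by (intro mult_left_mono power_mono V) auto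
  finally have cT: "card ?T \<le> (n + 1) * 2 ^ ((L + 2) * (n * d))" by (simp only: power_mult)
  have "?M \<subseteq> ?g ` ?T"
  proof
    fix B assume B: "B \<in> ?M"
    define xs where "xs = map (\<lambda>i. if i < dim_row B * d then B $$ (i div d, i mod d) else 0) [0..<n * d]"
    have lt: "a * d + b < dim_row B * d" if "a < dim_row B" "b < d" for a b
    proof -
      have "a * d + b < a * d + d" using that by simp
      also have "\<dots> = Suc a * d" by simp
      also have "\<dots> \<le> dim_row B * d" using that by (intro mult_le_mono1) auto
      finally show ?thesis .
    qed
    have le: "dim_row B * d \<le> n * d" using B by (intro mult_le_mono1) auto
    have "xs ! (a * d + b) = B $$ (a, b)" if "a < dim_row B" "b < d" for a b
    proof -
      have "a * d + b < n * d" using lt[OF that] le by linarith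
      then show ?thesis using lt[OF that] that unfolding xs_def by simp
    qed
    then have "B = ?g (dim_row B, xs)" using B by (intro eq_matI) auto
    moreover have "set xs \<subseteq> ?V"
    proof
      fix x assume "x \<in> set xs"
      then obtain i where i: "x = (if i < dim_row B * d then B $$ (i div d, i mod d) else 0)"
        unfolding xs_def by fastforce
      show "x \<in> ?V"
      proof (cases "i < dim_row B * d")
        case True
        then have "0 < d" by (cases d) auto
        then have "i div d < dim_row B" "i mod d < dim_col B" using True B by (auto simp: less_mult_imp_div_less)
        then have "x \<in> elements_mat B"
          using i True by (intro elements_matI[of B "dim_row B" "dim_col B" "i div d" "i mod d"]) auto
        then have "\<bar>x\<bar> \<le> 2 ^ L" using B by auto
        then show ?thesis by (auto simp: abs_le_iff)
      qed (use i in auto)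
    qed
    ultimately show "B \<in> ?g ` ?T" using B by (intro image_eqI[of _ _ "(dim_row B, xs)"]) (auto simp: xs_def)
  qed
  then have finM: "finite ?M" and le: "card ?M \<le> card ?T"
    using finT by (rule finite_surj[rotated], intro surj_card_le)
  have cM: "card ?M \<le> (n + 1) * 2 ^ ((L + 2) * (n * d))" using le cT by (rule order_trans)
  have sub: "{As. valid_input s n d L As} \<subseteq> {As. set As \<subseteq> ?M \<and> length As = s}"
  proof
    fix As assume A: "As \<in> {As. valid_input s n d L As}"
    have "dim_row B \<le> n" if "B \<in> set As" for B
      using A member_le_sum_list[of "dim_row B" "map dim_row As"] that by (auto simp: valid_input_def)
    then show "As \<in> {As. set As \<subseteq> ?M \<and> length As = s}" using A by (auto simp: valid_input_def)
  qed
  have fl: "finite {As. set As \<subseteq> ?M \<and> length As = s}" by (rule finite_lists_length_eq[OF finM])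
  show "finite {As. valid_input s n d L As}" by (rule finite_subset[OF sub fl])
  have "card {As. valid_input s n d L As} \<le> card ?M ^ s"
    using card_mono[OF fl sub] by (simp add: card_lists_length_eq[OF finM])
  also have "\<dots> \<le> ((n + 1) * 2 ^ ((L + 2) * (n * d))) ^ s" by (intro power_mono cM) auto
  finally show "card {As. valid_input s n d L As} \<le> ((n + 1) * 2 ^ ((L + 2) * (n * d))) ^ s" .
qed

text \<open>Decoded replies agree with the true sketches only at the indices actually sent; beyond
  them list access is unspecified. The coordinator nevertheless arrives at the scores of the
  analysis.\<close>

lemma score_cong:
  assumes "\<And>i k b. i < s \<Longrightarrow> k < t i \<Longrightarrow> b < d \<Longrightarrow> u i k b = u' i k b"
  shows "score s d \<alpha> t u = score s d \<alpha> t u'"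
proof -
  have ip: "ip d (u i k) x = ip d (u' i k) x" if "i < s" "k < t i" for i k x
    using assms that by (simp add: ip_def)
  then have "energy_form s d \<alpha> t u x = energy_form s d \<alpha> t u' x" for x
    unfolding energy_form_def by (intro sum.cong refl) auto
  with ip have "score_spec s d \<alpha> t u S = score_spec s d \<alpha> t u' S" for S
    by (simp add: score_spec_def)
  then show ?thesis by (simp add: score_def)
qed

section \<open>The protocol\<close>

lemma sum_lessThan_split:
  fixes g :: "nat \<Rightarrow> 'a :: comm_monoid_add"
  shows "(\<Sum>q<a + b. g q) = (\<Sum>q<a. g q) + (\<Sum>k<b. g (a + k))"
  by (induction b) (simp_all add: add.assoc)

lemma sum_div_mod:
  fixes f :: "nat \<Rightarrow> nat \<Rightarrow> real"
  shows "(\<Sum>q<s * K. f (q div K) (q mod K)) = (\<Sum>i<s. \<Sum>k<K. f i k)"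
proof (induction s)
  case (Suc s)
  have "(\<Sum>k<K. f ((s * K + k) div K) ((s * K + k) mod K)) = (\<Sum>k<K. f s k)"
    by (rule sum.cong) auto
  moreover have "Suc s * K = s * K + K" by simp
  ultimately show ?case by (simp only: sum_lessThan_split Suc sum.lessThan_Suc)
qed simp

lemma sum_concat:
  fixes f :: "'a \<Rightarrow> 'b \<Rightarrow> real"
  assumes "length xss = length yss" "\<And>i. i < length xss \<Longrightarrow> length (xss ! i) = length (yss ! i)"
  shows "(\<Sum>c<length (concat xss). f (concat xss ! c) (concat yss ! c))
    = (\<Sum>i<length xss. \<Sum>a<length (xss ! i). f (xss ! i ! a) (yss ! i ! a))"
  using assms
proof (induction xss yss rule: list_induct2)
  case (Cons x xss y yss)
  have xy: "length x = length y" using Cons.prems[of 0] by simp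
  have tl: "length (xss ! i) = length (yss ! i)" if "i < length xss" for i
    using Cons.prems[of "Suc i"] that by simp
  have "(\<Sum>c<length (concat (x # xss)). f (concat (x # xss) ! c) (concat (y # yss) ! c))
      = (\<Sum>c<length x. f (x ! c) (y ! c)) + (\<Sum>c<length (concat xss). f (concat xss ! c) (concat yss ! c))"
    unfolding concat.simps length_append sum_lessThan_split
    by (intro arg_cong2[where f = "(+)"] sum.cong refl) (auto simp: nth_append xy)
  also have "(\<Sum>c<length (concat xss). f (concat xss ! c) (concat yss ! c))
      = (\<Sum>i<length xss. \<Sum>a<length (xss ! i). f (xss ! i ! a) (yss ! i ! a))"
    by (rule Cons.IH) (rule tl)
  also have "(\<Sum>c<length x. f (x ! c) (y ! c)) + \<dots> = (\<Sum>i<length (x # xss). \<Sum>a<length ((x # xss) ! i). f ((x # xss) ! i ! a) ((y # yss) ! i ! a))"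
    by (simp only: length_Cons sum.lessThan_Suc_shift) simp
  finally show ?case .
qed simp

section \<open>Sketches and norms of the actual integer input\<close>

definition sketch_int :: "int mat \<Rightarrow> (nat \<Rightarrow> bool) \<Rightarrow> nat \<Rightarrow> int" where
  "sketch_int B \<sigma> b = (\<Sum>a<dim_row B. (if \<sigma> a then 1 else - 1) * B $$ (a, b))"

text \<open>Zero rows pad each block to \<open>n\<close> rows. They change neither sketches nor
  norms and let all servers share one sign distribution.\<close>

definition entries_of :: "int mat list \<Rightarrow> nat \<Rightarrow> nat \<Rightarrow> nat \<Rightarrow> real" where
  "entries_of As i a b = (if a < dim_row (As ! i) then real_of_int (As ! i $$ (a, b)) else 0)"

lemma l2_norm_square: "(l2_norm v)\<^sup>2 = (\<Sum>i<dim_vec v. (v $ i)\<^sup>2)"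
  unfolding l2_norm_def
  by (simp add: scalar_prod_def sum_nonneg power2_eq_square lessThan_atLeast0)

context
  fixes s n d L :: nat and As :: "int mat list"
  assumes valid: "valid_input s n d L As"
begin

lemma len: "length As = s"
  using valid by (simp add: valid_input_def)

lemma dim_col_block: "i < s \<Longrightarrow> dim_col (As ! i) = d"
  using valid by (auto simp: valid_input_def)

lemma dim_row_block: "i < s \<Longrightarrow> dim_row (As ! i) \<le> n"
  using valid member_le_sum_list[of "dim_row (As ! i)" "map dim_row As"]
  by (auto simp: valid_input_def)

lemma entry_bound: "i < s \<Longrightarrow> a < dim_row (As ! i) \<Longrightarrow> b < d \<Longrightarrow> \<bar>As ! i $$ (a, b)\<bar> \<le> 2 ^ L"
proof -
  assume i: "i < s" "a < dim_row (As ! i)" "b < d"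
  then have "As ! i $$ (a, b) \<in> elements_mat (As ! i)"
    using dim_col_block[OF i(1)] by (intro elements_matI[of _ "dim_row (As ! i)" d]) auto
  moreover have "As ! i \<in> set As" using i len by simp
  ultimately show ?thesis using valid unfolding valid_input_def by blast
qed

lemma sketch_int_bound:
  assumes "i < s" "b < d"
  shows "\<bar>sketch_int (As ! i) \<sigma> b\<bar> \<le> int n * 2 ^ L"
proof -
  have "\<bar>sketch_int (As ! i) \<sigma> b\<bar> \<le> (\<Sum>a<dim_row (As ! i). \<bar>(if \<sigma> a then 1 else - 1) * As ! i $$ (a, b)\<bar>)"
    unfolding sketch_int_def by (rule sum_abs)
  also have "\<dots> \<le> (\<Sum>a<dim_row (As ! i). 2 ^ L)"
    using entry_bound[OF assms(1) _ assms(2)] by (intro sum_mono) (auto simp: abs_mult)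
  also have "\<dots> = int (dim_row (As ! i)) * 2 ^ L" by simp
  also have "\<dots> \<le> int n * 2 ^ L" using dim_row_block[OF assms(1)] by (intro mult_right_mono) auto
  finally show ?thesis .
qed

lemma sketch_entries:
  assumes "i < s"
  shows "sketch n (entries_of As) i \<sigma> b = sketch_int (As ! i) \<sigma> b"
proof -
  have "sketch n (entries_of As) i \<sigma> b
      = (\<Sum>a<n. if a < dim_row (As ! i) then sgnb (\<sigma> a) * As ! i $$ (a, b) else 0)"
    by (simp add: sketch_def lin_def entries_of_def if_distrib cong: if_cong)
  also have "\<dots> = (\<Sum>a<dim_row (As ! i). sgnb (\<sigma> a) * As ! i $$ (a, b))"
  proof -
    have "{..<n} \<inter> {a. a < dim_row (As ! i)} = {..<dim_row (As ! i)}" using dim_row_block[OF assms] by auto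
    then show ?thesis by (simp add: sum.If_cases)
  qed
  also have "\<dots> = sketch_int (As ! i) \<sigma> b"
    unfolding sketch_int_def of_int_sum by (intro sum.cong refl) (simp add: sgnb_def)
  finally show ?thesis .
qed

lemma length_concat_rows: "length (concat (map rows As)) = n"
  using valid by (simp add: valid_input_def length_concat o_def)

lemma stack_dims: "dim_row (stack d As) = n" "dim_col (stack d As) = d"
  by (simp_all add: stack_def length_concat_rows)

lemma stack_index: "c < n \<Longrightarrow> b < d \<Longrightarrow> stack d As $$ (c, b) = real_of_int (concat (map rows As) ! c $ b)"
  by (simp add: stack_def length_concat_rows mat_of_rows_index)

text \<open>\<open>yss\<close> attaches a label to every row. With trivial labels the lemma
  evaluates the norm of A x; with the entries of one row of S as labels it evaluates that row of S
  A.\<close>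

lemma sum_rows:
  fixes f :: "'b \<Rightarrow> (nat \<Rightarrow> real) \<Rightarrow> real"
  assumes yss: "length yss = s" "\<And>i. i < s \<Longrightarrow> length (yss ! i) = dim_row (As ! i)"
    and cong: "\<And>y u v. (\<And>b. b < d \<Longrightarrow> u b = v b) \<Longrightarrow> f y u = f y v"
  shows "(\<Sum>c<n. f (concat yss ! c) (\<lambda>b. stack d As $$ (c, b)))
    = (\<Sum>i<s. \<Sum>a<dim_row (As ! i). f (yss ! i ! a) (entries_of As i a))"
proof -
  let ?g = "\<lambda>(v :: int vec) y. f y (\<lambda>b. real_of_int (v $ b))"
  have "(\<Sum>c<n. f (concat yss ! c) (\<lambda>b. stack d As $$ (c, b)))
      = (\<Sum>c<n. ?g (concat (map rows As) ! c) (concat yss ! c))"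
    by (intro sum.cong refl cong) (simp add: stack_index)
  also have "\<dots> = (\<Sum>i<length (map rows As). \<Sum>a<length (map rows As ! i). ?g (map rows As ! i ! a) (yss ! i ! a))"
    unfolding length_concat_rows[symmetric] by (rule sum_concat) (use yss len in auto)
  also have "\<dots> = (\<Sum>i<s. \<Sum>a<dim_row (As ! i). f (yss ! i ! a) (entries_of As i a))"
    using dim_col_block by (intro sum.cong cong) (auto simp: len entries_of_def)
  finally show ?thesis .
qed

lemma norm_stack:
  assumes x: "x \<in> carrier_vec d"
  shows "(l2_norm (stack d As *\<^sub>v x))\<^sup>2 = gram_form s n d (entries_of As) (vec_index x) (vec_index x)"
proof -
  let ?A = "entries_of As"
  have "(l2_norm (stack d As *\<^sub>v x))\<^sup>2 = (\<Sum>c<n. (ip d (\<lambda>b. stack d As $$ (c, b)) (vec_index x))\<^sup>2)"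
    unfolding l2_norm_square
    using x by (intro sum.cong) (auto simp: stack_dims scalar_prod_def ip_def lessThan_atLeast0 intro!: sum.cong)
  also have "\<dots> = (\<Sum>i<s. \<Sum>a<dim_row (As ! i). (ip d (?A i a) (vec_index x))\<^sup>2)"
    using sum_rows[of "map (\<lambda>i. replicate (dim_row (As ! i)) ()) [0..<s]" "\<lambda>_ u. (ip d u (vec_index x))\<^sup>2"]
    by (simp add: ip_def)
  also have "\<dots> = (\<Sum>i<s. \<Sum>a<n. (ip d (?A i a) (vec_index x))\<^sup>2)"
  proof (rule sum.cong[OF refl])
    fix i assume "i \<in> {..<s}"
    then show "(\<Sum>a<dim_row (As ! i). (ip d (?A i a) (vec_index x))\<^sup>2) = (\<Sum>a<n. (ip d (?A i a) (vec_index x))\<^sup>2)"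
      using dim_row_block[of i] by (intro sum.mono_neutral_left) (auto simp: ip_def entries_of_def)
  qed
  also have "\<dots> = gram_form s n d ?A (vec_index x) (vec_index x)"
    by (simp add: gram_form_def sum.cartesian_product power2_eq_square)
  finally show ?thesis .
qed

end

definition sampling_fails :: "nat \<Rightarrow> real \<Rightarrow> nat \<Rightarrow> nat \<Rightarrow> nat \<Rightarrow> nat \<Rightarrow> real \<Rightarrow> (nat \<Rightarrow> nat \<Rightarrow> nat \<Rightarrow> real) \<Rightarrow> coin_table \<Rightarrow> bool" where
  "sampling_fails t0 C s n d R e A \<omega> \<longleftrightarrow> (\<exists>x. (1 + 3 * e) * gram_form s n d A x x
        < energy_form s d 1 (counts t0 C s n d R A \<omega> R) (\<lambda>i k. sketch n A i (\<omega> R (i, k))) x \<or>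
      energy_form s d 1 (counts t0 C s n d R A \<omega> R) (\<lambda>i k. sketch n A i (\<omega> R (i, k))) x
        < (1 - 4 * e) * gram_form s n d A x x)"

locale coordinator_protocol =
  fixes s n d L m t0 R K w1 w2 :: nat and C :: real and cz :: "nat \<Rightarrow> coin_table"
    and encC encS :: "int list \<Rightarrow> bool list" and decC decS :: "bool list \<Rightarrow> int list"
  assumes d: "1 \<le> d" and m: "1 \<le> m" and C: "0 \<le> C" and K: "t0 + 1 + C * d \<le> K"
    and fwC: "fixed_width w1 {0..int (max m K)} encC decC"
    and fwS: "fixed_width w2 {- (int n * 2 ^ L)..int n * 2 ^ L} encS decS"
begin

lemma encC: "set xs \<subseteq> {0..int (max m K)} \<Longrightarrow> length (encC xs) = w1 * length xs"
    "set xs \<subseteq> {0..int (max m K)} \<Longrightarrow> decC (encC xs) = xs"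
  using fwC by (simp_all add: fixed_width_def)

lemma encS: "set xs \<subseteq> {- (int n * 2 ^ L)..int n * 2 ^ L} \<Longrightarrow> length (encS xs) = w2 * length xs"
    "set xs \<subseteq> {- (int n * 2 ^ L)..int n * 2 ^ L} \<Longrightarrow> decS (encS xs) = xs"
  using fwS by (simp_all add: fixed_width_def)

text \<open>The row count heads the message because the coordinator needs the block boundaries to
  lay out S; this is the offset \<open>Suc\<close> in \<open>entry\<close>.\<close>

definition reply_content :: "nat \<Rightarrow> nat \<Rightarrow> nat \<Rightarrow> nat \<Rightarrow> int mat \<Rightarrow> int list" where
  "reply_content z j i t B = int (dim_row B) # map (\<lambda>q. sketch_int B (cz z j (i, q div d)) (q mod d)) [0..<t * d]"

definition reply :: "nat \<Rightarrow> nat \<Rightarrow> nat \<Rightarrow> nat \<Rightarrow> int mat \<Rightarrow> bool list" where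
  "reply z j i t B = encS (reply_content z j i t B)"

definition entry :: "bool list list \<Rightarrow> nat \<Rightarrow> nat \<Rightarrow> nat \<Rightarrow> real" where
  "entry ms i k b = real_of_int (decS (ms ! i) ! Suc (k * d + b))"

primrec hcounts :: "bool list list list \<Rightarrow> nat \<Rightarrow> nat \<Rightarrow> nat" where
  "hcounts h 0 = (\<lambda>_. t0)"
| "hcounts h (Suc j) = next_counts t0 C s d (2 ^ j / 2 ^ R) (hcounts h j) (entry (h ! j))"

text \<open>The table index is resent in every round. A server then needs only the last message, and
  it reads the round off the number of messages received.\<close>

definition cmsg :: "nat \<Rightarrow> bool list list list \<Rightarrow> nat \<Rightarrow> bool list" where
  "cmsg z h i = encC [int z, int (hcounts h (length h) i)]"

definition smsg :: "nat \<Rightarrow> int mat \<Rightarrow> bool list list \<Rightarrow> bool list" where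
  "smsg i B msgs = (let xs = decC (last msgs) in reply (nat (xs ! 0)) (length msgs - 1) i (nat (xs ! 1)) B)"

text \<open>One row of S, cut into server blocks of which at most one is nonzero. Division by the
  square root of \<open>t i\<close> makes the squared norm an average over the sketches.\<close>

definition sketch_blocks :: "nat \<Rightarrow> (nat \<Rightarrow> nat) \<Rightarrow> (nat \<Rightarrow> nat) \<Rightarrow> nat \<Rightarrow> real list list" where
  "sketch_blocks z t ns q = map (\<lambda>i. map (\<lambda>a. if i = q div K \<and> q mod K < t i
     then sgnb (cz z R (i, q mod K) a) / sqrt (t i) else 0) [0..<ns i]) [0..<s]"

text \<open>Row \<open>i * K + k\<close> belongs to sketch \<open>k\<close> of server \<open>i\<close>; unused rows are zero.\<close>

definition sketch_matrix :: "nat \<Rightarrow> (nat \<Rightarrow> nat) \<Rightarrow> (nat \<Rightarrow> nat) \<Rightarrow> real mat" where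
  "sketch_matrix z t ns = mat (s * K) n (\<lambda>(q, c). concat (sketch_blocks z t ns q) ! c)"

definition sketched :: "(nat \<Rightarrow> nat) \<Rightarrow> (nat \<Rightarrow> nat \<Rightarrow> nat \<Rightarrow> real) \<Rightarrow> real mat" where
  "sketched t u = mat (s * K) d (\<lambda>(q, b). if q mod K < t (q div K)
     then u (q div K) (q mod K) b / sqrt (t (q div K)) else 0)"

definition outcome :: "nat \<Rightarrow> bool list list list \<Rightarrow> real mat \<times> real mat" where
  "outcome z h = (sketch_matrix z (hcounts h R) (\<lambda>i. nat (decS (h ! R ! i) ! 0)),
     sketched (hcounts h R) (entry (h ! R)))"

definition P :: "(int mat, real mat \<times> real mat) protocol" where
  "P = \<lparr>rounds = Suc R, coord_coins = pmf_of_set {..<m}, server_coins = (\<lambda>_. return_pmf 0),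
     coord_msg = cmsg, server_msg = (\<lambda>i B _ msgs. smsg i B msgs), result = outcome\<rparr>"

context
  fixes As :: "int mat list" and z :: nat
  assumes valid: "valid_input s n d L As" and z: "z < m"
begin

abbreviation "cnt \<equiv> counts t0 C s n d R (entries_of As) (cz z)"

text \<open>The transcript in closed form. The induction in \<open>answers_hist\<close> works
  because the counts recomputed from its prefixes are the counts of the analysis.\<close>

definition hist :: "nat \<Rightarrow> bool list list list" where
  "hist r = map (\<lambda>j. map (\<lambda>i. reply z j i (cnt j i) (As ! i)) [0..<s]) [0..<r]"

lemma reply_content_bound:
  assumes "i < s"
  shows "set (reply_content z j i t (As ! i)) \<subseteq> {- (int n * 2 ^ L)..int n * 2 ^ L}"
proof -
  have "int (dim_row (As ! i)) \<le> int n * 1" using dim_row_block[OF valid assms] by simp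
  also have "\<dots> \<le> int n * 2 ^ L" by (intro mult_left_mono) auto
  finally have 1: "int (dim_row (As ! i)) \<le> int n * 2 ^ L" .
  moreover have "sketch_int (As ! i) \<sigma> (q mod d) \<in> {- (int n * 2 ^ L)..int n * 2 ^ L}" for \<sigma> q
    using sketch_int_bound[OF valid assms, of "q mod d" \<sigma>] d by (auto simp: abs_le_iff)
  moreover have "- (int n * 2 ^ L) \<le> int (dim_row (As ! i))"
  proof -
    have "0 \<le> int n * 2 ^ L" by simp
    then show ?thesis by linarith
  qed
  ultimately show ?thesis unfolding reply_content_def by (auto simp del: atLeastAtMost_iff) auto
qed

lemma dec_reply: "i < s \<Longrightarrow> decS (reply z j i t (As ! i)) = reply_content z j i t (As ! i)"
  unfolding reply_def by (intro encS reply_content_bound)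

lemma length_reply: "i < s \<Longrightarrow> length (reply z j i t (As ! i)) = w2 * (1 + t * d)"
  unfolding reply_def by (subst encS(1)[OF reply_content_bound]) (auto simp: reply_content_def)

lemma entry_hist:
  assumes "j < r" "i < s" "k < cnt j i" "b < d"
  shows "entry (hist r ! j) i k b = sketch n (entries_of As) i (cz z j (i, k)) b"
proof -
  have lt: "k * d + b < cnt j i * d"
  proof -
    have "k * d + b < Suc k * d" using assms by simp
    also have "\<dots> \<le> cnt j i * d" using assms by (intro mult_le_mono1) auto
    finally show ?thesis .
  qed
  have "(k * d + b) div d = k" "(k * d + b) mod d = b" using assms by auto
  then show ?thesis
    using assms lt
    by (simp add: entry_def hist_def dec_reply reply_content_def sketch_entries[OF valid])
qed

lemma hcounts_hist: "j \<le> r \<Longrightarrow> hcounts (hist r) j = cnt j"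
proof (induction j)
  case (Suc j)
  have "score s d (2 ^ j / 2 ^ R) (cnt j) (entry (hist r ! j))
      = score s d (2 ^ j / 2 ^ R) (cnt j) (\<lambda>i k. sketch n (entries_of As) i (cz z j (i, k)))"
    using Suc.prems by (intro score_cong entry_hist) auto
  then show ?case using Suc by (simp add: next_counts_def[abs_def])
qed simp

lemma length_hist: "length (hist r) = r"
  by (simp add: hist_def)

lemma take_hist: "u \<le> r \<Longrightarrow> take u (hist r) = hist u"
  by (simp add: hist_def take_map)

lemma cnt_le_K: "i < s \<Longrightarrow> cnt j i \<le> K"
proof -
  assume "i < s"
  then have "real (cnt j i) \<le> real K"
    using counts_le_max[OF C, of i s t0 n d R "entries_of As" "cz z" j] K by linarith
  then show ?thesis by simp
qed

lemma cmsg_hist: "cmsg z (hist r) i = encC [int z, int (cnt r i)]"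
  by (simp add: cmsg_def length_hist hcounts_hist)

lemma cmsg_bound: "i < s \<Longrightarrow> set [int z, int (cnt r i)] \<subseteq> {0..int (max m K)}"
  using cnt_le_K[of i r] z by auto

lemma answers_hist: "answers P As (z, c) r = hist r"
proof (induction r)
  case (Suc r)
  have "smsg i (As ! i) (received P z (hist r) i (Suc r)) = reply z r i (cnt r i) (As ! i)" if i: "i < s" for i
  proof -
    have "last (received P z (hist r) i (Suc r)) = encC [int z, int (cnt r i)]"
      by (simp add: received_def P_def take_hist cmsg_hist)
    moreover have "length (received P z (hist r) i (Suc r)) = Suc r" by (simp add: received_def)
    ultimately show ?thesis by (simp add: smsg_def encC(2)[OF cmsg_bound[OF i]])
  qed
  then have "map (\<lambda>i. server_msg P i (As ! i) (c i) (received P z (hist r) i (Suc r))) [0..<length As]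
      = map (\<lambda>i. reply z r i (cnt r i) (As ! i)) [0..<s]"
    by (simp add: len[OF valid] P_def)
  then show ?case using Suc by (simp add: Let_def) (simp add: hist_def)
qed (simp add: hist_def)

lemma transcript_hist: "transcript P As (z, c) = hist (Suc R)"
  unfolding transcript_def answers_hist by (simp add: P_def)

lemma bits_to_servers_eq: "bits_to_servers P As (z, c) = s * (Suc R * (2 * w1))"
proof -
  have "sum_list (map length (received P z (hist (Suc R)) i (Suc R))) = Suc R * (2 * w1)" if i: "i < s" for i
  proof -
    have "received P z (hist (Suc R)) i (Suc R) = map (\<lambda>u. encC [int z, int (cnt u i)]) [0..<Suc R]"
      unfolding received_def by (intro map_cong refl) (simp add: P_def take_hist cmsg_hist del: upt_Suc)
    then have "map length (received P z (hist (Suc R)) i (Suc R)) = map (\<lambda>u. 2 * w1) [0..<Suc R]"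
      using encC(1)[OF cmsg_bound[OF i]] by simp
    then show ?thesis by (simp add: sum_list_triv)
  qed
  then show ?thesis
    unfolding bits_to_servers_def transcript_hist by (simp add: len[OF valid] P_def)
qed

lemma bits_to_coordinator_eq: "bits_to_coordinator P As (z, c) = (\<Sum>j<Suc R. \<Sum>i<s. w2 * (1 + cnt j i * d))"
  unfolding bits_to_coordinator_def transcript_hist hist_def map_map
  by (simp add: o_def interv_sum_list_conv_sum_set_nat lessThan_atLeast0 length_reply
      del: upt_Suc sum.op_ivl_Suc)

lemma bits_to_coordinator_le:
  "real (bits_to_coordinator P As (z, c)) \<le> (R + 1) * (w2 * (s + d * (s * (t0 + 1) + C * d)))"
proof -
  have "real (\<Sum>i<s. w2 * (1 + cnt j i * d)) \<le> w2 * (s + d * (s * (t0 + 1) + C * d))" for j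
  proof -
    have "real (\<Sum>i<s. w2 * (1 + cnt j i * d)) = w2 * (s + d * (\<Sum>i<s. real (cnt j i)))"
      by (simp add: sum.distrib sum_distrib_left algebra_simps)
    also have "\<dots> \<le> w2 * (s + d * (s * (t0 + 1) + C * d))"
      using sum_counts_le[OF C, of t0 s n d R "entries_of As" "cz z" j]
      by (intro mult_left_mono add_left_mono) (auto simp: algebra_simps)
    finally show ?thesis .
  qed
  then have "(\<Sum>j<Suc R. real (\<Sum>i<s. w2 * (1 + cnt j i * d))) \<le> (\<Sum>j<Suc R. w2 * (s + d * (s * (t0 + 1) + C * d)))"
    by (intro sum_mono)
  then show ?thesis unfolding bits_to_coordinator_eq of_nat_sum by (simp add: algebra_simps)
qed

abbreviation "rows_of \<equiv> (\<lambda>i. dim_row (As ! i))"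

lemma output_eq: "protocol_output P As (z, c) = (sketch_matrix z (cnt R) rows_of, sketched (cnt R) (entry (hist (Suc R) ! R)))"
proof -
  have "sketch_blocks z (cnt R) (\<lambda>i. nat (decS (hist (Suc R) ! R ! i) ! 0)) q = sketch_blocks z (cnt R) rows_of q" for q
    unfolding sketch_blocks_def
    by (intro map_cong refl) (auto simp: hist_def dec_reply reply_content_def simp del: upt_Suc)
  then show ?thesis
    unfolding protocol_output_def transcript_hist
    by (simp add: P_def outcome_def hcounts_hist sketch_matrix_def)
qed

lemma sketched_eq: "sketch_matrix z (cnt R) rows_of * stack d As = sketched (cnt R) (entry (hist (Suc R) ! R))"
proof (rule eq_matI)
  fix q b
  assume "q < dim_row (sketched (cnt R) (entry (hist (Suc R) ! R)))"
    and "b < dim_col (sketched (cnt R) (entry (hist (Suc R) ! R)))"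
  then have q: "q < s * K" and b: "b < d" by (auto simp: sketched_def)
  define i k where "i = q div K" and "k = q mod K"
  have K0: "0 < K" using q by (cases K) auto
  have i: "i < s" using q by (simp add: i_def less_mult_imp_div_less)
  have "(sketch_matrix z (cnt R) rows_of * stack d As) $$ (q, b)
      = (\<Sum>c<n. concat (sketch_blocks z (cnt R) rows_of q) ! c * stack d As $$ (c, b))"
    using q b by (simp add: sketch_matrix_def stack_dims[OF valid] scalar_prod_def lessThan_atLeast0)
  also have "\<dots> = (\<Sum>i'<s. \<Sum>a<dim_row (As ! i'). sketch_blocks z (cnt R) rows_of q ! i' ! a * entries_of As i' a b)"
    by (rule sum_rows[OF valid, of _ "\<lambda>y u. y * u b"]) (auto simp: sketch_blocks_def b)
  also have "\<dots> = (\<Sum>i'<s. if i' = i then \<Sum>a<dim_row (As ! i). (if k < cnt R i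
      then sgnb (cz z R (i, k) a) / sqrt (cnt R i) else 0) * entries_of As i a b else 0)"
    by (intro sum.cong refl) (auto simp: sketch_blocks_def i_def k_def intro!: sum.cong)
  also have "\<dots> = (\<Sum>a<dim_row (As ! i). (if k < cnt R i then sgnb (cz z R (i, k) a) / sqrt (cnt R i) else 0) * entries_of As i a b)"
    using i by simp
  also have "\<dots> = (if k < cnt R i then real_of_int (sketch_int (As ! i) (cz z R (i, k)) b) / sqrt (cnt R i) else 0)"
    by (auto simp: sketch_int_def entries_of_def sum_divide_distrib sgnb_def intro!: sum.cong)
  also have "\<dots> = sketched (cnt R) (entry (hist (Suc R) ! R)) $$ (q, b)"
    using q b i entry_hist[of R "Suc R" i k b]
    by (simp add: sketched_def i_def[symmetric] k_def[symmetric] sketch_entries[OF valid])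
  finally show "(sketch_matrix z (cnt R) rows_of * stack d As) $$ (q, b) = sketched (cnt R) (entry (hist (Suc R) ! R)) $$ (q, b)" .
qed (auto simp: sketched_def sketch_matrix_def stack_dims[OF valid])

lemma norm_sketched:
  assumes x: "x \<in> carrier_vec d"
  shows "(l2_norm ((sketch_matrix z (cnt R) rows_of * stack d As) *\<^sub>v x))\<^sup>2
    = energy_form s d 1 (cnt R) (\<lambda>i k. sketch n (entries_of As) i (cz z R (i, k))) (vec_index x)"
proof -
  let ?u = "\<lambda>i k. sketch n (entries_of As) i (cz z R (i, k))"
  have "(l2_norm ((sketch_matrix z (cnt R) rows_of * stack d As) *\<^sub>v x))\<^sup>2
      = (\<Sum>q<s * K. (\<Sum>b<d. sketched (cnt R) (entry (hist (Suc R) ! R)) $$ (q, b) * x $ b)\<^sup>2)"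
    unfolding sketched_eq l2_norm_square
    using x by (intro sum.cong) (auto simp: sketched_def scalar_prod_def lessThan_atLeast0 intro!: sum.cong)
  also have "\<dots> = (\<Sum>q<s * K. (\<lambda>i k. if k < cnt R i then 1 / cnt R i * (ip d (?u i k) (vec_index x))\<^sup>2 else 0) (q div K) (q mod K))"
  proof (rule sum.cong[OF refl])
    fix q assume "q \<in> {..<s * K}"
    then have q: "q < s * K" by simp
    then have i: "q div K < s" by (simp add: less_mult_imp_div_less)
    have "(\<Sum>b<d. sketched (cnt R) (entry (hist (Suc R) ! R)) $$ (q, b) * x $ b)
        = (\<Sum>b<d. if q mod K < cnt R (q div K) then ?u (q div K) (q mod K) b * x $ b / sqrt (cnt R (q div K)) else 0)"
      using q i entry_hist[of R "Suc R" "q div K" "q mod K"] by (intro sum.cong refl) (simp add: sketched_def)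
    also have "\<dots> = (if q mod K < cnt R (q div K) then ip d (?u (q div K) (q mod K)) (vec_index x) / sqrt (cnt R (q div K)) else 0)"
      by (simp add: ip_def sum_divide_distrib)
    finally show "(\<Sum>b<d. sketched (cnt R) (entry (hist (Suc R) ! R)) $$ (q, b) * x $ b)\<^sup>2
      = (\<lambda>i k. if k < cnt R i then 1 / cnt R i * (ip d (?u i k) (vec_index x))\<^sup>2 else 0) (q div K) (q mod K)"
      by (simp add: power_divide)
  qed
  also have "\<dots> = (\<Sum>i<s. \<Sum>k<K. if k < cnt R i then 1 / cnt R i * (ip d (?u i k) (vec_index x))\<^sup>2 else 0)"
    by (rule sum_div_mod)
  also have "\<dots> = energy_form s d 1 (cnt R) ?u (vec_index x)"
    unfolding energy_form_def
  proof (rule sum.cong[OF refl])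
    fix i assume "i \<in> {..<s}"
    then have "{..<K} \<inter> {k. k < cnt R i} = {..<cnt R i}" using cnt_le_K[of i R] by auto
    then show "(\<Sum>k<K. if k < cnt R i then 1 / cnt R i * (ip d (?u i k) (vec_index x))\<^sup>2 else 0)
        = (\<Sum>k<cnt R i. 1 / cnt R i * (ip d (?u i k) (vec_index x))\<^sup>2)"
      by (simp add: sum.If_cases)
  qed
  finally show ?thesis .
qed

end

text \<open>The sampling bounds concern squared norms. They pass to norms by (1 - \<epsilon>)^2
  \<le> 1 - \<epsilon> \<le> 1 - 4 e and 1 + 3 e \<le> 1 + 2 \<epsilon> \<le> (1 +
  \<epsilon>)^2.\<close>

lemma output_correct:
  assumes valid: "valid_input s n d L As" and z: "z < m" and good: "\<not> sampling_fails t0 C s n d R e (entries_of As) (cz z)"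
    and e: "0 < e" "8 * e \<le> \<epsilon>" "\<epsilon> < 1"
  shows "case protocol_output P As (z, c) of (S, M) \<Rightarrow> subspace_embedding \<epsilon> (stack d As) S \<and> M = S * stack d As"
proof -
  let ?S = "sketch_matrix z (counts t0 C s n d R (entries_of As) (cz z) R) (\<lambda>i. dim_row (As ! i))"
  have "(1 - \<epsilon>) * l2_norm (stack d As *\<^sub>v x) \<le> l2_norm ((?S * stack d As) *\<^sub>v x) \<and>
      l2_norm ((?S * stack d As) *\<^sub>v x) \<le> (1 + \<epsilon>) * l2_norm (stack d As *\<^sub>v x)"
    if x: "x \<in> carrier_vec d" for x
  proof -
    define a where "a = l2_norm (stack d As *\<^sub>v x)"
    define b where "b = l2_norm ((?S * stack d As) *\<^sub>v x)"
    have ab: "0 \<le> a" "0 \<le> b" by (simp_all add: a_def b_def l2_norm_def scalar_prod_def sum_nonneg)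
    have "a\<^sup>2 = gram_form s n d (entries_of As) (vec_index x) (vec_index x)"
      unfolding a_def by (rule norm_stack[OF valid x])
    moreover have "b\<^sup>2 = energy_form s d 1 (counts t0 C s n d R (entries_of As) (cz z) R) (\<lambda>i k. sketch n (entries_of As) i (cz z R (i, k))) (vec_index x)"
      unfolding b_def by (rule norm_sketched[OF valid z x])
    ultimately have two: "b\<^sup>2 \<le> (1 + 3 * e) * a\<^sup>2" "(1 - 4 * e) * a\<^sup>2 \<le> b\<^sup>2"
      using good by (auto simp: sampling_fails_def not_less)
    have "(1 - \<epsilon>)\<^sup>2 \<le> 1 - 4 * e"
    proof -
      have "(1 - \<epsilon>)\<^sup>2 \<le> (1 - \<epsilon>) * 1" unfolding power2_eq_square using e by (intro mult_left_mono) auto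
      also have "\<dots> \<le> 1 - 4 * e" using e by simp
      finally show ?thesis .
    qed
    then have "((1 - \<epsilon>) * a)\<^sup>2 \<le> (1 - 4 * e) * a\<^sup>2"
      unfolding power_mult_distrib by (rule mult_right_mono) simp
    from order_trans[OF this two(2)] have 1: "(1 - \<epsilon>) * a \<le> b" using ab(2) by (rule power2_le_imp_le)
    have "1 + 3 * e \<le> 1 + 2 * \<epsilon>" using e by simp
    also have "\<dots> \<le> (1 + \<epsilon>)\<^sup>2" by (simp add: power2_eq_square algebra_simps)
    finally have "1 + 3 * e \<le> (1 + \<epsilon>)\<^sup>2" .
    then have "(1 + 3 * e) * a\<^sup>2 \<le> ((1 + \<epsilon>) * a)\<^sup>2"
      unfolding power_mult_distrib by (rule mult_right_mono) simp
    moreover have "0 \<le> (1 + \<epsilon>) * a" using ab e by simp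
    ultimately have "b \<le> (1 + \<epsilon>) * a" using order_trans[OF two(1)] power2_le_imp_le by blast
    then show ?thesis using 1 by (simp add: a_def b_def)
  qed
  then have "subspace_embedding \<epsilon> (stack d As) ?S"
    unfolding subspace_embedding_def by (simp add: stack_dims[OF valid]) (simp add: sketch_matrix_def)
  then show ?thesis
    unfolding output_eq[OF valid z] by (simp add: sketched_eq[OF valid z])
qed

lemma constructs:
  fixes \<delta> :: real
  assumes few: "\<And>As. valid_input s n d L As \<Longrightarrow> card {z. z < m \<and> sampling_fails t0 C s n d R e (entries_of As) (cz z)} \<le> \<delta> * m"
    and e: "0 < e" "8 * e \<le> \<epsilon>" "\<epsilon> < 1"
  shows "constructs_subspace_embedding \<delta> \<epsilon> P s n d L"
  unfolding constructs_subspace_embedding_def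
proof (intro allI impI)
  fix As assume valid: "valid_input s n d L As"
  let ?U = "pmf_of_set {..<m}"
  let ?A = "{\<omega>. case protocol_output P As \<omega> of (S, M) \<Rightarrow> subspace_embedding \<epsilon> (stack d As) S \<and> M = S * stack d As}"
  let ?G = "{z. \<not> sampling_fails t0 C s n d R e (entries_of As) (cz z)}"
  have "0 \<in> {..<m}" using m by simp
  then have ne: "{..<m} \<noteq> {}" by blast
  have "prob_of ?U {z. sampling_fails t0 C s n d R e (entries_of As) (cz z)} = card {z. z < m \<and> sampling_fails t0 C s n d R e (entries_of As) (cz z)} / m"
    using ne by (simp add: measure_pmf_of_set) (auto intro!: arg_cong[where f = card])
  also have "\<dots> \<le> \<delta>" using few[OF valid] m by (simp add: pos_divide_le_eq)
  finally have bad: "prob_of ?U {z. sampling_fails t0 C s n d R e (entries_of As) (cz z)} \<le> \<delta>" .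
  have "{z. sampling_fails t0 C s n d R e (entries_of As) (cz z)} = UNIV - ?G" by auto
  then have "1 - \<delta> \<le> prob_of ?U ?G"
    using bad measure_pmf.prob_compl[of ?G ?U] by simp
  also have "\<dots> = prob_of (map_pmf fst (coins P s)) ?G"
    by (simp add: coins_def map_fst_pair_pmf P_def)
  also have "\<dots> = prob_of (coins P s) (fst -` ?G)" by simp
  \<comment> \<open>Restriction to the support supplies \<open>z < m\<close>, without which the
    transcript is not described by \<open>hist\<close>.\<close>
  also have "\<dots> = prob_of (coins P s) ((fst -` ?G) \<inter> set_pmf (coins P s))"
    by (rule measure_Int_set_pmf[symmetric])
  also have "\<dots> \<le> prob_of (coins P s) ?A"
  proof (rule measure_pmf.finite_measure_mono)
    show "(fst -` ?G) \<inter> set_pmf (coins P s) \<subseteq> ?A"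
    proof
      fix \<omega> assume w: "\<omega> \<in> (fst -` ?G) \<inter> set_pmf (coins P s)"
      obtain z c where zc: "\<omega> = (z, c)" by (cases \<omega>)
      have "z < m" using w ne by (auto simp: zc coins_def P_def)
      then show "\<omega> \<in> ?A" using output_correct[OF valid _ _ e, of z c] w by (simp add: zc)
    qed
  qed simp
  finally show "1 - \<delta> \<le> prob_of (coins P s) ?A" .
qed

end

section \<open>Choice of the parameters\<close>

text \<open>Picks the exponent \<open>c\<close> from \<delta> alone. The total failure probability
  is at most a constant times c^2 X^8 / X^c with X \<ge> 4 and c \<ge> 8, so smallness at base 4
  suffices for all inputs.\<close>

lemma quadratic_below_exponential:
  fixes a \<delta> :: real
  assumes "0 < \<delta>"
  shows "\<exists>c::nat. 8 \<le> c \<and> a * real c ^ 2 \<le> \<delta> * 4 ^ c"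
proof -
  have "(\<lambda>c::nat. a * real c ^ 2 / 4 ^ c) \<longlonglongrightarrow> 0" by real_asymp
  then have "\<forall>\<^sub>F c in sequentially. a * real c ^ 2 / 4 ^ c < \<delta>" using assms by (rule order_tendstoD)
  then obtain N where N: "\<And>c. N \<le> c \<Longrightarrow> a * real c ^ 2 / 4 ^ c < \<delta>" by (auto simp: eventually_sequentially)
  have "a * real (max N 8) ^ 2 \<le> \<delta> * 4 ^ max N 8" using N[of "max N 8"] by (simp add: divide_less_eq less_imp_le)
  then show ?thesis by (intro exI[of _ "max N 8"]) simp
qed

lemma ceiling_bounds:
  assumes "0 \<le> x" shows "x \<le> real (nat \<lceil>x\<rceil>)" "real (nat \<lceil>x\<rceil>) \<le> x + 1"
  using assms by linarith+

lemma code_width: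
  assumes "1 \<le> (N :: nat)"
  obtains w where "1 \<le> w" "N \<le> 2 ^ w" "real w \<le> log 2 N + 2"
proof (rule that[of "nat \<lceil>log 2 N\<rceil> + 1"])
  have l: "0 \<le> log 2 N" using assms by simp
  have "real N = 2 powr log 2 N" using assms by simp
  also have "\<dots> \<le> 2 powr real (nat \<lceil>log 2 N\<rceil>)" using ceiling_bounds(1)[OF l] by (intro powr_mono) auto
  also have "\<dots> = 2 ^ nat \<lceil>log 2 N\<rceil>" by (rule powr_realpow) simp
  also have "\<dots> \<le> (2 :: real) ^ (nat \<lceil>log 2 N\<rceil> + 1)" by (rule power_increasing[OF le_add1]) simp
  finally have "real N \<le> real (2 ^ (nat \<lceil>log 2 N\<rceil> + 1))" by (simp only: of_nat_power of_nat_numeral)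
  then show "N \<le> 2 ^ (nat \<lceil>log 2 N\<rceil> + 1)" by (simp only: of_nat_le_iff)
  show "real (nat \<lceil>log 2 N\<rceil> + 1) \<le> log 2 N + 2"
    using ceiling_bounds(2)[OF l] unfolding of_nat_add by linarith
qed simp

lemma log2_le: "1 \<le> x \<Longrightarrow> log 2 x \<le> 3 / 2 * ln x"
proof -
  assume "1 \<le> x"
  then have "ln x * (2 / 3) \<le> ln x * ln 2" using ln2_ge_two_thirds by (intro mult_left_mono) auto
  moreover have "0 < ln (2::real)" by simp
  ultimately show ?thesis by (simp add: log_def pos_divide_le_eq) 
qed

locale parameters =
  fixes s n d L c :: nat and \<epsilon> \<delta> :: real
  assumes sdL: "1 \<le> s" "1 \<le> d" "1 \<le> L" and eps: "0 < \<epsilon>" "\<epsilon> < 1" and delta: "0 < \<delta>"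
    and c: "8 \<le> c"
begin

definition X :: real where "X = real s + real n + real d + real L + 1 / \<epsilon>"
definition \<Lambda> :: real where "\<Lambda> = ln X"
text \<open>exp (- lam) = X^(-c). The truncation level is taken as T = 2 lam, so that the tail exp
  (- T / 2) is this power.\<close>

definition lam :: real where "lam = c * \<Lambda>"
definition e :: real where "e = \<epsilon> / 8"
text \<open>The remaining parameters solve the constraints of \<open>adaptive_sampling\<close> in
  turn: \<open>q0\<close> and \<open>q\<close> make both exponentials at most exp (- lam), and then
  \<open>\<eta>0\<close>, \<open>\<eta>\<close>, \<open>t0\<close>, \<open>C\<close> follow. The 3
  in \<open>q\<close> also leaves room for \<open>eta_le\<close>.\<close>

definition q0 :: nat where "q0 = nat \<lceil>16 * lam\<rceil>"
definition \<eta>0 :: real where "\<eta>0 = 1 / (16 * q0)"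
definition q :: nat where "q = nat \<lceil>3 * lam / e\<rceil>"
definition \<eta> :: real where "\<eta> = e / (2 * q)"
definition t0 :: nat where "t0 = nat \<lceil>2 * lam / \<eta>0\<rceil>"
definition C :: real where "C = 8 * (2 * lam) / \<eta>"
definition K :: nat where "K = nat \<lceil>t0 + 1 + C * d\<rceil>"
text \<open>The \<open>+ 1\<close> secures \<open>1 \<le> R\<close> even for
  \<open>d = 1\<close>.\<close>

definition R :: nat where "R = nat \<lceil>log 2 d\<rceil> + 1"
text \<open>More than 2 / \<delta> times a bound on the logarithm of the number of inputs. It is
  polynomial in X for fixed \<delta>, so an index has O(log X) bits.\<close>

definition m :: nat where "m = nat \<lceil>2 * (s * (n + (L + 2) * (n * d))) / \<delta>\<rceil> + 1"

lemma inv_eps: "1 \<le> 1 / \<epsilon>"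
  using eps by simp

lemma X_ge: "s \<le> X" "n \<le> X" "d + 1 \<le> X" "L \<le> X" "1 / \<epsilon> \<le> X" "4 \<le> X"
  using sdL inv_eps by (auto simp: X_def)

lemma Lambda_ge: "1 \<le> \<Lambda>"
proof -
  have "exp 1 \<le> (3 :: real)" using e_less_272 by simp
  then have "exp 1 \<le> X" using X_ge(6) by linarith
  then show ?thesis unfolding \<Lambda>_def using X_ge(6) by (subst ln_ge_iff) auto
qed

lemma Lambda_le: "\<Lambda> \<le> X"
  unfolding \<Lambda>_def using X_ge(6) ln_le_minus_one[of X] by linarith

lemma lam_ge: "8 \<le> lam" "\<Lambda> \<le> lam"
proof -
  have "8 * 1 \<le> c * \<Lambda>" using c Lambda_ge by (intro mult_mono) auto
  then show "8 \<le> lam" by (simp add: lam_def)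
  have "1 * \<Lambda> \<le> c * \<Lambda>" using c Lambda_ge by (intro mult_right_mono) auto
  then show "\<Lambda> \<le> lam" by (simp add: lam_def)
qed

lemma e_bounds: "0 < e" "e \<le> 1 / 8" "8 * e \<le> \<epsilon>"
  using eps by (simp_all add: e_def)

lemma q0_bounds: "16 * lam \<le> q0" "q0 \<le> 17 * lam"
proof -
  have nn: "0 \<le> 16 * lam" using lam_ge by simp
  show "16 * lam \<le> q0" unfolding q0_def by (rule ceiling_bounds[OF nn])
  show "q0 \<le> 17 * lam" using ceiling_bounds(2)[OF nn] lam_ge(1) unfolding q0_def by linarith
qed

lemma q_bounds: "3 * lam / e \<le> q" "q \<le> 4 * lam / e"
proof -
  have nn: "0 \<le> 3 * lam / e" using lam_ge e_bounds by simp
  show "3 * lam / e \<le> q" unfolding q_def by (rule ceiling_bounds[OF nn])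
  have "1 \<le> lam / e" using lam_ge e_bounds by (simp add: pos_le_divide_eq)
  then have "3 * lam / e + 1 \<le> 4 * lam / e" by (simp add: field_simps)
  then show "q \<le> 4 * lam / e" using ceiling_bounds(2)[OF nn] unfolding q_def by linarith
qed

lemma q_pos: "0 < real q0" "0 < real q"
proof -
  show "0 < real q0" using q0_bounds(1) lam_ge(1) by linarith
  have "0 < 3 * lam / e" using lam_ge e_bounds by simp
  then show "0 < real q" using q_bounds(1) by linarith
qed

lemma eta_pos: "0 < \<eta>0" "0 < \<eta>"
  using q_pos e_bounds by (simp_all add: \<eta>0_def \<eta>_def)

lemma q_eta: "real q0 * \<eta>0 \<le> 1 / 16" "real q * \<eta> \<le> e / 2"
  using q_pos by (simp_all add: \<eta>0_def \<eta>_def)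

lemma eta_le: "\<eta> \<le> \<eta>0"
proof -
  have "8 * e * real q0 \<le> 1 * real q0" using e_bounds by (intro mult_right_mono) auto
  also have "\<dots> \<le> 17 * lam" using q0_bounds by simp
  also have "\<dots> \<le> 24 * lam" using lam_ge by simp
  also have "\<dots> \<le> 3 * lam / e" using e_bounds lam_ge by (simp add: pos_le_divide_eq)
  also have "\<dots> \<le> q" by (rule q_bounds)
  finally show ?thesis using q_pos by (simp add: \<eta>_def \<eta>0_def field_simps)
qed

lemma t0_bounds: "2 * lam / t0 \<le> \<eta>0" "1 \<le> t0" "t0 \<le> 545 * lam\<^sup>2"
proof -
  have nn: "0 < 2 * lam / \<eta>0" using lam_ge eta_pos by simp
  have t: "2 * lam / \<eta>0 \<le> t0" unfolding t0_def by (rule ceiling_bounds) (use nn in simp)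
  then have pos: "0 < real t0" using nn by linarith
  then show "1 \<le> t0" by simp
  show "2 * lam / t0 \<le> \<eta>0" using t pos eta_pos by (simp add: field_simps)
  have "2 * lam / \<eta>0 = 32 * lam * q0" by (simp add: \<eta>0_def)
  also have "\<dots> \<le> 32 * lam * (17 * lam)" using q0_bounds lam_ge by (intro mult_left_mono) auto
  finally have "2 * lam / \<eta>0 \<le> 544 * lam\<^sup>2" by (simp add: power2_eq_square)
  moreover have "real t0 \<le> 2 * lam / \<eta>0 + 1" unfolding t0_def by (rule ceiling_bounds) (use nn in simp)
  moreover have "1 * 1 \<le> lam * lam" using lam_ge by (intro mult_mono) auto
  ultimately show "t0 \<le> 545 * lam\<^sup>2" by (simp add: power2_eq_square)
qed

lemma C_bounds: "0 < C" "8 * (2 * lam) / C \<le> \<eta>" "C \<le> 8192 * lam\<^sup>2 / \<epsilon>\<^sup>2"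
proof -
  show "0 < C" using lam_ge eta_pos by (simp add: C_def)
  show "8 * (2 * lam) / C \<le> \<eta>" using lam_ge eta_pos by (simp add: C_def)
  have "C = 32 * lam / e * q" using q_pos e_bounds by (simp add: C_def \<eta>_def)
  also have "\<dots> \<le> 32 * lam / e * (4 * lam / e)" using q_bounds lam_ge e_bounds by (intro mult_left_mono) auto
  also have "\<dots> = 8192 * lam\<^sup>2 / \<epsilon>\<^sup>2" by (simp add: e_def power2_eq_square)
  finally show "C \<le> 8192 * lam\<^sup>2 / \<epsilon>\<^sup>2" .
qed

lemma eps_square: "1 \<le> 1 / \<epsilon>\<^sup>2"
  using eps by (simp add: power_le_one)

lemma lam_square_ge: "1 \<le> lam\<^sup>2"
  using lam_ge(1) by (simp add: one_le_power)

lemma K_bounds: "t0 + 1 + C * d \<le> K" "K \<le> 9000 * lam\<^sup>2 * (d / \<epsilon>\<^sup>2)"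
proof -
  have nn: "0 \<le> t0 + 1 + C * d" using C_bounds by simp
  show "t0 + 1 + C * d \<le> K" unfolding K_def by (rule ceiling_bounds[OF nn])
  have "1 * 1 \<le> d * (1 / \<epsilon>\<^sup>2)" using sdL eps_square by (intro mult_mono) auto
  then have D: "1 \<le> d / \<epsilon>\<^sup>2" by simp
  have "real K \<le> (t0 + 1 + C * d) + 1" unfolding K_def by (rule ceiling_bounds[OF nn])
  also have "\<dots> \<le> (545 * lam\<^sup>2 + 1 + 8192 * lam\<^sup>2 / \<epsilon>\<^sup>2 * d) + 1"
    using t0_bounds C_bounds by (intro add_mono mult_right_mono) auto
  also have "\<dots> \<le> 547 * lam\<^sup>2 * 1 + 8192 * lam\<^sup>2 * (d / \<epsilon>\<^sup>2)" using lam_square_ge by simp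
  also have "\<dots> \<le> 547 * lam\<^sup>2 * (d / \<epsilon>\<^sup>2) + 8192 * lam\<^sup>2 * (d / \<epsilon>\<^sup>2)"
    using D by (intro add_right_mono mult_left_mono) auto
  also have "\<dots> \<le> 9000 * lam\<^sup>2 * (d / \<epsilon>\<^sup>2)" 
  proof -
    have "0 \<le> lam\<^sup>2 * (d / \<epsilon>\<^sup>2)" by simp
    then show ?thesis unfolding mult.assoc by linarith
  qed
  finally show "K \<le> 9000 * lam\<^sup>2 * (d / \<epsilon>\<^sup>2)" .
qed

lemma R_bounds: "1 \<le> R" "d \<le> 2 ^ R" "real (R + 1) \<le> 6 * ln (d + 1)" "real (R + 1) \<le> 6 * \<Lambda>"
proof -
  have l: "0 \<le> log 2 d" using sdL by simp
  show "1 \<le> R" by (simp add: R_def)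
  have "real d = 2 powr log 2 d" using sdL by simp
  also have "\<dots> \<le> 2 powr real (nat \<lceil>log 2 d\<rceil>)" using ceiling_bounds(1)[OF l] by (intro powr_mono) auto
  also have "\<dots> = 2 ^ nat \<lceil>log 2 d\<rceil>" by (rule powr_realpow) simp
  also have "\<dots> \<le> (2 :: real) ^ R" unfolding R_def by (rule power_increasing[OF le_add1]) simp
  finally have "real d \<le> real (2 ^ R)" by (simp only: of_nat_power of_nat_numeral)
  then show "d \<le> 2 ^ R" by (simp only: of_nat_le_iff)
  have "real (R + 1) \<le> log 2 d + 3" using ceiling_bounds(2)[OF l] by (simp add: R_def)
  moreover have "log 2 d \<le> 3 / 2 * ln d" using sdL by (intro log2_le) auto
  moreover have "ln (real d) \<le> ln (d + 1)" using sdL by simp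
  moreover have "2 / 3 \<le> ln (d + 1)"
  proof -
    have "2 / 3 \<le> ln (2 :: real)" by (rule ln2_ge_two_thirds)
    also have "\<dots> \<le> ln (d + 1)" using sdL by simp
    finally show ?thesis .
  qed
  ultimately show *: "real (R + 1) \<le> 6 * ln (d + 1)" by linarith
  have "ln (real d + 1) \<le> \<Lambda>" unfolding \<Lambda>_def using X_ge(3) by (intro ln_mono) auto
  then show "real (R + 1) \<le> 6 * \<Lambda>" using * by (simp add: add.commute)
qed

lemma exp_lam: "exp (- lam) = 1 / X ^ c"
proof -
  have "exp lam = X ^ c" using X_ge(6) by (simp add: lam_def \<Lambda>_def exp_of_nat_mult)
  then show ?thesis by (simp add: exp_minus inverse_eq_divide)
qed

lemma X_pow_le: "a \<le> b \<Longrightarrow> X ^ a \<le> X ^ b"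
  using X_ge(6) by (intro power_increasing) auto

text \<open>Here \<open>4 * 108020 \<le> 4000000\<close> collects the constants of the union bound, and \<open>65536 = 4 ^ 8\<close>
  pays for the factor \<open>X ^ 8\<close>.\<close>

lemma failure_bound:
  fixes \<beta> :: real
  assumes big: "4000000 * 65536 * real c ^ 2 \<le> \<delta> * 4 ^ c"
  defines "\<beta> \<equiv> 2 * d * exp (- lam)"
  shows "n * \<beta> \<le> e"
    and "(R + 1) * (s * K * \<beta> + 3 * s * d * exp (- (q0 / 16))) + 2 * d * exp (- (q * (e / 2))) \<le> \<delta> / 4"
proof -
  have Xc: "0 < X ^ c" "0 < X" "1 \<le> X" using X_ge(6) by simp_all
  have d: "d \<le> X" using X_ge(3) by linarith
  note Xs = X_ge(1,2,4,5)
  have nn: "0 \<le> 1 / \<epsilon>" using eps by simp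
  have prod3: "real n * real d * (1 / \<epsilon>) \<le> X * X * X" using Xs d nn Xc by (intro mult_mono) auto
  have "16 * X ^ 3 \<le> X ^ 2 * X ^ 3"
  proof (rule mult_right_mono)
    have "4 ^ 2 \<le> X ^ 2" using X_ge(6) by (intro power_mono) auto
    then show "16 \<le> X ^ 2" by simp
  qed (use Xc in auto)
  also have "\<dots> = X ^ 5" by (simp flip: power_add)
  also have "\<dots> \<le> X ^ c" using c by (intro X_pow_le) auto
  finally have X16: "16 * X ^ 3 \<le> X ^ c" .
  \<comment> \<open>16 is 2 * 8, from the 2 in \<open>\<beta>\<close> and from e = \<epsilon> /
    8.\<close>
  have "16 * (real n * real d * (1 / \<epsilon>)) \<le> X ^ c" using prod3 X16 by (simp add: power3_eq_cube)
  then have "16 * (n * d) \<le> \<epsilon> * X ^ c" using eps by (simp add: field_simps)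
  then show "n * \<beta> \<le> e" using Xc by (simp add: \<beta>_def exp_lam e_def field_simps)
  have e1: "exp (- (q0 / 16)) \<le> 1 / X ^ c" using q0_bounds(1) by (simp flip: exp_lam)
  have e2: "exp (- (q * (e / 2))) \<le> 1 / X ^ c"
  proof -
    have "3 * lam \<le> q * e" using q_bounds(1) e_bounds by (simp add: pos_divide_le_eq)
    then show ?thesis using lam_ge by (simp flip: exp_lam)
  qed
  have lamX: "lam\<^sup>2 \<le> c\<^sup>2 * X\<^sup>2"
  proof -
    have "lam \<le> c * X" using Lambda_le by (auto simp: lam_def intro: mult_left_mono)
    then have "lam\<^sup>2 \<le> (c * X)\<^sup>2" using lam_ge by (intro power_mono) auto
    then show ?thesis by (simp add: power_mult_distrib)
  qed
  have KX: "K \<le> 9000 * c\<^sup>2 * X ^ 5"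
  proof -
    have "K \<le> 9000 * lam\<^sup>2 * (d / \<epsilon>\<^sup>2)" by (rule K_bounds)
    also have "d / \<epsilon>\<^sup>2 = d * ((1 / \<epsilon>) * (1 / \<epsilon>))" by (simp add: power2_eq_square)
    also have "9000 * lam\<^sup>2 * (d * ((1 / \<epsilon>) * (1 / \<epsilon>))) \<le> 9000 * (c\<^sup>2 * X\<^sup>2) * (X * (X * X))"
      using lamX d Xs nn Xc by (intro mult_mono mult_nonneg_nonneg) auto
    also have "X\<^sup>2 * (X * (X * X)) = X ^ 5" by (simp add: eval_nat_numeral)
    then have "9000 * (c\<^sup>2 * X\<^sup>2) * (X * (X * X)) = 9000 * c\<^sup>2 * X ^ 5" by (simp only: mult.assoc)
    finally show ?thesis .
  qed
  have c1: "1 \<le> real c ^ 2" using c by (simp add: one_le_power)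
  \<comment> \<open>\<open>s\<close> and \<open>d\<close> cost one factor X each and
    \<open>K\<close> costs X^5; the number of rounds adds the eighth.\<close>
  have "s * K * \<beta> = (2 * (real s * real d * real K)) / X ^ c" by (simp add: \<beta>_def exp_lam)
  also have "\<dots> \<le> (2 * (X * X * (9000 * c\<^sup>2 * X ^ 5))) / X ^ c"
    using KX Xs d Xc by (intro divide_right_mono mult_left_mono mult_mono) auto
  also have "2 * (X * X * (9000 * c\<^sup>2 * X ^ 5)) = 18000 * c\<^sup>2 * X ^ 7"
  proof -
    have "X * X * X ^ 5 = X ^ 7" by (simp add: eval_nat_numeral)
    then show ?thesis by (simp add: mult_ac)
  qed
  finally have p1: "s * K * \<beta> \<le> 18000 * c\<^sup>2 * X ^ 7 / X ^ c" .
  have "3 * s * d * exp (- (q0 / 16)) \<le> 3 * X * X * (1 / X ^ c)"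
  proof (rule mult_mono[OF _ e1])
    have "real s * real d \<le> X * X" using Xs d Xc by (intro mult_mono) auto
    then show "real (3 * s * d) \<le> 3 * X * X" by simp
  qed (use Xc in auto)
  also have "\<dots> = 3 * 1 * X ^ 2 / X ^ c" by (simp add: power2_eq_square)
  also have "\<dots> \<le> 3 * c\<^sup>2 * X ^ 7 / X ^ c"
    using c1 Xc by (intro divide_right_mono mult_mono X_pow_le) auto
  finally have p2: "3 * s * d * exp (- (q0 / 16)) \<le> 3 * c\<^sup>2 * X ^ 7 / X ^ c" .
  have RX: "real (R + 1) \<le> 6 * X" using R_bounds(4) Lambda_le by linarith
  have "(R + 1) * (s * K * \<beta> + 3 * s * d * exp (- (q0 / 16))) \<le> 6 * X * (18003 * c\<^sup>2 * X ^ 7 / X ^ c)"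
  proof (rule mult_mono[OF RX])
    show "s * K * \<beta> + 3 * s * d * exp (- (q0 / 16)) \<le> 18003 * c\<^sup>2 * X ^ 7 / X ^ c"
      using p1 p2 by (simp add: add_divide_distrib[symmetric] distrib_right[symmetric])
    show "0 \<le> s * K * \<beta> + 3 * s * d * exp (- (q0 / 16))" by (simp add: \<beta>_def)
  qed (use Xc in auto)
  also have "\<dots> = 108018 * c\<^sup>2 * X ^ 8 / X ^ c"
  proof -
    have "X * X ^ 7 = X ^ 8" by (simp add: eval_nat_numeral)
    then show ?thesis by (simp add: mult_ac)
  qed
  finally have p3: "(R + 1) * (s * K * \<beta> + 3 * s * d * exp (- (q0 / 16))) \<le> 108018 * c\<^sup>2 * X ^ 8 / X ^ c" .
  have "2 * d * exp (- (q * (e / 2))) \<le> 2 * X * (1 / X ^ c)"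
    using e2 d Xc by (intro mult_mono) auto
  also have "\<dots> = 2 * 1 * X ^ 1 / X ^ c" by simp
  also have "\<dots> \<le> 2 * c\<^sup>2 * X ^ 8 / X ^ c"
    using c1 Xc by (intro divide_right_mono mult_mono X_pow_le) auto
  finally have p4: "2 * d * exp (- (q * (e / 2))) \<le> 2 * c\<^sup>2 * X ^ 8 / X ^ c" .
  have "X ^ 8 / X ^ c = 1 / X ^ (c - 8)" using c Xc by (simp add: power_diff)
  also have "\<dots> \<le> 1 / 4 ^ (c - 8)" using X_ge(6) by (intro divide_left_mono power_mono) auto
  also have "\<dots> = 65536 / 4 ^ c" using c by (simp add: power_diff)
  finally have p5: "X ^ 8 / X ^ c \<le> 65536 / 4 ^ c" .
  have "(R + 1) * (s * K * \<beta> + 3 * s * d * exp (- (q0 / 16))) + 2 * d * exp (- (q * (e / 2)))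
      \<le> 108020 * c\<^sup>2 * (X ^ 8 / X ^ c)"
    using p3 p4 by (simp add: add_divide_distrib[symmetric] distrib_right[symmetric])
  also have "\<dots> \<le> 108020 * c\<^sup>2 * (65536 / 4 ^ c)" using p5 by (intro mult_left_mono) auto
  also have "\<dots> \<le> \<delta> / 4"
  proof -
    have "4 * 108020 * c\<^sup>2 * 65536 \<le> 4000000 * 65536 * real c ^ 2" by simp
    then have "4 * 108020 * c\<^sup>2 * 65536 \<le> \<delta> * 4 ^ c" using big by linarith
    then show ?thesis by (simp add: field_simps)
  qed
  finally show "(R + 1) * (s * K * \<beta> + 3 * s * d * exp (- (q0 / 16))) + 2 * d * exp (- (q * (e / 2))) \<le> \<delta> / 4" .
qed

lemma sampling_fails_rarely:
  assumes big: "4000000 * 65536 * real c ^ 2 \<le> \<delta> * 4 ^ c"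
  shows "prob_of (Pi_pmf {..<Suc R} dflt (\<lambda>_. Pi_pmf ({..<s} \<times> {..<K}) dflt' (\<lambda>_. signs n)))
    {\<omega>. sampling_fails t0 C s n d R e A \<omega>} \<le> \<delta> / 4"
proof -
  interpret G: psd_form d "gram_form s n d A" by (rule psd_form_gram_form)
  obtain r w where rw: "r \<le> d" "\<And>a b. a < r \<Longrightarrow> b < r \<Longrightarrow> gram_form s n d A (w a) (w b) = of_bool (a = b)"
    "\<And>x y. gram_form s n d A x y = (\<Sum>a<r. gram_form s n d A x (w a) * gram_form s n d A y (w a))"
    by (rule G.orthonormal_basis) (rule that)
  interpret iso: isotropic s n d r A w "2 * lam"
  proof (rule isotropic.intro)
    show "gram_form s n d A (w a) (w b) = of_bool (a = b)" if "a < r" "b < r" for a b using that by (rule rw)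
    show "0 < 2 * lam" using lam_ge by simp
  qed (rule rw)+
  have \<beta>: "iso.\<beta> = 2 * d * exp (- lam)" by (simp add: iso.\<beta>_def)
  interpret ad: adaptive_sampling s n d r A w "2 * lam" R K t0 q q0 C \<eta> \<eta>0 e
  proof (intro adaptive_sampling.intro adaptive_sampling_axioms.intro)
    show "isotropic s n d r A w (2 * lam)" by (rule iso.isotropic_axioms)
    show "real n * iso.\<beta> \<le> e" unfolding \<beta> by (rule failure_bound(1)[OF big])
  qed (rule R_bounds sdL t0_bounds K_bounds C_bounds eta_le q_eta e_bounds)+
  have "prob_of (Pi_pmf {..<Suc R} dflt (\<lambda>_. Pi_pmf ({..<s} \<times> {..<K}) dflt' (\<lambda>_. signs n)))
    {\<omega>. sampling_fails t0 C s n d R e A \<omega>} \<le> (R + 1) * ad.\<rho> + 2 * d * exp (- (q * (e / 2)))"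
    unfolding sampling_fails_def using ad.adaptive_sampling_correct[OF sdL(2), of dflt dflt'] .
  also have "\<dots> \<le> \<delta> / 4" unfolding ad.\<rho>_def \<beta> by (rule failure_bound(2)[OF big])
  finally show ?thesis .
qed

lemma inputs_exp: "card {As. valid_input s n d L As} * exp (- (\<delta> * real m / 2)) < 1"
proof -
  define N where "N = real (s * (n + (L + 2) * (n * d)))"
  have "real (card {As. valid_input s n d L As}) \<le> real (((n + 1) * 2 ^ ((L + 2) * (n * d))) ^ s)"
    using valid_inputs_card(2)[of s n d L] by (simp only: of_nat_le_iff)
  also have "\<dots> = ((real n + 1) * 2 ^ ((L + 2) * (n * d))) ^ s"
    by (simp only: of_nat_power of_nat_mult of_nat_add of_nat_1 of_nat_numeral)
  also have "\<dots> \<le> (exp (real n) * exp 1 ^ ((L + 2) * (n * d))) ^ s"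
  proof (intro power_mono mult_mono)
    show "real n + 1 \<le> exp (real n)" using exp_ge_add_one_self[of "real n"] by linarith
    show "(2 :: real) \<le> exp 1" using exp_ge_add_one_self[of 1] by simp
  qed auto
  also have "\<dots> = exp N"
    by (simp add: N_def exp_of_nat_mult[symmetric] exp_add[symmetric] algebra_simps)
  finally have card: "real (card {As. valid_input s n d L As}) \<le> exp N" .
  have "2 * N / \<delta> < m"
  proof -
    have "2 * N / \<delta> = real (2 * (s * (n + (L + 2) * (n * d)))) / \<delta>"
      by (simp only: N_def of_nat_mult of_nat_numeral)
    moreover have "0 \<le> real (2 * (s * (n + (L + 2) * (n * d)))) / \<delta>" using delta by simp
    ultimately show ?thesis
      using ceiling_bounds(1)[of "real (2 * (s * (n + (L + 2) * (n * d)))) / \<delta>"]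
      unfolding m_def of_nat_add by linarith
  qed
  then have "N < \<delta> * real m / 2" using delta by (simp add: field_simps)
  then have "exp N * exp (- (\<delta> * real m / 2)) < 1" by (simp flip: exp_add)
  moreover have "card {As. valid_input s n d L As} * exp (- (\<delta> * real m / 2)) \<le> exp N * exp (- (\<delta> * real m / 2))"
    using card by (intro mult_right_mono) auto
  ultimately show ?thesis by linarith
qed

lemma m_le: "m \<le> 8 * X ^ 4 / \<delta> + 2"
proof -
  have "real (s * (n + (L + 2) * (n * d))) \<le> 4 * X ^ 4"
  proof -
    have d: "d \<le> X" and X1: "1 \<le> X" using X_ge by linarith+
    have "real (n * d) \<le> X * X" unfolding of_nat_mult using X_ge d X1 by (intro mult_mono) auto
    moreover have "real (L + 2) \<le> 3 * X" using X_ge sdL by simp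
    ultimately have "real ((L + 2) * (n * d)) \<le> 3 * X * (X * X)"
      unfolding of_nat_mult[of "L + 2"] using X1 by (intro mult_mono) auto
    moreover have "real n \<le> X * (X * X)"
      using X_ge(2) X1 mult_mono[of 1 X 1 X] by (simp add: mult_le_cancel_left1 order_trans)
    ultimately have "real (n + (L + 2) * (n * d)) \<le> 4 * (X * (X * X))" by simp
    then have "real s * real (n + (L + 2) * (n * d)) \<le> X * (4 * (X * (X * X)))"
      using X_ge X1 by (intro mult_mono) auto
    then show ?thesis by (simp add: eval_nat_numeral)
  qed
  then have le: "real (2 * (s * (n + (L + 2) * (n * d)))) / \<delta> \<le> 8 * X ^ 4 / \<delta>"
    unfolding of_nat_mult[of 2] using delta by (intro divide_right_mono) auto
  have "0 \<le> real (2 * (s * (n + (L + 2) * (n * d)))) / \<delta>" using delta by simp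
  from ceiling_bounds(2)[OF this] le show ?thesis unfolding m_def of_nat_add by linarith
qed

text \<open>The factor 3 / 2 converts natural to binary logarithms, 7 is the degree of the bound on
  \<open>m\<close> and \<open>K\<close> in X, and the final 2 is the slack of
  \<open>code_width\<close>.\<close>

definition W :: real where "W = 3 / 2 * (\<bar>ln (8 / \<delta> + 3 + 9000 * (real c)\<^sup>2)\<bar> + 7) + 2"

lemma width_to_server: "log 2 (max m K + 1) + 2 \<le> W * \<Lambda>"
proof -
  define D where "D = 8 / \<delta> + 3 + 9000 * (real c)\<^sup>2"
  have X1: "1 \<le> X" and d: "d \<le> X" using X_ge by linarith+
  have D1: "1 \<le> D" using delta by (simp add: D_def add_increasing)
  have K: "K \<le> 9000 * (real c)\<^sup>2 * X ^ 7"
  proof -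
    have "lam\<^sup>2 \<le> (c * X)\<^sup>2"
      using Lambda_le lam_ge by (intro power_mono) (auto simp: lam_def intro: mult_left_mono)
    moreover have "d / \<epsilon>\<^sup>2 \<le> X * (X * X)"
    proof -
      have "real d * ((1 / \<epsilon>) * (1 / \<epsilon>)) \<le> X * (X * X)"
        using d X_ge(5) X1 eps by (intro mult_mono) auto
      then show ?thesis by (simp add: power2_eq_square)
    qed
    ultimately have "9000 * lam\<^sup>2 * (d / \<epsilon>\<^sup>2) \<le> 9000 * (c * X)\<^sup>2 * (X * (X * X))"
      by (intro mult_mono) auto
    also have "\<dots> = 9000 * (real c)\<^sup>2 * X ^ 5" by (simp add: power_mult_distrib eval_nat_numeral)
    also have "\<dots> \<le> 9000 * (real c)\<^sup>2 * X ^ 7" by (intro mult_left_mono X_pow_le) auto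
    finally show ?thesis using K_bounds(2) by linarith
  qed
  have "real m \<le> 8 / \<delta> * X ^ 7 + 2 * X ^ 7"
  proof -
    have "8 / \<delta> * X ^ 4 \<le> 8 / \<delta> * X ^ 7" using delta by (intro mult_left_mono X_pow_le) auto
    moreover have "1 \<le> X ^ 7" using X1 by (rule one_le_power)
    ultimately show ?thesis using m_le by simp
  qed
  moreover have "0 \<le> 8 / \<delta> * X ^ 7" "0 \<le> 9000 * (real c)\<^sup>2 * X ^ 7" "1 \<le> X ^ 7"
    using delta X1 by simp_all
  ultimately have "real (max m K) + 1 \<le> D * X ^ 7"
    using K by (simp only: D_def distrib_right)
  then have "ln (real (max m K) + 1) \<le> ln (D * X ^ 7)" by (intro ln_mono) auto
  also have "\<dots> = ln D + 7 * \<Lambda>" using D1 X1 by (simp add: ln_mult ln_realpow \<Lambda>_def)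
  also have "\<dots> \<le> \<bar>ln D\<bar> * \<Lambda> + 7 * \<Lambda>"
  proof -
    have "\<bar>ln D\<bar> * 1 \<le> \<bar>ln D\<bar> * \<Lambda>" using Lambda_ge by (intro mult_left_mono) auto
    then show ?thesis using abs_ge_self[of "ln D"] by linarith
  qed
  finally have "ln (real (max m K) + 1) \<le> (\<bar>ln D\<bar> + 7) * \<Lambda>" by (simp add: distrib_right)
  then have "log 2 (real (max m K) + 1) \<le> 3 / 2 * ((\<bar>ln D\<bar> + 7) * \<Lambda>)"
    using log2_le[of "real (max m K) + 1"] by simp
  moreover have "W * \<Lambda> = 3 / 2 * ((\<bar>ln D\<bar> + 7) * \<Lambda>) + 2 * \<Lambda>"
    unfolding W_def D_def by (simp only: distrib_right mult.assoc)
  ultimately show ?thesis using Lambda_ge unfolding of_nat_add of_nat_1 by linarith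
qed

lemma width_to_coordinator: "log 2 (2 * (real n * 2 ^ L) + 1) + 2 \<le> 6 * L * \<Lambda>"
proof -
  have X1: "1 \<le> X" using X_ge by linarith
  have "2 * (real n * 2 ^ L) + 1 \<le> X\<^sup>2 * 2 ^ L"
  proof -
    have "2 * real n + 1 \<le> 4 * X" using X_ge(2,6) by linarith
    also have "\<dots> \<le> X\<^sup>2" using X_ge(6) by (simp add: power2_eq_square)
    finally have "(2 * real n + 1) * 2 ^ L \<le> X\<^sup>2 * 2 ^ L" by (rule mult_right_mono) simp
    moreover have "(2 * real n + 1) * 2 ^ L = 2 * (real n * 2 ^ L) + 2 ^ L" by (simp add: algebra_simps)
    moreover have "(1 :: real) \<le> 2 ^ L" by simp
    ultimately show ?thesis by linarith
  qed
  then have "log 2 (2 * (real n * 2 ^ L) + 1) \<le> log 2 (X\<^sup>2 * 2 ^ L)"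
    by (intro log_mono) (auto intro: add_nonneg_pos)
  also have "\<dots> = 2 * log 2 X + L"
    using X1 by (simp add: log_mult log_nat_power)
  also have "\<dots> \<le> 3 * \<Lambda> + L" using log2_le[OF X1] by (simp add: \<Lambda>_def)
  finally have 1: "log 2 (2 * (real n * 2 ^ L) + 1) + 2 \<le> 3 * \<Lambda> + L + 2" by simp
  have "real L * 1 \<le> L * \<Lambda>" "1 * \<Lambda> \<le> L * \<Lambda>" using Lambda_ge sdL by (auto intro!: mult_mono)
  then show ?thesis using 1 Lambda_ge unfolding mult.assoc by linarith
qed

text \<open>The \<open>t0\<close> sketches owed to every server make up the s d part, the
  leverage-driven ones the d^2 / \<epsilon>^2 part.\<close>

lemma row_total: "s + d * (s * (t0 + 1) + C * d) \<le> 8192 * lam\<^sup>2 * (real s * real d + (real d)\<^sup>2 / \<epsilon>\<^sup>2)"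
proof -
  have "real s * 1 \<le> real s * real d" using sdL by (intro mult_left_mono) auto
  moreover have "real s * real d * 1 \<le> real s * real d * lam\<^sup>2"
    using lam_square_ge by (intro mult_left_mono) auto
  moreover have "real s * real d * real t0 \<le> real s * real d * (545 * lam\<^sup>2)"
    using t0_bounds by (intro mult_left_mono) auto
  moreover have "C * (real d)\<^sup>2 \<le> 8192 * lam\<^sup>2 / \<epsilon>\<^sup>2 * (real d)\<^sup>2" using C_bounds by (intro mult_right_mono) auto
  moreover have "s + d * (s * (t0 + 1) + C * d) = real s + real s * real d + real s * real d * real t0 + C * (real d)\<^sup>2"
    by (simp add: algebra_simps power2_eq_square)
  moreover have "0 \<le> real s * real d * lam\<^sup>2" by simp
  ultimately have "s + d * (s * (t0 + 1) + C * d) \<le> 8192 * (real s * real d * lam\<^sup>2) + 8192 * lam\<^sup>2 / \<epsilon>\<^sup>2 * (real d)\<^sup>2"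
    by linarith
  then show ?thesis by (simp add: algebra_simps)
qed

text \<open>36 * 8192 c^2 comes from 6 \<Lambda> rounds, 6 L \<Lambda> bits per integer and 8192
  lam^2 in \<open>row_total\<close>; as lam = c \<Lambda>, this is the fourth power of \<Lambda>.
  \<open>12 * W\<close> pays for the messages to the servers, 6 for the number of rounds.\<close>

definition B :: real where "B = 36 * 8192 * (real c)\<^sup>2 + 12 * W + 6"

lemma B_ge: "0 \<le> W" "6 \<le> B" "12 * W \<le> B"
  by (auto simp: W_def B_def)

lemma polylog_eq: "polylog k s n d L \<epsilon> = \<Lambda> ^ k"
  by (simp add: polylog_def \<Lambda>_def X_def)

lemma protocol_exists:
  assumes big: "4000000 * 65536 * real c ^ 2 \<le> \<delta> * 4 ^ c"
  shows "\<exists>P :: (int mat, real mat \<times> real mat) protocol.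
       constructs_subspace_embedding \<delta> \<epsilon> P s n d L \<and>
       real (rounds P) \<le> B * ln (real d + 1) \<and>
       (\<forall>As. valid_input s n d L As \<longrightarrow>
          (\<forall>\<omega> \<in> set_pmf (coins P s).
             real (total_bits P As \<omega>)
               \<le> B * real L * (real s * real d + real d ^ 2 / \<epsilon> ^ 2) * polylog 4 s n d L \<epsilon> \<and>
             real (bits_to_servers P As \<omega>) \<le> B * real s * polylog 4 s n d L \<epsilon>))"
proof -
  let ?T = "Pi_pmf {..<Suc R} (\<lambda>_ _. False) (\<lambda>_. Pi_pmf ({..<s} \<times> {..<K}) (\<lambda>_. False) (\<lambda>_. signs n))"
  let ?bad = "\<lambda>As. sampling_fails t0 C s n d R e (entries_of As)"
  have "\<exists>cz. (\<forall>z<m. cz z \<in> set_pmf ?T) \<and>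
      (\<forall>As\<in>{As. valid_input s n d L As}. card {z. z < m \<and> ?bad As (cz z)} \<le> \<delta> * m)"
    using inputs_exp delta sampling_fails_rarely[OF big] valid_inputs_card(1)
    by (intro few_random_strings finite_set_Pi_pmf finite_set_signs) auto
  then obtain cz where cz: "\<And>As. valid_input s n d L As \<Longrightarrow> card {z. z < m \<and> ?bad As (cz z)} \<le> \<delta> * m"
    by auto
  have N1: "1 \<le> max m K + 1" by simp
  obtain w1 where w1: "1 \<le> w1" "max m K + 1 \<le> 2 ^ w1" "w1 \<le> log 2 (max m K + 1) + 2"
    by (rule code_width[OF N1]) (rule that)
  have N2: "1 \<le> 2 * (n * 2 ^ L) + 1" by simp
  obtain w2 where w2: "1 \<le> w2" "2 * (n * 2 ^ L) + 1 \<le> 2 ^ w2" "w2 \<le> log 2 (real (2 * (n * 2 ^ L) + 1)) + 2"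
    by (rule code_width[OF N2]) (rule that)
  let ?V1 = "{0..int (max m K)}" and ?V2 = "{- (int n * 2 ^ L)..int n * 2 ^ L}"
  have "card ?V1 = nat (int (max m K + 1))" by (simp add: add.commute)
  then have V1: "card ?V1 \<le> 2 ^ w1" using w1(2) by (simp only: nat_int)
  obtain encC decC where Ccode: "fixed_width w1 ?V1 encC decC"
    using fixed_width_code[OF finite_atLeastAtMost_int V1 w1(1)] by blast
  have "card ?V2 = nat (int (2 * (n * 2 ^ L) + 1))" by simp
  then have V2: "card ?V2 \<le> 2 ^ w2" using w2(2) by (simp only: nat_int)
  obtain encS decS where Scode: "fixed_width w2 ?V2 encS decS"
    using fixed_width_code[OF finite_atLeastAtMost_int V2 w2(1)] by blast
  interpret pr: coordinator_protocol s n d L m t0 R K w1 w2 C cz encC encS decC decS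
  proof
    show "1 \<le> m" by (simp add: m_def)
    show "0 \<le> C" using C_bounds by simp
  qed (use sdL K_bounds Ccode Scode in auto)
  have W1: "w1 \<le> W * \<Lambda>" using w1(3) width_to_server by linarith
  have W2: "w2 \<le> 6 * L * \<Lambda>"
  proof -
    have "real (2 * (n * 2 ^ L) + 1) = 2 * (real n * 2 ^ L) + 1" by simp
    then show ?thesis using w2(3) width_to_coordinator by (simp only:)
  qed
  have L0: "0 \<le> \<Lambda>" using Lambda_ge by simp
  have L4: "\<Lambda>\<^sup>2 \<le> \<Lambda> ^ 4" using Lambda_ge by (intro power_increasing) auto
  have bits: "real (bits_to_servers pr.P As \<omega>) \<le> 12 * W * s * \<Lambda> ^ 4 \<and>
      real (total_bits pr.P As \<omega>) \<le> B * real L * (real s * real d + real d ^ 2 / \<epsilon> ^ 2) * \<Lambda> ^ 4"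
    if valid: "valid_input s n d L As" and w: "\<omega> \<in> set_pmf (coins pr.P s)" for As \<omega>
  proof -
    obtain z co where zc: "\<omega> = (z, co)" by (cases \<omega>)
    have "0 \<in> {..<m}" by (simp add: m_def)
    then have ne: "{..<m} \<noteq> {}" by blast
    have z: "z < m" using w ne by (auto simp: zc coins_def pr.P_def)
    have "real (bits_to_servers pr.P As \<omega>) = s * (real (R + 1) * (2 * real w1))"
      unfolding zc pr.bits_to_servers_eq[OF valid z] by (simp add: distrib_right)
    also have "\<dots> \<le> s * ((6 * \<Lambda>) * (2 * (W * \<Lambda>)))"
      using R_bounds(4) W1 L0 B_ge by (intro mult_left_mono mult_mono) auto
    also have "\<dots> = 12 * W * s * \<Lambda>\<^sup>2" by (simp add: power2_eq_square)
    also have "\<dots> \<le> 12 * W * s * \<Lambda> ^ 4" using L4 B_ge by (intro mult_left_mono) auto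
    finally have S: "real (bits_to_servers pr.P As \<omega>) \<le> 12 * W * s * \<Lambda> ^ 4" .
    let ?Q = "real s * real d + (real d)\<^sup>2 / \<epsilon>\<^sup>2"
    have Q: "s \<le> L * ?Q"
    proof -
      have "1 * (real s * 1) \<le> L * (real s * real d)" using sdL by (intro mult_mono) auto
      also have "\<dots> \<le> L * ?Q" by (intro mult_left_mono) auto
      finally show ?thesis by simp
    qed
    have "real (bits_to_coordinator pr.P As \<omega>) \<le> real (R + 1) * (w2 * (s + d * (s * (t0 + 1) + C * d)))"
      unfolding zc using pr.bits_to_coordinator_le[OF valid z] by simp
    also have "\<dots> \<le> (6 * \<Lambda>) * ((6 * L * \<Lambda>) * (8192 * lam\<^sup>2 * ?Q))"
      using R_bounds(4) W2 row_total L0 C_bounds by (intro mult_mono) auto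
    also have "\<dots> = 36 * 8192 * (real c)\<^sup>2 * (L * ?Q) * \<Lambda> ^ 4"
      by (simp add: lam_def power_mult_distrib eval_nat_numeral mult_ac)
    finally have "real (bits_to_coordinator pr.P As \<omega>) \<le> 36 * 8192 * (real c)\<^sup>2 * (L * ?Q) * \<Lambda> ^ 4" .
    moreover have "12 * W * s * \<Lambda> ^ 4 \<le> 12 * W * (L * ?Q) * \<Lambda> ^ 4"
      using Q B_ge L0 by (intro mult_right_mono mult_left_mono) auto
    ultimately have "real (total_bits pr.P As \<omega>) \<le> (36 * 8192 * (real c)\<^sup>2 + 12 * W) * (L * ?Q) * \<Lambda> ^ 4"
      using S unfolding total_bits_def of_nat_add distrib_right by linarith
    also have "\<dots> \<le> B * (L * ?Q) * \<Lambda> ^ 4"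
      using L0 by (intro mult_right_mono) (auto simp: B_def)
    finally show ?thesis using S by (simp add: mult.assoc)
  qed
  have "real (bits_to_servers pr.P As \<omega>) \<le> B * s * \<Lambda> ^ 4"
    if "valid_input s n d L As" "\<omega> \<in> set_pmf (coins pr.P s)" for As \<omega>
  proof -
    have "12 * W * s * \<Lambda> ^ 4 \<le> B * s * \<Lambda> ^ 4" using B_ge L0 by (intro mult_right_mono) auto
    then show ?thesis using bits[OF that] by linarith
  qed
  moreover have "constructs_subspace_embedding \<delta> \<epsilon> pr.P s n d L"
    using cz e_bounds eps by (intro pr.constructs[of e]) auto
  moreover have "real (rounds pr.P) \<le> B * ln (real d + 1)"
  proof -
    have "6 * ln (real d + 1) \<le> B * ln (real d + 1)" using B_ge by (intro mult_right_mono) auto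
    then show ?thesis using R_bounds(3) by (simp add: pr.P_def add.commute)
  qed
  ultimately show ?thesis using bits unfolding polylog_eq by blast
qed

end

theorem theorem2p8:
  fixes \<delta> :: real
  assumes "0 < \<delta>" and "\<delta> < 1"
  shows "\<exists>(C::real) (k::nat). \<forall>(s::nat) (n::nat) (d::nat) (L::nat) (\<epsilon>::real).
    1 \<le> s \<and> 1 \<le> d \<and> 1 \<le> L \<and> 0 < \<epsilon> \<and> \<epsilon> < 1 \<longrightarrow>
    (\<exists>P :: (int mat, real mat \<times> real mat) protocol.
       constructs_subspace_embedding \<delta> \<epsilon> P s n d L \<and>
       real (rounds P) \<le> C * ln (real d + 1) \<and>
       (\<forall>As. valid_input s n d L As \<longrightarrow>
          (\<forall>\<omega> \<in> set_pmf (coins P s).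
             real (total_bits P As \<omega>)
               \<le> C * real L * (real s * real d + real d ^ 2 / \<epsilon> ^ 2) * polylog k s n d L \<epsilon> \<and>
             real (bits_to_servers P As \<omega>) \<le> C * real s * polylog k s n d L \<epsilon>)))"
proof -
  \<comment> \<open>\<open>c\<close> and with it the constant \<open>B\<close> depend on \<delta>
    only, so both can be fixed before the other parameters.\<close>
  obtain c :: nat where hc: "8 \<le> c" "4000000 * 65536 * real c ^ 2 \<le> \<delta> * 4 ^ c"
    using quadratic_below_exponential[OF assms(1), of "4000000 * 65536"] by blast
  show ?thesis
  proof (intro exI[of _ "parameters.B c \<delta>"] exI[of _ 4] allI impI)
    fix s n d L :: nat and \<epsilon> :: real
    assume "1 \<le> s \<and> 1 \<le> d \<and> 1 \<le> L \<and> 0 < \<epsilon> \<and> \<epsilon> < 1"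
    then interpret parameters s n d L c \<epsilon> \<delta>
      by unfold_locales (use hc assms in auto)
    show "\<exists>P :: (int mat, real mat \<times> real mat) protocol.
       constructs_subspace_embedding \<delta> \<epsilon> P s n d L \<and>
       real (rounds P) \<le> B * ln (real d + 1) \<and>
       (\<forall>As. valid_input s n d L As \<longrightarrow>
          (\<forall>\<omega> \<in> set_pmf (coins P s).
             real (total_bits P As \<omega>)
               \<le> B * real L * (real s * real d + real d ^ 2 / \<epsilon> ^ 2) * polylog 4 s n d L \<epsilon> \<and>
             real (bits_to_servers P As \<omega>) \<le> B * real s * polylog 4 s n d L \<epsilon>))"
      by (rule protocol_exists[OF hc(2)])
  qed
qed

end
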